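(* Let $K$ be a knot represented as the closure of an $n$-braid $\beta_n$, and let $\alpha$ satisfy $\alpha,2\alpha,\dots,n\alpha\notin\mathbb Z$. Then $$N^\alpha_r(K)=\sum_{\gamma\in n\alpha+H_{(n-1)(r-1)+1}}\mathsf d(\gamma)\,\chi_{\rho_\gamma}(\beta_n).$$
   Context: Fix $r\ge2$, $q=e^{\pi\sqrt{-1}/r}$, $\{x\}=q^x-q^{-x}$, $q^x=e^{\pi\sqrt{-1}x/r}$. $\mathcal C$ is the ribbon category of finite-dimensional weight modules over the unrolled quantum group $\overline U^H_q\mathfrak{sl}(2)$ (braiding from Ohtsuki's truncated $R$-matrix, Ohtsuki's twist); $\mathrm{Br}_n$ acts on $V^{\otimes n}$ via $\sigma_i\mapsto\mathrm{id}^{\otimes(i-1)}\otimes c_{V,V}\otimes\mathrm{id}^{\otimes(n-i-1)}$. $V_\alpha$ is the $r$-dimensional highest weight module of highest weight $\alpha+r-1$. Modified dimension $\mathsf d(\alpha)=(-1)^{r-1}r\{\alpha\}/\{r\alpha\}$. $H_k=\{k-1,k-3,\dots,-(k-1)\}$, so $n\alpha+H_{(n-1)(r-1)+1}=\{n\alpha+(n-1)(r-1)-2m:0\le m\le(n-1)(r-1)\}$. For $\gamma=n\alpha+(n-1)(r-1)-2m$, $\rho_\gamma:\mathrm{Br}_n\to\mathrm{End}(\mathrm{Hom}_{\mathcal C}(V_\gamma,V_\alpha^{\otimes n}))$ is $\rho_\gamma(\beta)(Y)=\beta\circ Y$ and $\chi_{\rho_\gamma}$ its character. Renormalized invariant: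 closing strands $2,\dots,n$ of $\beta_n$ on the right (blackboard framing) gives a $(1,1)$-tangle colored by $V_\alpha$ whose Reshetikhin–Turaev evaluation is $\langle T\rangle\,\mathrm{id}_{V_\alpha}$ with $\langle T\rangle\in\mathbb C$; then $N^\alpha_r(K):=\mathsf d(\alpha)\langle T\rangle$ (Geer–Patureau-Mirand–Turaev). *)

theory Defs
  imports Complex_Main "Jordan_Normal_Form.Matrix"
begin

definition qp :: "nat \<Rightarrow> complex \<Rightarrow> complex" where
  "qp r x = exp (pi * \<i> * x / of_nat r)"
definition qbr :: "nat \<Rightarrow> complex \<Rightarrow> complex" where
  "qbr r x = qp r x - qp r (- x)"
definition qint :: "nat \<Rightarrow> complex \<Rightarrow> complex" where
  "qint r x = qbr r x / qbr r 1"

definition mdim :: "nat \<Rightarrow> complex \<Rightarrow> complex" where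
  "mdim r a = (-1) ^ (r - 1) * of_nat r * qbr r a / qbr r (of_nat r * a)"

definition kron :: "complex mat \<Rightarrow> complex mat \<Rightarrow> complex mat" where
  "kron A B = mat (dim_row A * dim_row B) (dim_col A * dim_col B)
     (\<lambda>(i,j). A $$ (i div dim_row B, j div dim_col B) * B $$ (i mod dim_row B, j mod dim_col B))"

(* A finite-dimensional weight module, given by the action of E, F, H, K = q^H, K^{-1} *)
record umod =
  actE :: "complex mat"
  actF :: "complex mat"
  actH :: "complex mat"
  actK :: "complex mat"
  actKi :: "complex mat"

definition mdimension :: "umod \<Rightarrow> nat" where
  "mdimension M = dim_row (actH M)"

definition wt :: "nat \<Rightarrow> complex \<Rightarrow> nat \<Rightarrow> complex" where
  "wt r a i = a + of_nat r - 1 - 2 * of_nat i"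

(* V_a: r-dimensional highest weight module of highest weight a + r - 1,
   basis v_0..v_{r-1}, F v_i = v_{i+1}, E v_i = [i][a+r-i] v_{i-1}, H v_i = (a+r-1-2i) v_i *)
definition Vmod :: "nat \<Rightarrow> complex \<Rightarrow> umod" where
  "Vmod r a = \<lparr> actE = mat r r (\<lambda>(i,j). if j = i + 1 then qint r (of_nat j) * qint r (a + of_nat r - of_nat j) else 0),
               actF = mat r r (\<lambda>(i,j). if i = j + 1 then 1 else 0),
               actH = mat r r (\<lambda>(i,j). if i = j then wt r a i else 0),
               actK = mat r r (\<lambda>(i,j). if i = j then qp r (wt r a i) else 0),
               actKi = mat r r (\<lambda>(i,j). if i = j then qp r (- wt r a i) else 0) \<rparr>"

(* tensor product of modules via the coproduct
   Delta E = 1 (x) E + E (x) K,  Delta F = K^{-1} (x) F + F (x) 1,  Delta H = H (x) 1 + 1 (x) H,  Delta K = K (x) K *)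
definition tens :: "umod \<Rightarrow> umod \<Rightarrow> umod" where
  "tens M N = (let m = mdimension M; n = mdimension N in
     \<lparr> actE = kron (1\<^sub>m m) (actE N) + kron (actE M) (actK N),
       actF = kron (actKi M) (actF N) + kron (actF M) (1\<^sub>m n),
       actH = kron (actH M) (1\<^sub>m n) + kron (1\<^sub>m m) (actH N),
       actK = kron (actK M) (actK N),
       actKi = kron (actKi M) (actKi N) \<rparr>)"

definition unitmod :: umod where
  "unitmod = \<lparr> actE = 0\<^sub>m 1 1, actF = 0\<^sub>m 1 1, actH = 0\<^sub>m 1 1, actK = 1\<^sub>m 1, actKi = 1\<^sub>m 1 \<rparr>"

fun tpow :: "umod \<Rightarrow> nat \<Rightarrow> umod" where
  "tpow M 0 = unitmod"
| "tpow M (Suc n) = tens (tpow M n) M"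

definition msum :: "nat \<Rightarrow> nat \<Rightarrow> (nat \<Rightarrow> complex mat) \<Rightarrow> nat \<Rightarrow> complex mat" where
  "msum nr nc f k = foldr (\<lambda>i M. f i + M) [0..<k] (0\<^sub>m nr nc)"

(* Ohtsuki's truncated R-matrix on V_a (x) V_a:
   R = q^{H(x)H/2} sum_{k=0}^{r-1} {1}^{2k}/{k}! q^{k(k-1)/2} E^k (x) F^k *)
definition Rmat :: "nat \<Rightarrow> complex \<Rightarrow> complex mat" where
  "Rmat r a = (let V = Vmod r a;
      D = mat (r*r) (r*r) (\<lambda>(i,j). if i = j then qp r (wt r a (i div r) * wt r a (i mod r) / 2) else 0)
    in D * msum (r*r) (r*r) (\<lambda>k. (qbr r 1 ^ (2*k) / (\<Prod>j=1..k. qbr r (of_nat j)) * qp r (of_nat k * (of_nat k - 1) / 2))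
                   \<cdot>\<^sub>m kron (actE V ^\<^sub>m k) (actF V ^\<^sub>m k)) r)"

definition flipmat :: "nat \<Rightarrow> complex mat" where
  "flipmat r = mat (r*r) (r*r) (\<lambda>(i,j). if j = (i mod r) * r + i div r then 1 else 0)"

definition cmat :: "nat \<Rightarrow> complex \<Rightarrow> complex mat" where
  "cmat r a = flipmat r * Rmat r a"

definition cinv :: "nat \<Rightarrow> complex \<Rightarrow> complex mat" where
  "cinv r a = (SOME M. M \<in> carrier_mat (r*r) (r*r) \<and> M * cmat r a = 1\<^sub>m (r*r) \<and> cmat r a * M = 1\<^sub>m (r*r))"

(* Braid words in Br_n: lists of (i, sign), i in {1..n-1}, meaning sigma_i^{+1} or sigma_i^{-1} *)
definition braid_word :: "nat \<Rightarrow> (nat \<times> bool) list \<Rightarrow> bool" where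
  "braid_word n w = (\<forall>x \<in> set w. 1 \<le> fst x \<and> fst x < n)"

definition gen_mat :: "nat \<Rightarrow> complex \<Rightarrow> nat \<Rightarrow> nat \<times> bool \<Rightarrow> complex mat" where
  "gen_mat r a n g = kron (kron (1\<^sub>m (r ^ (fst g - 1))) (if snd g then cmat r a else cinv r a))
                          (1\<^sub>m (r ^ (n - fst g - 1)))"

definition braid_mat :: "nat \<Rightarrow> complex \<Rightarrow> nat \<Rightarrow> (nat \<times> bool) list \<Rightarrow> complex mat" where
  "braid_mat r a n w = foldr (\<lambda>g M. gen_mat r a n g * M) w (1\<^sub>m (r ^ n))"

definition swp :: "nat \<Rightarrow> nat \<Rightarrow> nat \<Rightarrow> nat" where
  "swp i j x = (if x = i then j else if x = j then i else x)"

definition braid_perm :: "(nat \<times> bool) list \<Rightarrow> nat \<Rightarrow> nat" where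
  "braid_perm w = foldr (\<lambda>g p. swp (fst g - 1) (fst g) \<circ> p) w id"

(* the closure of the braid is a knot (one component): the permutation is transitive on strands *)
definition closure_is_knot :: "nat \<Rightarrow> (nat \<times> bool) list \<Rightarrow> bool" where
  "closure_is_knot n w = (\<forall>j<n. \<exists>k. (braid_perm w ^^ k) 0 = j)"

definition HomC :: "nat \<Rightarrow> complex \<Rightarrow> umod \<Rightarrow> complex mat set" where
  "HomC r g W = {Y \<in> carrier_mat (mdimension W) r.
       Y * actE (Vmod r g) = actE W * Y \<and> Y * actF (Vmod r g) = actF W * Y \<and>
       Y * actH (Vmod r g) = actH W * Y \<and> Y * actK (Vmod r g) = actK W * Y}"

definition is_basis_list :: "complex mat set \<Rightarrow> complex mat list \<Rightarrow> nat \<Rightarrow> nat \<Rightarrow> bool" where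
  "is_basis_list S Bs nr nc = (set Bs \<subseteq> S \<and>
     (\<forall>c. msum nr nc (\<lambda>i. c i \<cdot>\<^sub>m Bs ! i) (length Bs) = 0\<^sub>m nr nc \<longrightarrow> (\<forall>i<length Bs. c i = 0)) \<and>
     (\<forall>Y \<in> S. \<exists>c. Y = msum nr nc (\<lambda>i. c i \<cdot>\<^sub>m Bs ! i) (length Bs)))"

definition trace_on :: "complex mat set \<Rightarrow> nat \<Rightarrow> nat \<Rightarrow> (complex mat \<Rightarrow> complex mat) \<Rightarrow> complex" where
  "trace_on S nr nc f = (SOME t. \<exists>Bs c. is_basis_list S Bs nr nc \<and>
      (\<forall>j<length Bs. f (Bs ! j) = msum nr nc (\<lambda>i. c i j \<cdot>\<^sub>m Bs ! i) (length Bs)) \<and>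
      t = (\<Sum>i<length Bs. c i i))"

definition chi :: "nat \<Rightarrow> complex \<Rightarrow> nat \<Rightarrow> (nat \<times> bool) list \<Rightarrow> complex \<Rightarrow> complex" where
  "chi r a n w g = trace_on (HomC r g (tpow (Vmod r a) n)) (r ^ n) r (\<lambda>Y. braid_mat r a n w * Y)"

(* right partial trace over the last factor W (dimension m) of an endomorphism of V (x) W, V of dim r,
   with the pivotal element K^{1-r} inserted on W: ptr(f) = tr_W((id (x) K^{1-r}) f) *)
definition ptr :: "nat \<Rightarrow> nat \<Rightarrow> complex mat \<Rightarrow> complex mat" where
  "ptr r m M = mat r r (\<lambda>(i,j). \<Sum>k<m. M $$ (i*m + k, j*m + k))"

(* <T>: closing strands 2..n of beta on the right gives <T> id_{V_a} *)
definition bracketT :: "nat \<Rightarrow> complex \<Rightarrow> nat \<Rightarrow> (nat \<times> bool) list \<Rightarrow> complex" where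
  "bracketT r a n w = (THE c. ptr r (r ^ (n - 1))
       (kron (1\<^sub>m r) (actKi (tpow (Vmod r a) (n - 1)) ^\<^sub>m (r - 1)) * braid_mat r a n w) = c \<cdot>\<^sub>m 1\<^sub>m r)"

definition Ninv :: "nat \<Rightarrow> complex \<Rightarrow> nat \<Rightarrow> (nat \<times> bool) list \<Rightarrow> complex" where
  "Ninv r a n w = mdim r a * bracketT r a n w"

end

theory Submission
  imports Defs "HOL-Computational_Algebra.Polynomial"
begin

text \<open>
  Write $W = V \otimes W'$ for the $n$-th tensor power of $V = V_\alpha$, and let $f$ be the endomorphism
  of $W$ given by the braid. Closing the strands $2, \dots, n$ gives the scalar $Tr (e f)$, where
  $e = |v_0><v_0| \otimes K^{1-r}$. Consider the averages
  $Av (X) = \sum F^i E^j X E^{r-1-j} F^{r-1-i}$ and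
  $Av' (X) = \sum E^{r-1-j} F^{r-1-i} X F^i E^j$ over $0 \le i, j < r$; if $Av (\psi) = 1$ then
  $Tr (e f) = Tr (e f Av (\psi)) = Tr (Av' (e) f \psi)$, because $f$ commutes with $E$ and $F$.

  Let $\kappa_\gamma$ be the scalar by which $E^{r-1} F^{r-1}$ acts on a highest weight vector of weight
  $\gamma + r - 1$. It is nonzero as no weight of $W$ is an integer, and this makes
  $\psi = E^{r-1} F^{r-1} \kappa(H)^{-2}$ satisfy $Av (\psi) = 1$. The factorisation of
  $(X^r - Y^r) / (X - Y)$ over the $r$-th roots of unity, with $X$ and $Y$ a left and a right
  multiplication, removes from $Av' (e)$ all terms that act on $W'$, so that $Av' (e) = \kappa_\alpha$.
  As $E^{r-1} F^{r-1} \kappa(H)^{-1}$ is a projection onto the highest weight vectors of $W$, the trace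
  $Tr (f \psi)$ is the sum of the $\kappa_\gamma^{-1} \chi_\gamma (f)$, and the theorem follows because
  $d(\gamma) \kappa_\gamma$ does not depend on $\gamma$.
\<close>

section \<open>Scalars\<close>

text \<open>Closing all n strands gives nothing: on each V_\<gamma> the trace of K^(1-r) is a
  multiple of the sum of all r-th roots of unity, hence zero. One strand has to stay open, but the
  cut operator e does not commute with E and F, so that splitting W into copies of the V_\<gamma>
  says nothing about Tr (e f) directly. The averages repair this. Since E^r = 0, the sum of the E^j
  X E^(r-1-j) telescopes to an operator that commutes with E, and likewise for F; this is why the
  exponents add up to r - 1. That 1 is an average is a form of Higman's criterion for projectivity,
  and it replaces any choice of a decomposition of W. The modified dimension enters through a
  product formula: the product of the {\<gamma> + i} over i < r is a constant times {r \<gamma>}.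
  Without the factor {\<gamma>} it is, up to a constant, the scalar by which E^(r-1) F^(r-1) acts on
  the highest weight vector of V_\<gamma>, so that the inverse of this scalar is proportional to
  {\<gamma>} / {r \<gamma>}.\<close>

lemma qp_add: "qp r (x + y) = qp r x * qp r y"
  by (simp add: qp_def exp_add[symmetric] distrib_left add_divide_distrib)

lemma qp_0 [simp]: "qp r 0 = 1"
  by (simp add: qp_def)

lemma qp_minus: "qp r (- x) = inverse (qp r x)"
  by (simp add: qp_def exp_minus)

lemma qp_diff: "qp r (x - y) = qp r x * qp r (- y)"
  using qp_add[of r x "- y"] by simp

lemma qp_minus_mult [simp]: "qp r (- x) * qp r x = 1" "qp r x * qp r (- x) = 1"
  by (simp_all add: qp_add[symmetric])

lemma qp_nz [simp]: "qp r x \<noteq> 0"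
  by (simp add: qp_def)

lemma qp_power: "qp r x ^ k = qp r (of_nat k * x)"
  by (induction k) (simp_all add: qp_add[symmetric] algebra_simps)

lemma qp_eq_1_iff:
  assumes "r > 0"
  shows "qp r (2 * x) = 1 \<longleftrightarrow> (\<exists>k::int. x = of_int k * of_nat r)"
proof -
  have "qp r (2 * x) = exp ((2 * pi * \<i>) * (x / of_nat r))"
    by (simp add: qp_def field_simps)
  moreover have e: "exp ((2 * pi * \<i>) * y) = 1 \<longleftrightarrow> (\<exists>k::int. y = of_int k)" for y :: complex
  proof -
    have "Im y = 0 \<and> (\<exists>k::int. Re y = of_int k)" if "exp ((2 * pi * \<i>) * y) = 1"
    proof -
      have "exp (- (2 * pi * Im y)) = 1"
        using arg_cong[OF that, of norm] by (simp add: norm_exp_eq_Re)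
      moreover have "cos (2 * pi * Re y) = 1"
        using arg_cong[OF that, of Re] calculation by (simp add: Re_exp)
      ultimately show ?thesis by (auto simp: cos_one_2pi_int)
    qed
    moreover have "exp ((2 * pi * \<i>) * of_int k) = 1" for k :: int
      using cos_int_2pin[of k] sin_int_2pin[of k]
      by (simp add: complex_eq_iff Re_exp Im_exp mult.assoc)
    moreover have "(\<exists>k::int. y = of_int k) \<longleftrightarrow> Im y = 0 \<and> (\<exists>k::int. Re y = of_int k)"
      by (auto simp: complex_eq_iff)
    ultimately show ?thesis by metis
  qed
  ultimately have "qp r (2 * x) = 1 \<longleftrightarrow> (\<exists>k::int. x / of_nat r = of_int k)"
    using e[of "x / of_nat r"] by simp
  thus ?thesis using assms by (simp add: divide_eq_eq)
qed

lemma qbr_eq_0_iff: "qbr r x = 0 \<longleftrightarrow> qp r (2 * x) = 1"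
proof -
  have "qp r (2 * x) = qp r x * qp r x" by (simp add: qp_add[symmetric])
  thus ?thesis by (auto simp: qbr_def qp_minus field_simps)
qed

lemma int_not_mult:
  fixes r k :: nat
  assumes "0 < k" "k < r" shows "(of_nat k :: complex) \<noteq> of_int i * of_nat r"
proof
  assume "(of_nat k :: complex) = of_int i * of_nat r"
  hence "int k = i * int r" using of_int_eq_iff[where 'a=complex, of "int k" "i * int r"] by simp
  hence "int r dvd int k" by simp
  thus False using assms by (auto dest: dvd_imp_le)
qed

lemma qbr_nat_nz: assumes "0 < k" "k < r" shows "qbr r (of_nat k) \<noteq> 0"
  using assms int_not_mult[OF assms] by (auto simp: qbr_eq_0_iff qp_eq_1_iff)

lemma qbr_1_nz: assumes "r \<ge> 2" shows "qbr r 1 \<noteq> 0"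
  using qbr_nat_nz[of 1 r] assms by simp

lemma qbr_non_int_nz: assumes "r > 0" "x \<notin> \<int>" shows "qbr r x \<noteq> 0"
proof
  assume "qbr r x = 0"
  then obtain k :: int where "x = of_int k * of_nat r"
    using assms by (auto simp: qbr_eq_0_iff qp_eq_1_iff)
  thus False using assms by (metis Ints_of_int Ints_of_nat Ints_mult)
qed

text \<open>The induction step of the commutation rules \<open>E_Fpow\<close> and
  \<open>Epow_F\<close>: y is the number of factors already passed, and x comes from the
  weight.\<close>

lemma qint_add:
  assumes "r \<ge> 2"
  shows "qint r x + qint r y * qint r (x - y - 1) = qint r (y + 1) * qint r (x - y)"
proof -
  have "qbr r 1 * qbr r x + qbr r y * qbr r (x - y - 1) = qbr r (y + 1) * qbr r (x - y)"
    by (simp add: qbr_def left_diff_distrib right_diff_distrib qp_add[symmetric])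
  thus ?thesis using qbr_1_nz[OF assms] by (simp add: qint_def divide_simps mult.commute)
qed

text \<open>With y = i and x = a + r - 1 this is the relation EF - FE = [H] on the basis vector v_i
  of V_a.\<close>

lemma qint_mult_Suc:
  assumes "r \<ge> 2"
  shows "qint r (y + 1) * qint r (x - y) = qint r y * qint r (x - y + 1) + qint r (x - 2 * y)"
proof -
  have "qbr r 1 * qbr r (x - 2 * y) + qbr r y * qbr r (x - y + 1) = qbr r (y + 1) * qbr r (x - y)"
    by (simp add: qbr_def left_diff_distrib right_diff_distrib qp_add[symmetric] algebra_simps)
  thus ?thesis using qbr_1_nz[OF assms] by (simp add: qint_def divide_simps mult.commute add.commute)
qed

section \<open>Roots of unity and the product formula for quantum integers\<close>

definition primitive_root :: "nat \<Rightarrow> complex \<Rightarrow> bool" where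
  "primitive_root r z \<longleftrightarrow> r > 0 \<and> z ^ r = 1 \<and> (\<forall>k. 0 < k \<and> k < r \<longrightarrow> z ^ k \<noteq> 1)"

lemma primitive_root_qp:
  assumes "r \<ge> 2"
  shows "primitive_root r (qp r 2)" "primitive_root r (qp r (- 2))"
proof -
  have p: "qp r 2 ^ k = qp r (2 * of_nat k)" for k
    by (simp add: qp_power mult.commute)
  have "qp r 2 ^ r = 1" unfolding p using assms by (subst qp_eq_1_iff) (auto intro!: exI[of _ 1])
  moreover have "qp r 2 ^ k \<noteq> 1" if "0 < k" "k < r" for k
    unfolding p using assms int_not_mult[OF that] by (subst qp_eq_1_iff) auto
  ultimately show "primitive_root r (qp r 2)" "primitive_root r (qp r (- 2))"
    using assms by (auto simp: primitive_root_def qp_minus power_inverse)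
qed

lemma primitive_root_power_eq:
  assumes "primitive_root r z" "i < r" "j < r" "z ^ i = z ^ j"
  shows "i = j"
proof -
  have "i = j" if "i \<le> j" "j < r" "z ^ i = z ^ j" for i j
  proof (rule ccontr)
    assume "i \<noteq> j"
    have "z \<noteq> 0" using assms(1) by (auto simp: primitive_root_def power_0_left split: if_splits)
    moreover have "z ^ j = z ^ i * z ^ (j - i)"
      unfolding power_add[symmetric] using that(1) by simp
    ultimately have "z ^ (j - i) = 1" using that by simp
    thus False using assms(1) that \<open>i \<noteq> j\<close> by (auto simp: primitive_root_def)
  qed
  from this[of i j] this[of j i] show ?thesis using assms by (cases "i \<le> j") auto
qed

text \<open>Its coefficients are also those of the product of the X - w_i Y in two commuting
  variables; this homogeneous form is the one used for operators.\<close>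

definition rpoly :: "(nat \<Rightarrow> complex) \<Rightarrow> nat \<Rightarrow> complex poly" where
  "rpoly w k = (\<Prod>i<k. [:- w i, 1:])"

lemma degree_rpoly: "degree (rpoly w k) = k" and lead_coeff_rpoly: "coeff (rpoly w k) k = 1"
proof -
  show d: "degree (rpoly w k) = k" for k
    unfolding rpoly_def by (subst degree_prod_eq_sum_degree) auto
  have "lead_coeff (rpoly w k) = 1"
    unfolding rpoly_def by (subst lead_coeff_prod) auto
  thus "coeff (rpoly w k) k = 1" by (simp add: d)
qed

text \<open>Both sides are monic of degree r and vanish at the r distinct powers of z.\<close>

lemma rpoly_primitive_root:
  assumes "primitive_root r z"
  shows "rpoly (\<lambda>i. z ^ i) r = monom 1 r - 1"
proof -
  let ?A = "(\<lambda>i. z ^ i) ` {..<r}"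
  have r: "r > 0" using assms by (simp add: primitive_root_def)
  have inj: "inj_on (\<lambda>i. z ^ i) {..<r}"
    using primitive_root_power_eq[OF assms] by (auto simp: inj_on_def)
  show ?thesis
  proof (rule poly_eqI_degree_lead_coeff[where A = ?A and n = r])
    show "card ?A \<ge> r" using inj by (simp add: card_image)
    show "degree (rpoly (\<lambda>i. z ^ i) r) \<le> r" by (simp add: degree_rpoly)
    show "degree (monom 1 r - 1 :: complex poly) \<le> r"
      by (rule degree_diff_le) (simp_all add: degree_monom_le)
    show "coeff (rpoly (\<lambda>i. z ^ i) r) r = coeff (monom 1 r - 1) r"
      using r by (simp add: lead_coeff_rpoly)
    fix x assume "x \<in> ?A"
    then obtain i where i: "i < r" "x = z ^ i" by auto
    have "x ^ r = 1" using assms i by (simp add: primitive_root_def power_mult[symmetric] mult.commute[of i] power_mult)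
    moreover have "poly (rpoly (\<lambda>i. z ^ i) r) x = 0"
      using i by (auto simp: rpoly_def poly_prod)
    ultimately show "poly (rpoly (\<lambda>i. z ^ i) r) x = poly (monom 1 r - 1) x"
      by (simp add: poly_monom)
  qed
qed

text \<open>The previous identity with the factor X - 1, which belongs to the root z^0, cancelled on
  both sides.\<close>

lemma rpoly_primitive_root_Suc:
  assumes "primitive_root r z"
  shows "rpoly (\<lambda>i. z ^ Suc i) (r - 1) = (\<Sum>i<r. monom 1 i)"
proof -
  have r: "r > 0" using assms by (simp add: primitive_root_def)
  have "[:- 1, 1:] * rpoly (\<lambda>i. z ^ Suc i) (r - 1) = rpoly (\<lambda>i. z ^ i) (Suc (r - 1))"
    unfolding rpoly_def by (subst prod.lessThan_Suc_shift) simp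
  also have "\<dots> = monom 1 r - 1" using rpoly_primitive_root[OF assms] r by simp
  also have "\<dots> = [:- 1, 1:] * (\<Sum>i<r. monom 1 i)"
    using power_diff_1_eq[of "monom 1 1 :: complex poly" r] r
    by (simp add: monom_power monom_altdef one_pCons)
  finally have "[:- 1, 1:] * rpoly (\<lambda>i. z ^ Suc i) (r - 1) = [:- 1, 1:] * (\<Sum>i<r. monom 1 i)" .
  thus ?thesis by (subst (asm) mult_cancel_left) auto
qed

text \<open>Each factor {x + i} is q^i q^(-x) (q^(2x) - q^(-2i)), and the q^(-2i) run through all
  r-th roots of unity, so the product of the brackets is q^(2rx) - 1. The {r x} produced here is
  what cancels the denominator of the modified dimension.\<close>

lemma prod_qbr_shift:
  assumes "r \<ge> 2"
  shows "(\<Prod>i<r. qbr r (x + of_nat i)) = qp r (of_nat (\<Sum>i<r. i)) * qbr r (of_nat r * x)"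
proof -
  let ?z = "qp r (- 2)"
  have "qbr r (x + of_nat i) = qp r (of_nat i) * qp r (- x) * (qp r (2 * x) - ?z ^ i)" for i
    by (simp add: qp_power qbr_def right_diff_distrib qp_add[symmetric] algebra_simps)
  hence "(\<Prod>i<r. qbr r (x + of_nat i)) =
      (\<Prod>i<r. qp r (of_nat i)) * qp r (- x) ^ r * (\<Prod>i<r. qp r (2 * x) - ?z ^ i)"
    by (simp add: prod.distrib)
  also have "(\<Prod>i<r. qp r (2 * x) - ?z ^ i) = poly (rpoly (\<lambda>i. ?z ^ i) r) (qp r (2 * x))"
    by (simp add: rpoly_def poly_prod)
  also have "\<dots> = qp r (2 * x) ^ r - 1"
    using rpoly_primitive_root[OF primitive_root_qp(2)[OF assms]] by (simp add: poly_monom)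
  also have "(\<Prod>i<r. qp r (of_nat i)) = qp r (of_nat (\<Sum>i<r. i))"
  proof -
    have "(\<Prod>i<k. qp r (of_nat i)) = qp r (of_nat (\<Sum>i<k. i))" for k
      by (induction k) (simp_all add: qp_add[symmetric] add.commute)
    thus ?thesis .
  qed
  also have "qp r (of_nat (\<Sum>i<r. i)) * qp r (- x) ^ r * (qp r (2 * x) ^ r - 1) =
      qp r (of_nat (\<Sum>i<r. i)) * qbr r (of_nat r * x)"
    by (simp add: qbr_def qp_power right_diff_distrib qp_add[symmetric] mult.assoc) (simp add: algebra_simps)
  finally show ?thesis .
qed

text \<open>The scalar by which $E^jF^j$ acts on a highest weight vector of weight $x$.\<close>

definition kap :: "nat \<Rightarrow> nat \<Rightarrow> complex \<Rightarrow> complex" where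
  "kap r j x = (\<Prod>i<j. qint r (of_nat (Suc i)) * qint r (x - of_nat i))"

lemma kap_0 [simp]: "kap r 0 x = 1"
  and kap_Suc: "kap r (Suc j) x = kap r j x * (qint r (of_nat (Suc j)) * qint r (x - of_nat j))"
  by (simp_all add: kap_def)

text \<open>The factors [i + 1] are nonzero because i + 1 < r, the factors [x - i] because x - i is
  not an integer.\<close>

lemma kap_nz:
  assumes "r \<ge> 2" "j < r" "x \<notin> \<int>"
  shows "kap r j x \<noteq> 0"
proof -
  have "x - of_nat i \<notin> \<int>" for i
    using assms(3) by (metis Ints_add Ints_of_nat diff_add_cancel)
  thus ?thesis using assms qbr_1_nz[of r] qbr_nat_nz[of _ r] qbr_non_int_nz[of r]
    by (auto simp: kap_def qint_def simp del: of_nat_Suc)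
qed

text \<open>Up to a constant, \<open>kap\<close> is the product of {g + 1}, ..., {g + r - 1}. The
  numerator {g} of the modified dimension supplies the missing factor for i = 0, and by
  \<open>prod_qbr_shift\<close> the full product is a constant times its denominator {r g}.\<close>

lemma mdim_kap_const:
  assumes "r \<ge> 2"
  shows "\<exists>c. \<forall>g. g \<notin> \<int> \<longrightarrow> mdim r g * kap r (r - 1) (g + of_nat r - 1) = c"
proof -
  define C where "C = (-1) ^ (r - 1) * of_nat r * qp r (of_nat (\<Sum>i<r. i)) *
    (\<Prod>i<r - 1. qint r (of_nat (Suc i)) / qbr r 1)"
  have "mdim r g * kap r (r - 1) (g + of_nat r - 1) = C" if g: "g \<notin> \<int>" for g
  proof -
    have nz: "qbr r (of_nat r * g) \<noteq> 0"
    proof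
      assume "qbr r (of_nat r * g) = 0"
      then obtain k :: int where "of_nat r * g = of_int k * of_nat r"
        using assms by (auto simp: qbr_eq_0_iff qp_eq_1_iff)
      hence "g = of_int k" using assms by simp
      thus False using g by simp
    qed
    have "kap r (r - 1) (g + of_nat r - 1) =
       (\<Prod>i<r - 1. qint r (of_nat (Suc i)) / qbr r 1) * (\<Prod>i<r - 1. qbr r (g + of_nat r - 1 - of_nat i))"
      by (simp add: kap_def prod.distrib[symmetric] qint_def)
    also have "(\<Prod>i<r - 1. qbr r (g + of_nat r - 1 - of_nat i)) = (\<Prod>i<r - 1. qbr r (g + of_nat (Suc i)))"
      by (rule prod.reindex_bij_witness[of _ "\<lambda>i. r - 2 - i" "\<lambda>i. r - 2 - i"])
         (use assms in \<open>auto simp: of_nat_diff algebra_simps\<close>)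
    finally have "qbr r g * kap r (r - 1) (g + of_nat r - 1) =
       (\<Prod>i<r - 1. qint r (of_nat (Suc i)) / qbr r 1) * (\<Prod>i<Suc (r - 1). qbr r (g + of_nat i))"
      by (subst prod.lessThan_Suc_shift) simp
    also have "Suc (r - 1) = r" using assms by simp
    finally show ?thesis
      using nz unfolding prod_qbr_shift[OF assms] mdim_def C_def by (simp add: field_simps)
  qed
  thus ?thesis by blast
qed

section \<open>Linear operators\<close>

text \<open>A unital ring receiving all square matrices: a matrix of size $n$ acts on sequences
  by the block diagonal matrix with infinitely many equal blocks. This gives access to the
  algebraic type classes, which matrices with explicit dimensions do not have.\<close>

typedef lop = "{f :: (nat \<Rightarrow> complex) \<Rightarrow> nat \<Rightarrow> complex.
    (\<forall>u v. f (\<lambda>i. u i + v i) = (\<lambda>i. f u i + f v i)) \<and> (\<forall>c u. f (\<lambda>i. c * u i) = (\<lambda>i. c * f u i))}"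
  morphisms ap Abs_lop
  by (rule exI[of _ "\<lambda>_ _. 0"]) auto

setup_lifting type_definition_lop

instantiation lop :: ring_1
begin
lift_definition zero_lop :: lop is "\<lambda>_ _. 0" by auto
lift_definition one_lop :: lop is "\<lambda>u. u" by auto
lift_definition plus_lop :: "lop \<Rightarrow> lop \<Rightarrow> lop" is "\<lambda>f g u i. f u i + g u i"
  by (auto simp: algebra_simps)
lift_definition minus_lop :: "lop \<Rightarrow> lop \<Rightarrow> lop" is "\<lambda>f g u i. f u i - g u i"
  by (auto simp: algebra_simps)
lift_definition uminus_lop :: "lop \<Rightarrow> lop" is "\<lambda>f u i. - f u i"
  by (auto simp: algebra_simps)
lift_definition times_lop :: "lop \<Rightarrow> lop \<Rightarrow> lop" is "\<lambda>f g u. f (g u)"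
  by auto
instance
proof
  show "(0::lop) \<noteq> 1"
    by transfer (auto simp: fun_eq_iff intro!: exI[of _ "\<lambda>_. 1"])
  fix a b c :: lop
  show "a * (b + c) = a * b + a * c" by transfer auto
qed (transfer; auto simp: algebra_simps)+
end

lift_definition sc :: "complex \<Rightarrow> lop" is "\<lambda>c u i. c * u i"
  by (auto simp: algebra_simps)

lemma sc_0 [simp]: "sc 0 = 0" and sc_1 [simp]: "sc 1 = 1"
  by (transfer; simp)+

lemma sc_mult: "sc (a * b) = sc a * sc b"
  and sc_minus: "sc (- a) = - sc a" and sc_diff: "sc (a - b) = sc a - sc b"
  by (transfer; simp add: algebra_simps)+

lemma sc_commute: "A * sc c = sc c * A"
  by transfer auto

lemma sc_left_commute: "A * (sc c * B) = sc c * (A * B)"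
  by (metis mult.assoc sc_commute)

lemma ap_mult: "ap (A * B) u = ap A (ap B u)" and ap_add: "ap (A + B) u i = ap A u i + ap B u i"
  and ap_0 [simp]: "ap 0 u i = 0" and ap_1 [simp]: "ap 1 u = u" and ap_sc: "ap (sc c) u i = c * u i"
  by (transfer; simp)+

lemma lop_eqI: "(\<And>u i. ap A u i = ap B u i) \<Longrightarrow> A = B"
  by (metis ap_inject ext)

text \<open>The recursion applies (left multiplication by P) - w_k (right multiplication by Q) to
  X_k. Left and right multiplications commute, so the product of these maps expands like a
  polynomial in two commuting variables, although P, Q and X_0 need not commute with each
  other.\<close>

lemma twisted_power_expand:
  assumes "\<And>k. X (Suc k) = P * X k - sc (w k) * X k * Q"
  shows "X k = (\<Sum>j\<le>k. sc (coeff (rpoly w k) j) * P ^ j * X 0 * Q ^ (k - j))"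
proof (induction k)
  case 0
  then show ?case by (simp add: rpoly_def)
next
  case (Suc k)
  define c where "c = coeff (rpoly w k)"
  have c0: "c j = 0" if "j > k" for j
    using that by (simp add: c_def coeff_eq_0 degree_rpoly)
  have rec: "coeff (rpoly w (Suc k)) j = (if j = 0 then 0 else c (j - 1)) - w k * c j" for j
    by (simp add: rpoly_def c_def mult.commute[of _ "[:_, _:]"] coeff_pCons split: nat.split)
  have "(\<Sum>j\<le>Suc k. sc (coeff (rpoly w (Suc k)) j) * P ^ j * X 0 * Q ^ (Suc k - j)) =
     (\<Sum>j\<le>Suc k. sc (if j = 0 then 0 else c (j - 1)) * P ^ j * X 0 * Q ^ (Suc k - j))
     - (\<Sum>j\<le>Suc k. sc (w k * c j) * P ^ j * X 0 * Q ^ (Suc k - j))"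
    unfolding rec by (simp add: sc_diff left_diff_distrib sum_subtractf)
  also have "(\<Sum>j\<le>Suc k. sc (if j = 0 then 0 else c (j - 1)) * P ^ j * X 0 * Q ^ (Suc k - j)) =
      P * X k"
    unfolding Suc.IH c_def[symmetric]
    by (simp add: sum.atMost_Suc_shift sum_distrib_left mult.assoc sc_left_commute del: sum.atMost_Suc)
  also have "(\<Sum>j\<le>Suc k. sc (w k * c j) * P ^ j * X 0 * Q ^ (Suc k - j)) = sc (w k) * X k * Q"
    unfolding Suc.IH c_def[symmetric]
    by (simp add: c0 sum_distrib_left sum_distrib_right mult.assoc sc_mult)
       (rule sum.cong, auto simp: Suc_diff_le power_commutes[symmetric] mult.assoc)
  finally show ?case using assms by simp
qed

text \<open>The factorisations of $X^r - Y^r$ and $\sum X^jY^{r-1-j}$ over the $r$-th roots of unity,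
  with $X$ the left multiplication by $P$ and $Y$ the right multiplication by $Q$.\<close>

lemma twisted_power_full:
  assumes "primitive_root r z" "\<And>k. X (Suc k) = P * X k - sc (z ^ k) * X k * Q"
  shows "X r = P ^ r * X 0 - X 0 * Q ^ r"
proof -
  have r: "r > 0" using assms by (simp add: primitive_root_def)
  have "X r = (\<Sum>j\<le>r. sc (coeff (monom 1 r - 1) j) * P ^ j * X 0 * Q ^ (r - j))"
    using twisted_power_expand[of X P "\<lambda>k. z ^ k" Q r] assms rpoly_primitive_root[OF assms(1)] by simp
  also have "\<dots> = (\<Sum>j\<in>{0, r}. sc (coeff (monom 1 r - 1) j) * P ^ j * X 0 * Q ^ (r - j))"
    by (rule sum.mono_neutral_right) auto
  also have "\<dots> = P ^ r * X 0 - X 0 * Q ^ r"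
    using r by (simp add: sc_minus)
  finally show ?thesis .
qed

lemma twisted_power_sum:
  assumes "primitive_root r z" "\<And>k. X (Suc k) = P * X k - sc (z ^ Suc k) * X k * Q"
  shows "X (r - 1) = (\<Sum>j<r. P ^ j * X 0 * Q ^ (r - 1 - j))"
proof -
  have r: "r > 0" using assms by (simp add: primitive_root_def)
  have c: "coeff (\<Sum>i<r. monom 1 i) j = (1::complex)" if "j < r" for j
    using that by (simp add: coeff_sum)
  have s: "{..r - 1} = {..<r}" using r by auto
  have "X (r - 1) = (\<Sum>j\<le>r - 1. sc (coeff (\<Sum>i<r. monom 1 i) j) * P ^ j * X 0 * Q ^ (r - 1 - j))"
    using twisted_power_expand[of X P "\<lambda>k. z ^ Suc k" Q "r - 1"] assms rpoly_primitive_root_Suc[OF assms(1)]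
    by simp
  also have "\<dots> = (\<Sum>j<r. P ^ j * X 0 * Q ^ (r - 1 - j))"
    unfolding s by (intro sum.cong) (simp_all add: c del: coeff_sum)
  finally show ?thesis .
qed

text \<open>By \<open>twisted_power_sum\<close> either sum is an (r-1)-fold twisted commutator of e,
  with twists z, z^2, and so on. Each commutator with B multiplies by z the factor that A picks up
  when it passes X_k, so A X_k = z^(k+1) X_k A. This is exactly the twist of the next commutator,
  and A cancels from every step.\<close>

lemma twisted_conj_sum:
  assumes z: "primitive_root r z" and AB: "A * B = sc z * B * A" and Ae: "A * e = sc z * e * A"
  shows "(\<Sum>j<r. (A + B) ^ j * e * (A + B) ^ (r - 1 - j)) = (\<Sum>j<r. B ^ j * e * B ^ (r - 1 - j))"
proof -
  define X where "X = rec_nat e (\<lambda>k Y. B * Y - sc (z ^ Suc k) * Y * B)"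
  have X0: "X 0 = e" and XS: "X (Suc k) = B * X k - sc (z ^ Suc k) * X k * B" for k
    by (simp_all add: X_def)
  have comm: "A * X k = sc (z ^ Suc k) * X k * A" for k
  proof (induction k)
    case 0
    then show ?case using Ae by (simp add: X0)
  next
    case (Suc k)
    have 1: "A * (B * X k) = sc (z ^ Suc (Suc k)) * (B * X k) * A"
    proof -
      have "A * (B * X k) = sc z * B * (A * X k)" by (simp only: mult.assoc[symmetric] AB)
      also have "\<dots> = sc (z ^ Suc (Suc k)) * (B * X k) * A"
        by (simp add: Suc.IH sc_mult mult.assoc sc_left_commute[of B])
      finally show ?thesis .
    qed
    have 2: "A * (X k * B) = sc (z ^ Suc (Suc k)) * (X k * B) * A"
    proof -
      have "A * (X k * B) = sc (z ^ Suc k) * X k * (A * B)" by (simp only: mult.assoc[symmetric] Suc.IH)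
      also have "\<dots> = sc (z ^ Suc (Suc k)) * (X k * B) * A"
        by (simp add: AB sc_mult mult.assoc sc_left_commute[of "X k"] sc_left_commute[of "sc (z ^ k)" z])
      finally show ?thesis .
    qed
    show ?case unfolding XS
      by (simp add: right_diff_distrib left_diff_distrib 1 mult.assoc sc_left_commute[of A]
          2[unfolded mult.assoc]) (rule sc_left_commute)
  qed
  have "X (Suc k) = (A + B) * X k - sc (z ^ Suc k) * X k * (A + B)" for k
    unfolding XS by (simp add: algebra_simps comm)
  from twisted_power_sum[OF z this] twisted_power_sum[OF z XS] show ?thesis by (simp add: X0)
qed

text \<open>The powers A^k are themselves a sequence of twisted commutators, starting at 1, with P =
  A + B on the left and Q = B on the right: from B A^k = z^k A^k B follows (A + B) A^k - z^k A^k B =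
  A^(k+1). Hence \<open>twisted_power_full\<close> gives A^r = (A + B)^r - B^r.\<close>

lemma twisted_add_power:
  assumes z: "primitive_root r z" and AB: "B * A = sc z * A * B"
  shows "(A + B) ^ r = A ^ r + B ^ r"
proof -
  have BA: "B * A ^ k = sc (z ^ k) * A ^ k * B" for k
  proof (induction k)
    case (Suc k)
    have "B * A ^ Suc k = sc z * A * (B * A ^ k)" by (simp only: power_Suc mult.assoc[symmetric] AB)
    also have "\<dots> = sc (z ^ Suc k) * A ^ Suc k * B"
      by (simp add: Suc.IH sc_mult mult.assoc sc_left_commute[of A])
    finally show ?case .
  qed simp
  have "A ^ Suc k = (A + B) * A ^ k - sc (z ^ k) * A ^ k * B" for k
    by (simp add: distrib_right BA)
  from twisted_power_full[OF z this] have "A ^ r = (A + B) ^ r - B ^ r" by simp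
  thus ?thesis by (simp add: algebra_simps)
qed

section \<open>Matrices as operators\<close>

lift_definition bl :: "nat \<Rightarrow> complex mat \<Rightarrow> lop" is
  "\<lambda>n X u i. \<Sum>j<n. X $$ (i mod n, j) * u (i div n * n + j)"
  by (auto simp: algebra_simps sum.distrib sum_distrib_left)

declare index_mult_mat(1) [simp del]

lemma mult_entry:
  assumes "X \<in> carrier_mat m n" "Y \<in> carrier_mat n k" "i < m" "j < k"
  shows "(X * Y) $$ (i, j) = (\<Sum>l<n. X $$ (i, l) * Y $$ (l, j))"
  using assms by (simp add: index_mult_mat(1) scalar_prod_def lessThan_atLeast0)

lemma ap_bl: "ap (bl n X) u i = (\<Sum>j<n. X $$ (i mod n, j) * u (i div n * n + j))"
  by (simp add: bl.rep_eq)

lemma bl_entry: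
  assumes "i < n" "j < n"
  shows "ap (bl n X) (\<lambda>k. if k = j then 1 else 0) i = X $$ (i, j)"
proof -
  have "ap (bl n X) (\<lambda>k. if k = j then 1 else 0) i = (\<Sum>k<n. if k = j then X $$ (i, k) else 0)"
    unfolding ap_bl using assms by (intro sum.cong) auto
  thus ?thesis using assms by simp
qed

text \<open>Carries identities that were proved in the ring \<open>lop\<close> back to
  matrices.\<close>

lemma bl_inj:
  assumes "bl n X = bl n Y" "X \<in> carrier_mat n n" "Y \<in> carrier_mat n n"
  shows "X = Y"
proof (rule eq_matI)
  fix i j assume "i < dim_row Y" "j < dim_col Y"
  thus "X $$ (i, j) = Y $$ (i, j)" using assms bl_entry[of i n j X] bl_entry[of i n j Y] by auto
qed (use assms in auto)

lemma bl_mult: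
  assumes "n > 0" "X \<in> carrier_mat n n" "Y \<in> carrier_mat n n"
  shows "bl n (X * Y) = bl n X * bl n Y"
proof (rule lop_eqI)
  fix u :: "nat \<Rightarrow> complex" and i
  let ?v = "\<lambda>k. u (i div n * n + k)"
  have "ap (bl n X * bl n Y) u i = (\<Sum>j<n. X $$ (i mod n, j) * (\<Sum>k<n. Y $$ (j, k) * ?v k))"
    unfolding ap_mult ap_bl[of n X] using assms(1)
    by (intro sum.cong refl arg_cong2[of _ _ _ _ "(*)"]) (simp add: ap_bl)
  also have "\<dots> = (\<Sum>j<n. \<Sum>k<n. X $$ (i mod n, j) * Y $$ (j, k) * ?v k)"
    by (simp add: sum_distrib_left mult.assoc)
  also have "\<dots> = (\<Sum>k<n. \<Sum>j<n. X $$ (i mod n, j) * Y $$ (j, k) * ?v k)"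
    by (rule sum.swap)
  also have "\<dots> = (\<Sum>k<n. (X * Y) $$ (i mod n, k) * ?v k)"
    using assms by (intro sum.cong) (simp_all add: mult_entry[of _ n n _ n] sum_distrib_right)
  also have "\<dots> = ap (bl n (X * Y)) u i" by (simp add: ap_bl)
  finally show "ap (bl n (X * Y)) u i = ap (bl n X * bl n Y) u i" by simp
qed

lemma bl_add:
  assumes "n > 0" "X \<in> carrier_mat n n" "Y \<in> carrier_mat n n"
  shows "bl n (X + Y) = bl n X + bl n Y"
  using assms by (intro lop_eqI) (simp add: ap_bl ap_add sum.distrib[symmetric] distrib_right)

lemma bl_smult:
  assumes "n > 0" "X \<in> carrier_mat n n"
  shows "bl n (c \<cdot>\<^sub>m X) = sc c * bl n X"
  using assms by (intro lop_eqI) (simp add: ap_bl ap_mult ap_sc sum_distrib_left mult.assoc)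

lemma bl_one: assumes "n > 0" shows "bl n (1\<^sub>m n) = 1"
proof (rule lop_eqI)
  fix u i
  have "ap (bl n (1\<^sub>m n)) u i = (\<Sum>j<n. if j = i mod n then u (i div n * n + j) else 0)"
    unfolding ap_bl using assms by (intro sum.cong) auto
  thus "ap (bl n (1\<^sub>m n)) u i = ap 1 u i" using assms by simp
qed

lemma bl_zero: "n > 0 \<Longrightarrow> bl n (0\<^sub>m n n) = 0"
  by (intro lop_eqI) (simp add: ap_bl)

lemma bl_pow:
  assumes "n > 0" "X \<in> carrier_mat n n"
  shows "bl n (X ^\<^sub>m k) = bl n X ^ k"
proof (induction k)
  case 0
  then show ?case using assms by (simp add: bl_one)
next
  case (Suc k)
  have "bl n (X ^\<^sub>m Suc k) = bl n (X ^\<^sub>m k) * bl n X"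
    using assms bl_mult[of n "X ^\<^sub>m k" X] by simp
  thus ?case by (simp add: Suc.IH power_commutes)
qed

text \<open>\<open>tr n\<close> reads only the first block, so its cyclicity requires operators that
  respect the blocks.\<close>

definition bls :: "nat \<Rightarrow> lop set" where
  "bls n = bl n ` carrier_mat n n"

lemma bls_bl [simp]: "X \<in> carrier_mat n n \<Longrightarrow> bl n X \<in> bls n"
  by (auto simp: bls_def)

lemma blsE: assumes "A \<in> bls n" obtains X where "X \<in> carrier_mat n n" "A = bl n X"
  using assms by (auto simp: bls_def)

lemma bls_mult: "n > 0 \<Longrightarrow> A \<in> bls n \<Longrightarrow> B \<in> bls n \<Longrightarrow> A * B \<in> bls n"
  by (elim blsE) (metis bl_mult bls_bl mult_carrier_mat)

lemma bls_add: "n > 0 \<Longrightarrow> A \<in> bls n \<Longrightarrow> B \<in> bls n \<Longrightarrow> A + B \<in> bls n"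
  by (elim blsE) (metis bl_add bls_bl add_carrier_mat)

lemma bls_1: "n > 0 \<Longrightarrow> 1 \<in> bls n"
  by (metis bl_one bls_bl one_carrier_mat)

lemma bls_0: "n > 0 \<Longrightarrow> 0 \<in> bls n"
  by (metis bl_zero bls_bl zero_carrier_mat)

lemma bls_sc: "n > 0 \<Longrightarrow> sc c \<in> bls n"
  by (metis bl_one bl_smult bls_bl one_carrier_mat smult_carrier_mat mult.right_neutral)

lemma bls_uminus: "n > 0 \<Longrightarrow> A \<in> bls n \<Longrightarrow> - A \<in> bls n"
  using bls_mult[OF _ bls_sc[of n "- 1"]] by (simp add: sc_minus)

lemma bls_power: "n > 0 \<Longrightarrow> A \<in> bls n \<Longrightarrow> A ^ k \<in> bls n"
  by (induction k) (auto intro: bls_mult bls_1)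

lemma bls_sum: "n > 0 \<Longrightarrow> (\<And>i. i \<in> S \<Longrightarrow> f i \<in> bls n) \<Longrightarrow> sum f S \<in> bls n"
  by (induction S rule: infinite_finite_induct) (auto intro: bls_add bls_0)

definition tr :: "nat \<Rightarrow> lop \<Rightarrow> complex" where
  "tr n A = (\<Sum>i<n. ap A (\<lambda>k. if k = i then 1 else 0) i)"

lemma tr_bl: "tr n (bl n X) = (\<Sum>i<n. X $$ (i, i))"
  by (simp add: tr_def bl_entry)

lemma tr_add: "tr n (A + B) = tr n A + tr n B"
  by (simp add: tr_def ap_add sum.distrib)

lemma tr_0 [simp]: "tr n 0 = 0"
  by (simp add: tr_def)

lemma tr_sum: "tr n (sum f S) = (\<Sum>i\<in>S. tr n (f i))"
  by (induction S rule: infinite_finite_induct) (auto simp: tr_add)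

lemma tr_sc: "tr n (sc c * A) = c * tr n A"
  by (simp add: tr_def ap_mult ap_sc sum_distrib_left)

lemma tr_mult_commute:
  assumes "n > 0" "A \<in> bls n" "B \<in> bls n"
  shows "tr n (A * B) = tr n (B * A)"
proof -
  obtain X Y where X: "X \<in> carrier_mat n n" "A = bl n X" and Y: "Y \<in> carrier_mat n n" "B = bl n Y"
    using assms by (metis blsE)
  have "(\<Sum>i<n. \<Sum>l<n. X $$ (i, l) * Y $$ (l, i)) = (\<Sum>i<n. \<Sum>l<n. Y $$ (i, l) * X $$ (l, i))"
    by (subst sum.swap) (simp add: mult.commute)
  thus ?thesis using X Y assms(1)
    by (simp add: bl_mult[symmetric] tr_bl mult_entry[of _ n n _ n])
qed

section \<open>Diagonal matrices and the grading by weights\<close>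

definition dgm :: "nat \<Rightarrow> (nat \<Rightarrow> complex) \<Rightarrow> complex mat" where
  "dgm n d = mat n n (\<lambda>(i, j). if i = j then d i else 0)"

lemma dgm_carrier [simp]: "dgm n d \<in> carrier_mat n n"
  and dgm_dim [simp]: "dim_row (dgm n d) = n" "dim_col (dgm n d) = n"
  and dgm_entry [simp]: "i < n \<Longrightarrow> j < n \<Longrightarrow> dgm n d $$ (i, j) = (if i = j then d i else 0)"
  by (simp_all add: dgm_def)

lemma mult_dgm_entry:
  assumes "X \<in> carrier_mat m n" "i < m" "j < n"
  shows "(X * dgm n d) $$ (i, j) = X $$ (i, j) * d j"
proof -
  have "(\<Sum>l<n. X $$ (i, l) * dgm n d $$ (l, j)) = (\<Sum>l<n. if l = j then X $$ (i, l) * d l else 0)"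
    using assms by (intro sum.cong) auto
  thus ?thesis using assms by (simp add: mult_entry[of _ m n _ n])
qed

lemma dgm_mult_entry:
  assumes "X \<in> carrier_mat m n" "i < m" "j < n"
  shows "(dgm m d * X) $$ (i, j) = d i * X $$ (i, j)"
proof -
  have "(\<Sum>l<m. dgm m d $$ (i, l) * X $$ (l, j)) = (\<Sum>l<m. if l = i then d l * X $$ (l, j) else 0)"
    using assms by (intro sum.cong) auto
  thus ?thesis using assms by (simp add: mult_entry[of _ m m _ n])
qed

lemma dgm_mult: "dgm n d * dgm n d' = dgm n (\<lambda>i. d i * d' i)"
  by (rule eq_matI) (auto simp: mult_dgm_entry[of _ n])

lemma dgm_add: "dgm n d + dgm n d' = dgm n (\<lambda>i. d i + d' i)"
  by (rule eq_matI) auto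

lemma dgm_smult: "c \<cdot>\<^sub>m dgm n d = dgm n (\<lambda>i. c * d i)"
  by (rule eq_matI) auto

lemma dgm_one: "dgm n (\<lambda>_. 1) = 1\<^sub>m n"
  by (rule eq_matI) auto

lemma dgm_cong: "(\<And>i. i < n \<Longrightarrow> d i = d' i) \<Longrightarrow> dgm n d = dgm n d'"
  by (rule eq_matI) auto

lemma dgm_pow: "dgm n d ^\<^sub>m k = dgm n (\<lambda>i. d i ^ k)"
  by (induction k) (simp_all add: dgm_one dgm_mult mult.commute)

text \<open>Matrices of degree s for the grading by the weights h. In contrast to the relation
  [H, X] = s X, the entrywise form gives the commutation rule with every function of H at once,
  including q^H and the inverse of \<open>kap\<close>.\<close>

definition shifts :: "nat \<Rightarrow> (nat \<Rightarrow> complex) \<Rightarrow> complex \<Rightarrow> complex mat \<Rightarrow> bool" where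
  "shifts n h s X \<longleftrightarrow> (\<forall>i<n. \<forall>j<n. X $$ (i, j) \<noteq> 0 \<longrightarrow> h i = h j + s)"

lemma shifts_dgm:
  assumes "X \<in> carrier_mat n n" "shifts n h s X"
  shows "X * dgm n (\<lambda>i. g (h i)) = dgm n (\<lambda>i. g (h i - s)) * X"
proof (rule eq_matI)
  fix i j
  assume "i < dim_row (dgm n (\<lambda>i. g (h i - s)) * X)" "j < dim_col (dgm n (\<lambda>i. g (h i - s)) * X)"
  thus "(X * dgm n (\<lambda>i. g (h i))) $$ (i, j) = (dgm n (\<lambda>i. g (h i - s)) * X) $$ (i, j)"
    using assms
    by (cases "X $$ (i, j) = 0") (auto simp: mult_dgm_entry[of _ n] dgm_mult_entry[of _ _ n] shifts_def)
qed (use assms in auto)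

lemma shifts_mult:
  assumes "X \<in> carrier_mat n n" "Y \<in> carrier_mat n n" "shifts n h s X" "shifts n h t Y"
  shows "shifts n h (s + t) (X * Y)"
  unfolding shifts_def
proof (intro allI impI)
  fix i j assume ij: "i < n" "j < n" and "(X * Y) $$ (i, j) \<noteq> 0"
  then obtain l where "l < n" "X $$ (i, l) * Y $$ (l, j) \<noteq> 0"
    using assms by (metis (no_types, lifting) mult_entry sum.neutral lessThan_iff)
  thus "h i = h j + (s + t)" using assms(3,4) ij by (auto simp: shifts_def)
qed

lemma shifts_pow:
  assumes "X \<in> carrier_mat n n" "shifts n h s X"
  shows "shifts n h (of_nat k * s) (X ^\<^sub>m k)"
proof (induction k)
  case 0
  then show ?case using assms(1) by (auto simp: shifts_def)
next
  case (Suc k)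
  show ?case using shifts_mult[OF _ assms(1) Suc.IH assms(2)] assms(1) by (simp add: algebra_simps)
qed

section \<open>Kronecker products\<close>

lemma sum_div_mod:
  fixes f :: "nat \<Rightarrow> nat \<Rightarrow> 'a::comm_monoid_add"
  assumes "n > 0"
  shows "(\<Sum>k<m * n. f (k div n) (k mod n)) = (\<Sum>i<m. \<Sum>j<n. f i j)"
proof -
  have "(\<Sum>k<m * n. f (k div n) (k mod n)) = (\<Sum>i<m. \<Sum>k = i * n..<i * n + n. f (k div n) (k mod n))"
    by (simp add: sum.nat_group)
  also have "\<dots> = (\<Sum>i<m. \<Sum>j<n. f i j)"
  proof (rule sum.cong)
    fix i
    have idx: "k div n = i" "k mod n = k - i * n" if "i * n \<le> k" "k < i * n + n" for k
    proof -
      show "k div n = i" using that by (intro div_nat_eqI) (auto simp: algebra_simps)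
      thus "k mod n = k - i * n" by (simp add: modulo_nat_def mult.commute)
    qed
    show "(\<Sum>k = i * n..<i * n + n. f (k div n) (k mod n)) = (\<Sum>j<n. f i j)"
      by (rule sum.reindex_bij_witness[of _ "\<lambda>j. i * n + j" "\<lambda>k. k - i * n"])
        (auto simp: idx)
  qed simp
  finally show ?thesis .
qed

lemma div_lt: "i < m * n \<Longrightarrow> i div n < (m::nat)" and mod_lt: "i < m * n \<Longrightarrow> i mod n < (n::nat)"
  by (auto simp: less_mult_imp_div_less) (metis mod_less_divisor mult_0_right not_less0 neq0_conv)

lemma kron_carrier [simp]:
  "A \<in> carrier_mat a b \<Longrightarrow> B \<in> carrier_mat c d \<Longrightarrow> kron A B \<in> carrier_mat (a * c) (b * d)"
  by (auto simp: kron_def)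

lemma kron_dim [simp]: "dim_row (kron A B) = dim_row A * dim_row B"
  "dim_col (kron A B) = dim_col A * dim_col B"
  by (simp_all add: kron_def)

lemma kron_entry:
  "i < dim_row A * dim_row B \<Longrightarrow> j < dim_col A * dim_col B \<Longrightarrow> kron A B $$ (i, j) =
    A $$ (i div dim_row B, j div dim_col B) * B $$ (i mod dim_row B, j mod dim_col B)"
  by (simp add: kron_def)

lemma kron_mult:
  assumes "A \<in> carrier_mat m m" "A' \<in> carrier_mat m m" "B \<in> carrier_mat n n" "B' \<in> carrier_mat n n"
  shows "kron A B * kron A' B' = kron (A * A') (B * B')"
proof (rule eq_matI)
  fix i j
  assume "i < dim_row (kron (A * A') (B * B'))" "j < dim_col (kron (A * A') (B * B'))"
  hence i: "i < m * n" and j: "j < m * n" using assms by auto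
  hence n: "n > 0" by (cases n) auto
  have "(kron A B * kron A' B') $$ (i, j) = (\<Sum>k<m * n. kron A B $$ (i, k) * kron A' B' $$ (k, j))"
    using assms i j by (intro mult_entry) auto
  also have "\<dots> = (\<Sum>k<m * n. (A $$ (i div n, k div n) * A' $$ (k div n, j div n)) *
      (B $$ (i mod n, k mod n) * B' $$ (k mod n, j mod n)))"
    using assms i j by (intro sum.cong) (auto simp: kron_entry)
  also have "\<dots> = (\<Sum>k<m. A $$ (i div n, k) * A' $$ (k, j div n)) *
      (\<Sum>k<n. B $$ (i mod n, k) * B' $$ (k, j mod n))"
    using sum_div_mod[OF n, where m = m and f = "\<lambda>k l. (A $$ (i div n, k) * A' $$ (k, j div n)) *
      (B $$ (i mod n, l) * B' $$ (l, j mod n))"] by (simp add: sum_product)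
  also have "\<dots> = kron (A * A') (B * B') $$ (i, j)"
    using assms i j n div_lt[OF i] div_lt[OF j] by (subst kron_entry) (auto simp: mult_entry[of _ m m _ m] mult_entry[of _ n n _ n])
  finally show "(kron A B * kron A' B') $$ (i, j) = kron (A * A') (B * B') $$ (i, j)" .
qed (use assms in auto)

lemma kron_assoc: "kron (kron A B) C = kron A (kron B C)"
proof (rule eq_matI)
  fix i j
  assume "i < dim_row (kron A (kron B C))" "j < dim_col (kron A (kron B C))"
  hence i: "i < dim_row A * dim_row B * dim_row C" and j: "j < dim_col A * dim_col B * dim_col C"
    by (auto simp: mult.assoc)
  have p: "0 < dim_row B * dim_row C" "0 < dim_col B * dim_col C" using i j by (auto intro!: Nat.gr0I)
  have m: "i mod (dim_row B * dim_row C) div dim_row C = i div dim_row C mod dim_row B"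
    "i mod (dim_row B * dim_row C) mod dim_row C = i mod dim_row C"
    "j mod (dim_col B * dim_col C) div dim_col C = j div dim_col C mod dim_col B"
    "j mod (dim_col B * dim_col C) mod dim_col C = j mod dim_col C"
    using p by (simp_all add: mult.commute[of "dim_row B"] mult.commute[of "dim_col B"] mod_mult2_eq)
  have d: "i div (dim_row B * dim_row C) = i div dim_row C div dim_row B"
    "j div (dim_col B * dim_col C) = j div dim_col C div dim_col B"
    by (simp_all add: mult.commute[of "dim_row B"] mult.commute[of "dim_col B"] div_mult2_eq)
  show "kron (kron A B) C $$ (i, j) = kron A (kron B C) $$ (i, j)"
    using i j div_lt[OF i] div_lt[OF j] p by (simp add: kron_entry mult.assoc m d)
qed (auto simp: mult.assoc)

lemma kron_add_left:
  assumes "A \<in> carrier_mat a b" "A' \<in> carrier_mat a b"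
  shows "kron (A + A') B = kron A B + kron A' B"
  using assms by (intro eq_matI) (auto simp: kron_entry div_lt algebra_simps)

lemma kron_add_right:
  assumes "B \<in> carrier_mat a b" "B' \<in> carrier_mat a b"
  shows "kron A (B + B') = kron A B + kron A B'"
  using assms by (intro eq_matI) (auto simp: kron_entry mod_lt algebra_simps)

lemma kron_smult_left: "kron (c \<cdot>\<^sub>m A) B = c \<cdot>\<^sub>m kron A B"
  by (intro eq_matI) (auto simp: kron_entry div_lt)

lemma kron_smult_right: "kron A (c \<cdot>\<^sub>m B) = c \<cdot>\<^sub>m kron A B"
  by (intro eq_matI) (auto simp: kron_entry mod_lt)

lemma kron_dgm: "kron (dgm m d) (dgm n d') = dgm (m * n) (\<lambda>i. d (i div n) * d' (i mod n))"
proof (rule eq_matI)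
  fix i j
  assume "i < dim_row (dgm (m * n) (\<lambda>i. d (i div n) * d' (i mod n)))"
    "j < dim_col (dgm (m * n) (\<lambda>i. d (i div n) * d' (i mod n)))"
  hence "i < m * n" "j < m * n" by auto
  moreover have "i = j" if "i div n = j div n" "i mod n = j mod n"
    using that by (metis div_mult_mod_eq)
  ultimately show "kron (dgm m d) (dgm n d') $$ (i, j) = dgm (m * n) (\<lambda>i. d (i div n) * d' (i mod n)) $$ (i, j)"
    by (auto simp: kron_entry div_lt mod_lt)
qed auto

lemma kron_one: "kron (1\<^sub>m m) (1\<^sub>m n) = 1\<^sub>m (m * n)"
  unfolding dgm_one[symmetric] kron_dgm by simp

lemma kron_zero_left [simp]: "kron (0\<^sub>m a b) B = 0\<^sub>m (a * dim_row B) (b * dim_col B)"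
  by (rule eq_matI) (auto simp: kron_entry div_lt)

lemma kron_zero_right [simp]: "kron A (0\<^sub>m a b) = 0\<^sub>m (dim_row A * a) (dim_col A * b)"
  by (rule eq_matI) (auto simp: kron_entry mod_lt)

lemma kron_pow:
  assumes "A \<in> carrier_mat m m" "B \<in> carrier_mat n n"
  shows "kron A B ^\<^sub>m k = kron (A ^\<^sub>m k) (B ^\<^sub>m k)"
proof (induction k)
  case 0
  then show ?case using assms by (simp add: kron_one)
next
  case (Suc k)
  have "kron A B ^\<^sub>m Suc k = kron (A ^\<^sub>m k) (B ^\<^sub>m k) * kron A B" by (simp add: Suc.IH)
  also have "\<dots> = kron (A ^\<^sub>m Suc k) (B ^\<^sub>m Suc k)"
    using assms by (subst kron_mult) auto
  finally show ?case .
qed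

section \<open>The algebra of a weight module\<close>

text \<open>\<open>dg g\<close> plays the role of $g(H)$, and \<open>L\<close> contains the weights of the module.\<close>

locale wmod =
  fixes r :: nat and E F :: lop and dg :: "(complex \<Rightarrow> complex) \<Rightarrow> lop" and L :: "complex set"
  assumes r2: "r \<ge> 2"
    and dg_mult: "dg g * dg g' = dg (\<lambda>x. g x * g' x)"
    and dg_add: "dg g + dg g' = dg (\<lambda>x. g x + g' x)"
    and dg_const: "dg (\<lambda>_. c) = sc c"
    and dg_cong: "(\<And>x. x \<in> L \<Longrightarrow> g x = g' x) \<Longrightarrow> dg g = dg g'"
    and E_dg: "E * dg g = dg (\<lambda>x. g (x - 2)) * E"
    and F_dg: "F * dg g = dg (\<lambda>x. g (x + 2)) * F"
    and EF: "E * F = F * E + dg (qint r)"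
    and Er: "E ^ r = 0" and Fr: "F ^ r = 0"
begin

lemma dg_E: "dg g * E = E * dg (\<lambda>x. g (x + 2))"
  and dg_F: "dg g * F = F * dg (\<lambda>x. g (x - 2))"
  by (simp_all add: E_dg F_dg)

lemma dg_Epow: "dg g * E ^ k = E ^ k * dg (\<lambda>x. g (x + 2 * of_nat k))"
proof (induction k arbitrary: g)
  case (Suc k)
  have "dg g * E ^ Suc k = E * (dg (\<lambda>x. g (x + 2)) * E ^ k)"
    by (simp add: mult.assoc[symmetric] dg_E)
  thus ?case by (simp add: Suc.IH mult.assoc[symmetric] add_ac distrib_left)
qed simp

lemma dg_Fpow: "dg g * F ^ k = F ^ k * dg (\<lambda>x. g (x - 2 * of_nat k))"
proof (induction k arbitrary: g)
  case (Suc k)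
  have "dg g * F ^ Suc k = F * (dg (\<lambda>x. g (x - 2)) * F ^ k)"
    by (simp add: mult.assoc[symmetric] dg_F)
  moreover have "(\<lambda>x. g (x - 2 * of_nat k - 2)) = (\<lambda>x. g (x - 2 * of_nat (Suc k)))"
    by (simp add: algebra_simps)
  ultimately show ?case by (simp only: Suc.IH mult.assoc[symmetric] power_Suc)
qed simp

lemma E_zero_pow: "k \<ge> r \<Longrightarrow> E ^ k = 0" and F_zero_pow: "k \<ge> r \<Longrightarrow> F ^ k = 0"
  using power_add[of E r "k - r"] power_add[of F r "k - r"] by (simp_all add: Er Fr)

lemma E_Fpow:
  "E * F ^ Suc j = F ^ Suc j * E + F ^ j * dg (\<lambda>x. qint r (of_nat (Suc j)) * qint r (x - of_nat j))"
proof (induction j)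
  case 0
  have "qint r 1 = 1" using qbr_1_nz[OF r2] by (simp add: qint_def)
  then show ?case using EF by simp
next
  case (Suc j)
  have "E * F ^ Suc (Suc j) = (E * F ^ Suc j) * F" by (simp only: power_Suc2 mult.assoc)
  also have "\<dots> = F ^ Suc j * (E * F) +
      F ^ j * (dg (\<lambda>x. qint r (of_nat (Suc j)) * qint r (x - of_nat j)) * F)"
    unfolding Suc.IH by (simp only: distrib_right mult.assoc)
  also have "\<dots> = F ^ Suc (Suc j) * E + F ^ Suc j * (dg (qint r) +
      dg (\<lambda>x. qint r (of_nat (Suc j)) * qint r (x - 2 - of_nat j)))"
    unfolding EF dg_F by (simp only: distrib_left power_Suc2 mult.assoc add.assoc)
  also have "dg (qint r) + dg (\<lambda>x. qint r (of_nat (Suc j)) * qint r (x - 2 - of_nat j)) =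
      dg (\<lambda>x. qint r (of_nat (Suc (Suc j))) * qint r (x - of_nat (Suc j)))"
    unfolding dg_add
  proof (rule dg_cong)
    fix x :: complex
    have eq: "x - of_nat (Suc j) - 1 = x - 2 - of_nat j" "of_nat (Suc j) + 1 = (of_nat (Suc (Suc j)) :: complex)"
      by (simp_all add: algebra_simps)
    show "qint r x + qint r (of_nat (Suc j)) * qint r (x - 2 - of_nat j) =
        qint r (of_nat (Suc (Suc j))) * qint r (x - of_nat (Suc j))"
      by (rule qint_add[OF r2, of x "of_nat (Suc j)", unfolded eq])
  qed
  finally show ?case .
qed

lemma Epow_F:
  "E ^ Suc k * F = F * E ^ Suc k + E ^ k * dg (\<lambda>x. qint r (of_nat (Suc k)) * qint r (x + of_nat k))"
proof (induction k)
  case 0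
  have "qint r 1 = 1" using qbr_1_nz[OF r2] by (simp add: qint_def)
  then show ?case using EF by simp
next
  case (Suc k)
  have "E ^ Suc (Suc k) * F = E * (E ^ Suc k * F)" by (simp only: power_Suc mult.assoc)
  also have "\<dots> = (E * F) * E ^ Suc k +
      E ^ Suc k * dg (\<lambda>x. qint r (of_nat (Suc k)) * qint r (x + of_nat k))"
    unfolding Suc.IH by (simp only: distrib_left mult.assoc power_Suc)
  also have "\<dots> = F * E ^ Suc (Suc k) + (dg (qint r) * E ^ Suc k +
      E ^ Suc k * dg (\<lambda>x. qint r (of_nat (Suc k)) * qint r (x + of_nat k)))"
    unfolding EF by (simp only: distrib_right power_Suc mult.assoc add.assoc)
  also have "dg (qint r) * E ^ Suc k + E ^ Suc k * dg (\<lambda>x. qint r (of_nat (Suc k)) * qint r (x + of_nat k)) =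
     E ^ Suc k * dg (\<lambda>x. qint r (x + 2 * of_nat (Suc k)) + qint r (of_nat (Suc k)) * qint r (x + of_nat k))"
    unfolding dg_Epow dg_add[symmetric] by (simp only: distrib_left)
  also have "dg (\<lambda>x. qint r (x + 2 * of_nat (Suc k)) + qint r (of_nat (Suc k)) * qint r (x + of_nat k)) =
     dg (\<lambda>x. qint r (of_nat (Suc (Suc k))) * qint r (x + of_nat (Suc k)))"
  proof (rule dg_cong)
    fix x :: complex
    have eq: "x + of_nat (Suc k) - 1 = x + of_nat k"
      "x + 2 * of_nat (Suc k) - of_nat (Suc k) = x + of_nat (Suc k)"
      "of_nat (Suc k) + 1 = (of_nat (Suc (Suc k)) :: complex)"
      by (simp_all add: algebra_simps)
    show "qint r (x + 2 * of_nat (Suc k)) + qint r (of_nat (Suc k)) * qint r (x + of_nat k) =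
      qint r (of_nat (Suc (Suc k))) * qint r (x + of_nat (Suc k))"
      by (rule qint_add[OF r2, of "x + 2 * of_nat (Suc k)" "of_nat (Suc k)", unfolded eq])
  qed
  finally show ?case .
qed

lemma E_dg_zero: "E * X = 0 \<Longrightarrow> E * (dg g * X) = 0"
  by (simp add: mult.assoc[symmetric] E_dg) (simp add: mult.assoc)

text \<open>An operator X with E X = 0 stands for a whole family of highest weight vectors, the
  columns of X. Their weights may differ, so the usual scalars become functions of H placed directly
  to the left of X.\<close>

lemma EF_hw:
  assumes "E * X = 0"
  shows "E * (F ^ Suc j * X) = F ^ j * (dg (\<lambda>x. qint r (of_nat (Suc j)) * qint r (x - of_nat j)) * X)"
  by (simp only: mult.assoc[symmetric] E_Fpow distrib_right)
     (simp only: mult.assoc assms mult_zero_right add_0)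

lemma EjFj_hw:
  assumes "E * X = 0"
  shows "E ^ j * (F ^ j * X) = dg (kap r j) * X"
  using assms
proof (induction j arbitrary: X)
  case 0
  then show ?case by (simp add: dg_const)
next
  case (Suc j)
  let ?g = "\<lambda>x. qint r (of_nat (Suc j)) * qint r (x - of_nat j)"
  have "E ^ Suc j * (F ^ Suc j * X) = E ^ j * (E * (F ^ Suc j * X))"
    by (simp only: power_Suc2 mult.assoc)
  also have "\<dots> = E ^ j * (F ^ j * (dg ?g * X))" by (simp only: EF_hw[OF Suc.prems])
  also have "\<dots> = dg (kap r j) * (dg ?g * X)" by (rule Suc.IH[OF E_dg_zero[OF Suc.prems]])
  also have "\<dots> = dg (\<lambda>x. kap r j x * ?g x) * X"
    by (simp add: mult.assoc[of "dg (kap r j)" "dg ?g" X, symmetric] dg_mult del: of_nat_Suc)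
  also have "(\<lambda>x. kap r j x * ?g x) = kap r (Suc j)" by (simp add: fun_eq_iff kap_Suc)
  finally show ?case .
qed

lemma EaFb_hw:
  assumes "E * X = 0" "b < a"
  shows "E ^ a * (F ^ b * X) = 0"
proof -
  have "a = (a - b - 1) + Suc b" using assms by simp
  hence "E ^ a = E ^ (a - b - 1) * (E * E ^ b)" by (metis power_add power_Suc)
  hence "E ^ a * (F ^ b * X) = E ^ (a - b - 1) * (E * (E ^ b * (F ^ b * X)))" by (simp add: mult.assoc)
  thus ?thesis using assms E_dg_zero by (simp add: EjFj_hw)
qed

section \<open>The averaging operator and the highest weight vectors\<close>

definition Av :: "lop \<Rightarrow> lop" where
  "Av X = (\<Sum>i<r. \<Sum>j<r. F ^ i * E ^ j * X * E ^ (r - 1 - j) * F ^ (r - 1 - i))"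

definition prj :: lop where
  "prj = E ^ (r - 1) * F ^ (r - 1) * dg (\<lambda>x. inverse (kap r (r - 1) x))"

definition psi :: lop where
  "psi = prj * dg (\<lambda>x. inverse (kap r (r - 1) x))"

lemma Suc_r: "Suc (r - 1) = r" using r2 by simp

lemma E_prj: "E * prj = 0" and prj_F: "prj * F = 0"
proof -
  have "E * E ^ (r - 1) = 0" "F ^ (r - 1) * F = 0"
    using Er Fr Suc_r by (metis power_Suc, metis power_Suc2)
  thus "E * prj = 0" "prj * F = 0"
    unfolding prj_def by (simp_all only: mult.assoc dg_F) (simp_all add: mult.assoc[symmetric])
qed

lemma prj_hw:
  assumes "\<And>x. x \<in> L \<Longrightarrow> x \<notin> \<int>" "E * X = 0"
  shows "prj * X = X"
proof -
  have "prj * X = dg (kap r (r - 1)) * (dg (\<lambda>x. inverse (kap r (r - 1) x)) * X)"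
    using assms by (simp add: prj_def mult.assoc EjFj_hw E_dg_zero)
  also have "\<dots> = dg (\<lambda>_. 1) * X"
    unfolding mult.assoc[symmetric] dg_mult
    by (intro arg_cong2[of _ _ _ _ "(*)"] dg_cong) (use kap_nz[OF r2] r2 assms(1) in auto)
  finally show ?thesis by (simp add: dg_const)
qed

lemma dg_prj: "dg g * prj = prj * dg g"
proof -
  have "dg g * prj = E ^ (r - 1) * (dg (\<lambda>x. g (x + 2 * of_nat (r - 1))) * F ^ (r - 1)) *
      dg (\<lambda>x. inverse (kap r (r - 1) x))"
    by (simp only: prj_def mult.assoc[symmetric] dg_Epow)
  also have "\<dots> = E ^ (r - 1) * F ^ (r - 1) * (dg g * dg (\<lambda>x. inverse (kap r (r - 1) x)))"
    by (simp add: dg_Fpow mult.assoc)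
  also have "\<dots> = prj * dg g" by (simp add: prj_def dg_mult mult.assoc mult.commute)
  finally show ?thesis .
qed

text \<open>Every operator annihilated by $E^k$ is a combination of operators $F^lT$ with $ET = 0$,
  and on these \<open>Av psi\<close> is the identity.\<close>

lemma Av_psi:
  assumes L: "\<And>x. x \<in> L \<Longrightarrow> x \<notin> \<int>"
  shows "Av psi = 1"
proof -
  have Epsi: "E * psi = 0" using E_prj by (simp add: psi_def mult.assoc[symmetric])
  have psiF: "psi * F = 0" unfolding psi_def by (simp only: mult.assoc dg_F) (simp add: mult.assoc[symmetric] prj_F)
  have "F ^ i * E ^ j * psi = (if j = 0 then F ^ i * psi else 0)" for i j
    using Epsi by (cases j) (auto simp: power_Suc2 mult.assoc simp del: power_Suc)
  hence "Av psi = (\<Sum>i<r. \<Sum>j<r. (if j = 0 then F ^ i * psi else 0) * E ^ (r - 1 - j) * F ^ (r - 1 - i))"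
    by (simp add: Av_def)
  also have "\<dots> = (\<Sum>i<r. F ^ i * psi * E ^ (r - 1) * F ^ (r - 1 - i))"
  proof (rule sum.cong)
    fix i
    have "(\<Sum>j<r. (if j = 0 then F ^ i * psi else 0) * E ^ (r - 1 - j) * F ^ (r - 1 - i)) =
      (\<Sum>j<r. if j = 0 then F ^ i * psi * E ^ (r - 1) * F ^ (r - 1 - i) else 0)"
      by (rule sum.cong) auto
    thus "(\<Sum>j<r. (if j = 0 then F ^ i * psi else 0) * E ^ (r - 1 - j) * F ^ (r - 1 - i)) =
       F ^ i * psi * E ^ (r - 1) * F ^ (r - 1 - i)" using r2 by simp
  qed simp
  finally have Av: "Av psi = (\<Sum>i<r. F ^ i * psi * E ^ (r - 1) * F ^ (r - 1 - i))" .
  \<comment> \<open>Only the summand i = k acts on F^k T. For i < k the power of F applied to T has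
    exponent at least r. For i > k it has fewer than r - 1 factors, and E^(r-1) annihilates the
    result.\<close>
  have hw: "Av psi * (F ^ k * T) = F ^ k * T" if T: "E * T = 0" and k: "k < r" for k T
  proof -
    have t: "F ^ i * psi * E ^ (r - 1) * F ^ (r - 1 - i) * (F ^ k * T) =
        (if i = k then F ^ k * T else 0)" if i: "i < r" for i
    proof -
      have e: "F ^ i * psi * E ^ (r - 1) * F ^ (r - 1 - i) * (F ^ k * T) =
        F ^ i * (psi * (E ^ (r - 1) * (F ^ (r - 1 - i + k) * T)))"
        by (simp add: power_add mult.assoc)
      consider "i < k" | "i > k" | "i = k" by linarith
      thus ?thesis
      proof cases
        case 1
        hence "r - 1 - i + k \<ge> r" using k i by simp
        thus ?thesis using 1 unfolding e by (simp add: F_zero_pow)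
      next
        case 2
        hence "r - 1 - i + k < r - 1" using i by simp
        thus ?thesis using 2 T unfolding e by (simp add: EaFb_hw)
      next
        case 3
        hence "r - 1 - i + k = r - 1" using i by simp
        hence "E ^ (r - 1) * (F ^ (r - 1 - i + k) * T) = dg (kap r (r - 1)) * T"
          using T by (simp add: EjFj_hw)
        moreover have "psi * (dg (kap r (r - 1)) * T) = T"
        proof -
          have "psi * (dg (kap r (r - 1)) * T) = prj * (dg (\<lambda>x. inverse (kap r (r - 1) x) * kap r (r - 1) x) * T)"
            by (simp add: psi_def mult.assoc[symmetric] dg_mult[symmetric])
          also have "dg (\<lambda>x. inverse (kap r (r - 1) x) * kap r (r - 1) x) = dg (\<lambda>_. 1)"
            by (rule dg_cong) (use kap_nz[OF r2] r2 L in auto)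
          finally show ?thesis using prj_hw[OF L T] by (simp add: dg_const)
        qed
        ultimately show ?thesis using 3 unfolding e by simp
      qed
    qed
    have "Av psi * (F ^ k * T) = (\<Sum>i<r. if i = k then F ^ k * T else 0)"
      unfolding Av sum_distrib_right using t by (intro sum.cong) auto
    thus ?thesis using k by simp
  qed
  \<comment> \<open>Peel off the lowest layer: T is chosen so that E^k F^k T = E^k X, hence X - F^k
    T is annihilated by a smaller power of E. The conclusion for X = 1 then starts from E^r =
    0.\<close>
  have "Av psi * X = X" if "E ^ k * X = 0" "k \<le> r" for k X
    using that
  proof (induction k arbitrary: X)
    case (Suc k)
    define T where "T = dg (\<lambda>x. inverse (kap r k x)) * (E ^ k * X)"
    have T: "E * T = 0" unfolding T_def
      using Suc.prems by (intro E_dg_zero) (simp add: mult.assoc[symmetric])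
    have "E ^ k * (F ^ k * T) = dg (\<lambda>x. kap r k x * inverse (kap r k x)) * (E ^ k * X)"
      unfolding EjFj_hw[OF T] unfolding T_def by (simp only: mult.assoc[symmetric] dg_mult)
    also have "dg (\<lambda>x. kap r k x * inverse (kap r k x)) = dg (\<lambda>_. 1)"
      by (rule dg_cong) (use kap_nz[OF r2, of k] Suc.prems L in auto)
    finally have "E ^ k * (X - F ^ k * T) = 0" by (simp add: dg_const right_diff_distrib)
    hence "Av psi * (X - F ^ k * T) = X - F ^ k * T" using Suc by simp
    moreover have "Av psi * (F ^ k * T) = F ^ k * T" using hw[OF T] Suc.prems by simp
    ultimately show ?case by (simp add: right_diff_distrib)
  qed simp
  from this[of r 1] show ?thesis by (simp add: Er)
qed

end

section \<open>Weight modules\<close>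

text \<open>The relations of the quantum group in a basis of weight vectors, with h i the weight of
  the i-th one. Nilpotency of E and F belongs to the definition so that it is available for all
  tensor products.\<close>

definition umodule :: "nat \<Rightarrow> nat \<Rightarrow> (nat \<Rightarrow> complex) \<Rightarrow> umod \<Rightarrow> bool" where
  "umodule r n h M \<longleftrightarrow> n > 0 \<and>
     actE M \<in> carrier_mat n n \<and> actF M \<in> carrier_mat n n \<and> actH M = dgm n h \<and>
     actK M = dgm n (\<lambda>i. qp r (h i)) \<and> actKi M = dgm n (\<lambda>i. qp r (- h i)) \<and>
     shifts n h 2 (actE M) \<and> shifts n h (- 2) (actF M) \<and>
     actE M * actF M = actF M * actE M + dgm n (\<lambda>i. qint r (h i)) \<and>
     actE M ^\<^sub>m r = 0\<^sub>m n n \<and> actF M ^\<^sub>m r = 0\<^sub>m n n"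

lemma umoduleD:
  assumes "umodule r n h M"
  shows "n > 0" "actE M \<in> carrier_mat n n" "actF M \<in> carrier_mat n n" "actH M = dgm n h"
    "actK M = dgm n (\<lambda>i. qp r (h i))" "actKi M = dgm n (\<lambda>i. qp r (- h i))"
    "shifts n h 2 (actE M)" "shifts n h (- 2) (actF M)"
    "actE M * actF M = actF M * actE M + dgm n (\<lambda>i. qint r (h i))"
    "actE M ^\<^sub>m r = 0\<^sub>m n n" "actF M ^\<^sub>m r = 0\<^sub>m n n" "mdimension M = n"
  using assms by (simp_all add: umodule_def mdimension_def)

definition dgl :: "nat \<Rightarrow> (nat \<Rightarrow> complex) \<Rightarrow> (complex \<Rightarrow> complex) \<Rightarrow> lop" where
  "dgl n h g = bl n (dgm n (\<lambda>i. g (h i)))"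

text \<open>The homomorphism is left general because three of them occur: the block representation
  \<open>bl n\<close> itself, and the embeddings X \<mapsto> X \<otimes> 1 and X \<mapsto> 1
  \<otimes> X of the operators on V into those on V \<otimes> V.\<close>

lemma wmod_hom:
  assumes r: "r \<ge> 2" and M: "umodule r n h M"
    and mult: "\<And>X Y. X \<in> carrier_mat n n \<Longrightarrow> Y \<in> carrier_mat n n \<Longrightarrow> \<phi> (X * Y) = \<phi> X * \<phi> Y"
    and add: "\<And>X Y. X \<in> carrier_mat n n \<Longrightarrow> Y \<in> carrier_mat n n \<Longrightarrow> \<phi> (X + Y) = \<phi> X + \<phi> Y"
    and smult: "\<And>X c. X \<in> carrier_mat n n \<Longrightarrow> \<phi> (c \<cdot>\<^sub>m X) = sc c * \<phi> X"
    and one: "\<phi> (1\<^sub>m n) = 1"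
  shows "wmod r (\<phi> (actE M)) (\<phi> (actF M)) (\<lambda>g. \<phi> (dgm n (\<lambda>i. g (h i)))) (h ` {..<n})"
proof -
  note D = umoduleD[OF M]
  have pow: "\<phi> X ^ k = \<phi> (X ^\<^sub>m k)" if X: "X \<in> carrier_mat n n" for X k
  proof (induction k)
    case 0
    then show ?case using X one by simp
  next
    case (Suc k)
    have "\<phi> (X ^\<^sub>m Suc k) = \<phi> (X ^\<^sub>m k) * \<phi> X" using X by (simp add: mult)
    thus ?case by (simp add: Suc.IH[symmetric] power_commutes)
  qed
  have "0\<^sub>m n n = 0 \<cdot>\<^sub>m (1\<^sub>m n :: complex mat)" by (rule eq_matI) auto
  hence zero: "\<phi> (0\<^sub>m n n) = 0" by (simp add: smult)
  show ?thesis
  proof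
    fix g g' :: "complex \<Rightarrow> complex" and c
    show "\<phi> (dgm n (\<lambda>i. g (h i))) * \<phi> (dgm n (\<lambda>i. g' (h i))) = \<phi> (dgm n (\<lambda>i. g (h i) * g' (h i)))"
      by (simp add: mult[symmetric] dgm_mult)
    show "\<phi> (dgm n (\<lambda>i. g (h i))) + \<phi> (dgm n (\<lambda>i. g' (h i))) = \<phi> (dgm n (\<lambda>i. g (h i) + g' (h i)))"
      by (simp add: add[symmetric] dgm_add)
    show "\<phi> (dgm n (\<lambda>i. c)) = sc c"
      using smult[of "1\<^sub>m n" c] dgm_smult[of c n "\<lambda>_. 1"] by (simp add: one dgm_one)
    show "\<phi> (actE M) * \<phi> (dgm n (\<lambda>i. g (h i))) = \<phi> (dgm n (\<lambda>i. g (h i - 2))) * \<phi> (actE M)"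
      using shifts_dgm[OF D(2,7), of g] D(2) by (simp add: mult[symmetric])
    show "\<phi> (actF M) * \<phi> (dgm n (\<lambda>i. g (h i))) = \<phi> (dgm n (\<lambda>i. g (h i + 2))) * \<phi> (actF M)"
      using shifts_dgm[OF D(3,8), of g] D(3) by (simp add: mult[symmetric])
    show "\<phi> (dgm n (\<lambda>i. g (h i))) = \<phi> (dgm n (\<lambda>i. g' (h i)))" if "\<And>x. x \<in> h ` {..<n} \<Longrightarrow> g x = g' x"
      using that by (intro arg_cong[of _ _ \<phi>] dgm_cong) auto
    show "\<phi> (actE M) * \<phi> (actF M) = \<phi> (actF M) * \<phi> (actE M) + \<phi> (dgm n (\<lambda>i. qint r (h i)))"
      using D by (simp add: mult[symmetric] add[symmetric] mult_carrier_mat[of _ n n _ n])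
  qed (use D r in \<open>simp_all add: pow zero\<close>)
qed

lemma umodule_wmod:
  assumes "r \<ge> 2" and M: "umodule r n h M"
  shows "wmod r (bl n (actE M)) (bl n (actF M)) (dgl n h) (h ` {..<n})"
  using wmod_hom[OF assms, of "bl n"] umoduleD(1)[OF M]
  by (simp add: dgl_def[abs_def] bl_mult bl_add bl_smult bl_one)

lemma shifts_dgm_0: "shifts n h 0 (dgm n d)"
  by (auto simp: shifts_def)

lemma shifts_one: "shifts n h 0 (1\<^sub>m n)"
  by (auto simp: shifts_def)

lemma shifts_add:
  assumes "X \<in> carrier_mat n n" "Y \<in> carrier_mat n n" "shifts n h s X" "shifts n h s Y"
  shows "shifts n h s (X + Y)"
  using assms unfolding shifts_def by (metis add.right_neutral index_add_mat(1) carrier_matD)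

lemma shifts_kron:
  assumes "A \<in> carrier_mat m m" "B \<in> carrier_mat n n" "shifts m h s A" "shifts n h' t B"
  shows "shifts (m * n) (\<lambda>i. h (i div n) + h' (i mod n)) (s + t) (kron A B)"
  unfolding shifts_def
proof (intro allI impI)
  fix i j assume i: "i < m * n" and j: "j < m * n" and nz: "kron A B $$ (i, j) \<noteq> 0"
  hence "A $$ (i div n, j div n) \<noteq> 0" "B $$ (i mod n, j mod n) \<noteq> 0"
    using assms by (auto simp: kron_entry)
  thus "h (i div n) + h' (i mod n) = h (j div n) + h' (j mod n) + (s + t)"
    using assms(3,4) div_lt[OF i] div_lt[OF j] mod_lt[OF i] mod_lt[OF j] by (simp add: shifts_def)
qed

definition kb :: "nat \<Rightarrow> nat \<Rightarrow> complex mat \<Rightarrow> complex mat \<Rightarrow> lop" where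
  "kb m n A B = bl (m * n) (kron A B)"

context
  fixes m n :: nat
  assumes mn: "m > 0" "n > 0"
begin

lemma kb_mult:
  assumes "A \<in> carrier_mat m m" "A' \<in> carrier_mat m m" "B \<in> carrier_mat n n" "B' \<in> carrier_mat n n"
  shows "kb m n A B * kb m n A' B' = kb m n (A * A') (B * B')"
  using assms mn by (simp add: kb_def bl_mult[symmetric] kron_mult)

lemma kb_pow:
  assumes "A \<in> carrier_mat m m" "B \<in> carrier_mat n n"
  shows "kb m n A B ^ k = kb m n (A ^\<^sub>m k) (B ^\<^sub>m k)"
  using assms mn by (simp add: kb_def bl_pow[symmetric] kron_pow)

lemma kb_add_left:
  assumes "A \<in> carrier_mat m m" "A' \<in> carrier_mat m m" "B \<in> carrier_mat n n"
  shows "kb m n (A + A') B = kb m n A B + kb m n A' B"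
  using assms mn by (simp add: kb_def bl_add[symmetric] kron_add_left)

lemma kb_add_right:
  assumes "A \<in> carrier_mat m m" "B \<in> carrier_mat n n" "B' \<in> carrier_mat n n"
  shows "kb m n A (B + B') = kb m n A B + kb m n A B'"
  using assms mn by (simp add: kb_def bl_add[symmetric] kron_add_right)

lemma kb_smult:
  assumes "A \<in> carrier_mat m m" "B \<in> carrier_mat n n"
  shows "kb m n (c \<cdot>\<^sub>m A) B = sc c * kb m n A B" "kb m n A (c \<cdot>\<^sub>m B) = sc c * kb m n A B"
  using assms mn by (simp_all add: kb_def bl_smult[symmetric] kron_smult_left kron_smult_right)

lemma kb_zero:
  assumes "A \<in> carrier_mat m m" "B \<in> carrier_mat n n"
  shows "kb m n (0\<^sub>m m m) B = 0" "kb m n A (0\<^sub>m n n) = 0"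
  using assms mn by (simp_all add: kb_def bl_zero)

lemma kb_one: "kb m n (1\<^sub>m m) (1\<^sub>m n) = 1"
  using mn by (simp add: kb_def kron_one bl_one)

lemma kb_bls: "A \<in> carrier_mat m m \<Longrightarrow> B \<in> carrier_mat n n \<Longrightarrow> kb m n A B \<in> bls (m * n)"
  by (simp add: kb_def)

end

lemma umodule_K_E:
  assumes "umodule r n h M"
  shows "actK M * actE M = qp r 2 \<cdot>\<^sub>m (actE M * actK M)"
    and "actF M * actK M = qp r 2 \<cdot>\<^sub>m (actK M * actF M)"
    and "actE M * actKi M = qp r 2 \<cdot>\<^sub>m (actKi M * actE M)"
    and "actKi M * actF M = qp r 2 \<cdot>\<^sub>m (actF M * actKi M)"
proof -
  note D = umoduleD[OF assms]
  have s: "dgm n (\<lambda>i. c * d i) * X = c \<cdot>\<^sub>m (dgm n d * X)" if "X \<in> carrier_mat n n" for c d X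
    unfolding dgm_smult[symmetric] using that by (simp add: mult_smult_assoc_mat[of _ n n _ n])
  have E: "actE M * actK M = qp r (- 2) \<cdot>\<^sub>m (actK M * actE M)"
    using shifts_dgm[OF D(2,7), of "qp r"] D(2) s[of "actE M" "qp r (- 2)"]
    by (simp add: D(5) qp_diff mult.commute)
  show "actE M * actKi M = qp r 2 \<cdot>\<^sub>m (actKi M * actE M)"
    using shifts_dgm[OF D(2,7), of "\<lambda>x. qp r (- x)"] s[OF D(2), of "qp r 2" "\<lambda>i. qp r (- h i)"]
    by (simp add: D(6) qp_diff)
  show "actF M * actK M = qp r 2 \<cdot>\<^sub>m (actK M * actF M)"
    using shifts_dgm[OF D(3,8), of "qp r"] D(3) s[of "actF M" "qp r 2"]
    by (simp add: D(5) qp_add mult.commute)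
  have F: "actF M * actKi M = qp r (- 2) \<cdot>\<^sub>m (actKi M * actF M)"
    using shifts_dgm[OF D(3,8), of "\<lambda>x. qp r (- x)"] D(3) s[of "actF M" "qp r (- 2)"]
    by (simp add: D(6) qp_diff mult.commute)
  have i: "X = qp r 2 \<cdot>\<^sub>m (qp r (- 2) \<cdot>\<^sub>m X)" for X
    by (rule eq_matI) (simp_all add: mult.assoc[symmetric])
  show "actK M * actE M = qp r 2 \<cdot>\<^sub>m (actE M * actK M)" unfolding E by (rule i)
  show "actKi M * actF M = qp r 2 \<cdot>\<^sub>m (actF M * actKi M)" unfolding F by (rule i)
qed

lemma tens_simps:
  assumes M: "umodule r m hM M" and N: "umodule r n hN N"
  shows "actE (tens M N) = kron (1\<^sub>m m) (actE N) + kron (actE M) (actK N)"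
    "actF (tens M N) = kron (actKi M) (actF N) + kron (actF M) (1\<^sub>m n)"
    "actH (tens M N) = dgm (m * n) (\<lambda>i. hM (i div n) + hN (i mod n))"
    "actK (tens M N) = dgm (m * n) (\<lambda>i. qp r (hM (i div n) + hN (i mod n)))"
    "actKi (tens M N) = dgm (m * n) (\<lambda>i. qp r (- (hM (i div n) + hN (i mod n))))"
  using umoduleD[OF M] umoduleD[OF N]
  by (simp_all add: tens_def Let_def dgm_one[symmetric] kron_dgm dgm_add qp_add[symmetric] add.commute)

text \<open>The point that needs an argument is nilpotency: the two summands of the coproduct of E
  commute up to q^2, so by \<open>twisted_add_power\<close> the r-th power of their sum is the sum
  of their r-th powers, and the same holds for F. In the commutator of E and F the mixed terms
  cancel, since the powers of q from the two tensor factors are inverse to each other.\<close>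

lemma umodule_tens:
  assumes r: "r \<ge> 2" and M: "umodule r m hM M" and N: "umodule r n hN N"
  shows "umodule r (m * n) (\<lambda>i. hM (i div n) + hN (i mod n)) (tens M N)"
proof -
  note DM = umoduleD[OF M] and DN = umoduleD[OF N]
  note T = tens_simps[OF M N]
  let ?h = "\<lambda>i. hM (i div n) + hN (i mod n)"
  have mn: "m > 0" "n > 0" using DM DN by auto
  have cM: "actK M \<in> carrier_mat m m" "actKi M \<in> carrier_mat m m" using DM by auto
  have cN: "actK N \<in> carrier_mat n n" "actKi N \<in> carrier_mat n n" using DN by auto
  note car = DM(2,3) DN(2,3) cM cN
  note km = kb_mult[OF mn] and kp = kb_pow[OF mn] and ks = kb_smult[OF mn] and kz = kb_zero[OF mn]
    and kal = kb_add_left[OF mn] and kar = kb_add_right[OF mn]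
  define Ea Eb Fa Fb where "Ea = kb m n (1\<^sub>m m) (actE N)" and "Eb = kb m n (actE M) (actK N)"
    and "Fa = kb m n (actKi M) (actF N)" and "Fb = kb m n (actF M) (1\<^sub>m n)"
  have E: "bl (m * n) (actE (tens M N)) = Ea + Eb"
    unfolding T Ea_def Eb_def kb_def using car mn by (intro bl_add) auto
  have F: "bl (m * n) (actF (tens M N)) = Fa + Fb"
    unfolding T Fa_def Fb_def kb_def using car mn by (intro bl_add) auto
  have cE: "actE (tens M N) \<in> carrier_mat (m * n) (m * n)" and cF: "actF (tens M N) \<in> carrier_mat (m * n) (m * n)"
    unfolding T using car by auto
  have EaFa: "Ea * Fa = Fa * Ea + kb m n (actKi M) (dgm n (\<lambda>i. qint r (hN i)))"
    unfolding Ea_def Fa_def using car by (simp add: km kar[symmetric] DN(9))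
  have EbFb: "Eb * Fb = Fb * Eb + kb m n (dgm m (\<lambda>i. qint r (hM i))) (actK N)"
    unfolding Eb_def Fb_def using car by (simp add: km kal[symmetric] DM(9))
  have EaFb: "Ea * Fb = Fb * Ea"
    unfolding Ea_def Fb_def using car by (simp add: km)
  have EbFa: "Eb * Fa = Fa * Eb"
    unfolding Eb_def Fa_def using car
    by (simp add: km umodule_K_E(3)[OF M] umodule_K_E(2)[OF N] ks)
  \<comment> \<open>What the commutator leaves over is K^(-1) \<otimes> [H] + [H] \<otimes> K, the
    coproduct of [H].\<close>
  have diag: "kb m n (actKi M) (dgm n (\<lambda>i. qint r (hN i))) + kb m n (dgm m (\<lambda>i. qint r (hM i))) (actK N)
     = bl (m * n) (dgm (m * n) (\<lambda>i. qint r (?h i)))"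
  proof -
    have "qp r (- a) * qint r b + qint r a * qp r b = qint r (a + b)" for a b
      using qbr_1_nz[OF r] by (simp add: qint_def divide_simps)
        (simp add: qbr_def right_diff_distrib left_diff_distrib qp_add[symmetric] add.commute)
    thus ?thesis using mn by (simp add: kb_def DM DN kron_dgm bl_add[symmetric] dgm_add)
  qed
  have "bl (m * n) (actE (tens M N)) * bl (m * n) (actF (tens M N)) =
     bl (m * n) (actF (tens M N)) * bl (m * n) (actE (tens M N)) + bl (m * n) (dgm (m * n) (\<lambda>i. qint r (?h i)))"
    unfolding E F diag[symmetric] by (simp add: distrib_left distrib_right EaFa EbFb EaFb EbFa)
  hence comm: "actE (tens M N) * actF (tens M N) = actF (tens M N) * actE (tens M N) + dgm (m * n) (\<lambda>i. qint r (?h i))"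
    using cE cF mn by (intro bl_inj[of "m * n"]) (auto simp: bl_mult bl_add)
  have "Eb * Ea = sc (qp r 2) * Ea * Eb"
    unfolding Ea_def Eb_def using car by (simp add: km ks mult.assoc umodule_K_E(1)[OF N])
  hence "(Ea + Eb) ^ r = Ea ^ r + Eb ^ r" by (rule twisted_add_power[OF primitive_root_qp(1)[OF r]])
  also have "\<dots> = 0" unfolding Ea_def Eb_def using car by (simp add: kp DM(10) DN(10) kz)
  finally have Er: "actE (tens M N) ^\<^sub>m r = 0\<^sub>m (m * n) (m * n)"
    using cE mn by (intro bl_inj[of "m * n"]) (auto simp: bl_pow bl_zero E)
  have "Fa * Fb = sc (qp r 2) * Fb * Fa"
    unfolding Fa_def Fb_def using car by (simp add: km ks mult.assoc umodule_K_E(4)[OF M])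
  hence "(Fb + Fa) ^ r = Fb ^ r + Fa ^ r" by (rule twisted_add_power[OF primitive_root_qp(1)[OF r]])
  also have "\<dots> = 0" unfolding Fa_def Fb_def using car by (simp add: kp DM(11) DN(11) kz)
  finally have Fr: "actF (tens M N) ^\<^sub>m r = 0\<^sub>m (m * n) (m * n)"
    using cF mn by (intro bl_inj[of "m * n"]) (auto simp: bl_pow bl_zero F add.commute)
  have sK: "shifts n hN 0 (actK N)" "shifts m hM 0 (actKi M)" by (simp_all add: DN(5) DM(6) shifts_dgm_0)
  have sE: "shifts (m * n) ?h 2 (actE (tens M N))"
    unfolding T using car shifts_kron[OF one_carrier_mat[of m] DN(2) shifts_one DN(7), where h = hM]
      shifts_kron[OF DM(2) cN(1) DM(7) sK(1)]
    by (intro shifts_add) auto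
  have sF: "shifts (m * n) ?h (- 2) (actF (tens M N))"
    unfolding T using car shifts_kron[OF cM(2) DN(3) sK(2) DN(8)]
      shifts_kron[OF DM(3) one_carrier_mat[of n] DM(8) shifts_one, where h' = hN]
    by (intro shifts_add) auto
  show ?thesis unfolding umodule_def using mn cE cF comm Er Fr sE sF T by simp
qed

lemma umodule_unitmod: "r \<ge> 2 \<Longrightarrow> umodule r 1 (\<lambda>_. 0) unitmod"
proof -
  assume "r \<ge> 2"
  then obtain k where k: "r = Suc k" by (cases r) auto
  have "qint r 0 = 0" by (simp add: qint_def qbr_def)
  thus ?thesis unfolding umodule_def unitmod_def k
    by (auto simp: shifts_def dgm_def intro!: eq_matI)
qed

text \<open>E^r and F^r vanish for reasons of weight: they would move a weight by 2r, while the
  weights of V_a differ by at most 2(r - 1).\<close>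

lemma umodule_Vmod:
  assumes r: "r \<ge> 2"
  shows "umodule r r (wt r a) (Vmod r a)"
proof -
  let ?E = "actE (Vmod r a)" and ?F = "actF (Vmod r a)"
  have cE: "?E \<in> carrier_mat r r" and cF: "?F \<in> carrier_mat r r" by (simp_all add: Vmod_def)
  have sE: "shifts r (wt r a) 2 ?E" and sF: "shifts r (wt r a) (- 2) ?F"
    by (auto simp: shifts_def Vmod_def wt_def split: if_splits)
  have neq: "wt r a i \<noteq> wt r a j + of_nat r * 2" if "j < r" for i j
  proof
    assume "wt r a i = wt r a j + of_nat r * 2"
    hence "2 * of_nat j = (2 * of_nat (i + r) :: complex)" by (simp add: wt_def algebra_simps)
    hence "of_nat j = (of_nat (i + r) :: complex)" by (simp only: mult_left_cancel[OF zero_neq_numeral[symmetric]])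
    thus False using that by (simp only: of_nat_eq_iff)
  qed
  have sr: "wt r a i \<noteq> wt r a j + of_nat r * 2" "wt r a i \<noteq> wt r a j + of_nat r * - 2" if "i < r" "j < r" for i j
    using neq[of j i] neq[of i j] that by auto
  have Er: "?E ^\<^sub>m r = 0\<^sub>m r r" and Fr: "?F ^\<^sub>m r = 0\<^sub>m r r"
    using shifts_pow[OF cE sE, of r] shifts_pow[OF cF sF, of r] sr cE cF
    by (auto simp: shifts_def intro!: eq_matI)
  have comm: "?E * ?F = ?F * ?E + dgm r (\<lambda>i. qint r (wt r a i))"
  proof (rule eq_matI)
    fix i j
    assume "i < dim_row (?F * ?E + dgm r (\<lambda>i. qint r (wt r a i)))"
      "j < dim_col (?F * ?E + dgm r (\<lambda>i. qint r (wt r a i)))"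
    hence ij: "i < r" "j < r" by auto
    define e where "e k = qint r (of_nat k) * qint r (a + of_nat r - of_nat k)" for k
    \<comment> \<open>Because of [r] = 0 the coefficient formula for E also covers the two ends: it
      gives 0 at the nonexistent vector v_r as well as at v_0.\<close>
    have z: "qint r 0 = 0" "qint r (of_nat r) = 0"
      using r by (auto simp: qint_def qbr_eq_0_iff qp_eq_1_iff intro!: exI[of _ 1])
    hence e0: "e 0 = 0" "e r = 0" by (simp_all add: e_def)
    have E: "?E $$ (k, l) = (if l = Suc k then e l else 0)" and F: "?F $$ (k, l) = (if k = Suc l then 1 else 0)"
      if "k < r" "l < r" for k l
      using that by (auto simp: Vmod_def e_def)
    have "(?E * ?F) $$ (i, j) = (\<Sum>l<r. ?E $$ (i, l) * ?F $$ (l, j))"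
      using ij cE cF by (intro mult_entry)
    also have "\<dots> = (\<Sum>l<r. if l = Suc j then (if i = j then e l else 0) else 0)"
      using ij by (intro sum.cong) (auto simp: E F)
    also have "\<dots> = (if i = j then e (Suc i) else 0)"
      using ij e0 by (cases "Suc j = r") auto
    finally have 1: "(?E * ?F) $$ (i, j) = (if i = j then e (Suc i) else 0)" .
    have "(?F * ?E) $$ (i, j) = (\<Sum>l<r. ?F $$ (i, l) * ?E $$ (l, j))"
      using ij cE cF by (intro mult_entry)
    \<comment> \<open>For i = 0 the index i - 1 is again 0, which is harmless since e 0 = 0.\<close>
    also have "\<dots> = (\<Sum>l<r. if l = i - 1 then (if i = j then e i else 0) else 0)"
      by (intro sum.cong; cases i) (use ij e0 in \<open>auto simp: E F\<close>)
    also have "\<dots> = (if i = j then e i else 0)"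
      using ij e0 by auto
    finally have 2: "(?F * ?E) $$ (i, j) = (if i = j then e i else 0)" .
    have "e (Suc i) = e i + qint r (wt r a i)"
      using qint_mult_Suc[OF r, of "of_nat i" "a + of_nat r - 1"]
      by (simp add: e_def wt_def algebra_simps)
    thus "(?E * ?F) $$ (i, j) = (?F * ?E + dgm r (\<lambda>i. qint r (wt r a i))) $$ (i, j)"
      using ij cE cF by (simp add: 1 2) auto
  qed (use cE cF in auto)
  show ?thesis unfolding umodule_def using r cE cF sE sF Er Fr comm
    by (auto simp: Vmod_def dgm_def)
qed

text \<open>The base-r digits of i are the indices of the tensor factors, with the last factor in
  the lowest digit, so this adds up their weights.\<close>

definition wsum :: "nat \<Rightarrow> complex \<Rightarrow> nat \<Rightarrow> nat \<Rightarrow> complex" where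
  "wsum r a n = rec_nat (\<lambda>_. 0) (\<lambda>n h i. h (i div r) + wt r a (i mod r)) n"

lemma wsum_0 [simp]: "wsum r a 0 i = 0"
  and wsum_Suc: "wsum r a (Suc n) i = wsum r a n (i div r) + wt r a (i mod r)"
  by (simp_all add: wsum_def)

lemma umodule_tpow:
  assumes "r \<ge> 2"
  shows "umodule r (r ^ n) (wsum r a n) (tpow (Vmod r a) n)"
proof (induction n)
  case 0
  then show ?case using umodule_unitmod[OF assms] by simp
next
  case (Suc n)
  show ?case using umodule_tens[OF assms Suc.IH umodule_Vmod[OF assms, of a]]
    by (simp add: wsum_Suc[abs_def] mult.commute)
qed

text \<open>The witness s is the sum of the n lowest base-r digits of i, each of which is at most r
  - 1.\<close>

lemma wsum_form:
  assumes "r \<ge> 2"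
  shows "\<exists>s. s \<le> n * (r - 1) \<and> wsum r a n i = of_nat n * (a + of_nat (r - 1)) - 2 * of_nat s"
proof (induction n arbitrary: i)
  case 0
  then show ?case by simp
next
  case (Suc n)
  from Suc.IH[of "i div r"] obtain s where s: "s \<le> n * (r - 1)"
    "wsum r a n (i div r) = of_nat n * (a + of_nat (r - 1)) - 2 * of_nat s" by blast
  have "i mod r \<le> r - 1" using assms by (metis Suc_pred' less_Suc_eq_le mod_less_divisor not_numeral_le_zero neq0_conv)
  hence "s + i mod r \<le> Suc n * (r - 1)" using s(1) by simp
  moreover have "wsum r a (Suc n) i = of_nat (Suc n) * (a + of_nat (r - 1)) - 2 * of_nat (s + i mod r)"
    using assms by (simp add: wsum_Suc s(2) wt_def of_nat_diff algebra_simps)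
  ultimately show ?case by blast
qed

section \<open>Associativity of the tensor product\<close>

lemma kron_one_1 [simp]: "kron A (1\<^sub>m (Suc 0)) = A" "kron (1\<^sub>m (Suc 0)) A = A"
  by (rule eq_matI; auto simp: kron_entry)+

lemma tens_sel:
  "actE (tens M N) = kron (1\<^sub>m (mdimension M)) (actE N) + kron (actE M) (actK N)"
  "actF (tens M N) = kron (actKi M) (actF N) + kron (actF M) (1\<^sub>m (mdimension N))"
  "actH (tens M N) = kron (actH M) (1\<^sub>m (mdimension N)) + kron (1\<^sub>m (mdimension M)) (actH N)"
  "actK (tens M N) = kron (actK M) (actK N)"
  "actKi (tens M N) = kron (actKi M) (actKi N)"
  by (simp_all add: tens_def Let_def)

text \<open>An equality, not merely an isomorphism, since Kronecker products are strictly
  associative. The powers \<open>tpow\<close> grow on the right, whereas the open strand is the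
  first factor and a braid generator acts in the middle; strict associativity provides these other
  groupings without any transport of matrices.\<close>

lemma tens_assoc:
  assumes A: "umodule r a hA A" and B: "umodule r b hB B" and C: "umodule r c hC C"
  shows "tens (tens A B) C = tens A (tens B C)"
proof -
  note D = umoduleD[OF A] umoduleD[OF B] umoduleD[OF C]
  have car: "actE A \<in> carrier_mat a a" "actF A \<in> carrier_mat a a" "actH A \<in> carrier_mat a a"
    "actK A \<in> carrier_mat a a" "actKi A \<in> carrier_mat a a"
    "actE B \<in> carrier_mat b b" "actF B \<in> carrier_mat b b" "actH B \<in> carrier_mat b b"
    "actK B \<in> carrier_mat b b" "actKi B \<in> carrier_mat b b"
    "actE C \<in> carrier_mat c c" "actF C \<in> carrier_mat c c" "actH C \<in> carrier_mat c c"
    "actK C \<in> carrier_mat c c" "actKi C \<in> carrier_mat c c"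
    using D by auto
  have dims: "mdimension A = a" "mdimension B = b" "mdimension C = c" using D by auto
  have dAB: "mdimension (tens A B) = a * b" and dBC: "mdimension (tens B C) = b * c"
    using car dims by (simp_all add: mdimension_def tens_def Let_def)
  have E: "actE (tens (tens A B) C) = actE (tens A (tens B C))"
  proof -
    have "kron (1\<^sub>m (a * b)) (actE C) + kron (kron (1\<^sub>m a) (actE B) + kron (actE A) (actK B)) (actK C) =
      kron (1\<^sub>m a) (kron (1\<^sub>m b) (actE C) + kron (actE B) (actK C)) + kron (actE A) (kron (actK B) (actK C))"
      using car kron_add_left[of "kron (1\<^sub>m a) (actE B)" "a * b" "a * b" "kron (actE A) (actK B)" "actK C"]
        kron_add_right[of "kron (1\<^sub>m b) (actE C)" "b * c" "b * c" "kron (actE B) (actK C)" "1\<^sub>m a"]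
      by (simp add: kron_one[symmetric] kron_assoc)
        (rule assoc_add_mat[symmetric, of _ "a * (b * c)" "a * (b * c)"], auto)
    thus ?thesis by (simp add: tens_sel dAB dBC dims)
  qed
  have F: "actF (tens (tens A B) C) = actF (tens A (tens B C))"
  proof -
    have "kron (kron (actKi A) (actKi B)) (actF C) + kron (kron (actKi A) (actF B) + kron (actF A) (1\<^sub>m b)) (1\<^sub>m c) =
      kron (actKi A) (kron (actKi B) (actF C) + kron (actF B) (1\<^sub>m c)) + kron (actF A) (1\<^sub>m (b * c))"
      using car kron_add_left[of "kron (actKi A) (actF B)" "a * b" "a * b" "kron (actF A) (1\<^sub>m b)" "1\<^sub>m c"]
        kron_add_right[of "kron (actKi B) (actF C)" "b * c" "b * c" "kron (actF B) (1\<^sub>m c)" "actKi A"]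
      by (simp add: kron_one[symmetric] kron_assoc)
        (rule assoc_add_mat[symmetric, of _ "a * (b * c)" "a * (b * c)"], auto)
    thus ?thesis by (simp add: tens_sel dAB dBC dims)
  qed
  have H: "actH (tens (tens A B) C) = actH (tens A (tens B C))"
  proof -
    have "kron (kron (actH A) (1\<^sub>m b) + kron (1\<^sub>m a) (actH B)) (1\<^sub>m c) + kron (1\<^sub>m (a * b)) (actH C) =
      kron (actH A) (1\<^sub>m (b * c)) + kron (1\<^sub>m a) (kron (actH B) (1\<^sub>m c) + kron (1\<^sub>m b) (actH C))"
      using car kron_add_left[of "kron (actH A) (1\<^sub>m b)" "a * b" "a * b" "kron (1\<^sub>m a) (actH B)" "1\<^sub>m c"]
        kron_add_right[of "kron (actH B) (1\<^sub>m c)" "b * c" "b * c" "kron (1\<^sub>m b) (actH C)" "1\<^sub>m a"]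
      by (simp add: kron_one[symmetric] kron_assoc)
        (rule assoc_add_mat[of _ "a * (b * c)" "a * (b * c)"], auto)
    thus ?thesis by (simp add: tens_sel dAB dBC dims)
  qed
  have K: "actK (tens (tens A B) C) = actK (tens A (tens B C))"
    and Ki: "actKi (tens (tens A B) C) = actKi (tens A (tens B C))"
    by (simp_all add: tens_sel kron_assoc)
  show ?thesis by (rule umod.equality) (simp_all add: E F H K Ki)
qed

lemma tens_unitmod:
  assumes "umodule r n h M"
  shows "tens M unitmod = M" "tens unitmod M = M"
proof -
  note D = umoduleD[OF assms]
  have c: "dim_row (actE M) = n" "dim_col (actE M) = n" "dim_row (actF M) = n" "dim_col (actF M) = n"
    "mdimension unitmod = 1"
    using D by (auto simp: mdimension_def unitmod_def)
  have s: "0\<^sub>m n n + X = X" "X + 0\<^sub>m n n = X" if "X \<in> carrier_mat n n" for X :: "complex mat"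
    using that by auto
  show "tens M unitmod = M" "tens unitmod M = M"
    unfolding tens_def Let_def c D(12) using D c s
    by (auto simp: unitmod_def intro!: umod.equality)
qed

lemma tpow_add:
  assumes r: "r \<ge> 2"
  shows "tpow (Vmod r a) (m + n) = tens (tpow (Vmod r a) m) (tpow (Vmod r a) n)"
proof (induction n)
  case 0
  then show ?case using tens_unitmod(1)[OF umodule_tpow[OF r]] by simp
next
  case (Suc n)
  then show ?case
    using tens_assoc[OF umodule_tpow[OF r] umodule_tpow[OF r] umodule_Vmod[OF r, of a], of a m a n] by simp
qed

lemma tpow_1: "r \<ge> 2 \<Longrightarrow> tpow (Vmod r a) (Suc 0) = Vmod r a"
  using tens_unitmod(2)[OF umodule_Vmod] by simp

section \<open>The trace identity\<close>

text \<open>By cyclicity, the operation in the hypothesis on e is the adjoint of \<open>Av\<close>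
  for the form Tr (X Y). Since f commutes with E and F, it can be carried along on either
  side.\<close>

lemma (in wmod) tr_psi:
  assumes N: "N > 0" "E \<in> bls N" "F \<in> bls N" "\<And>g. dg g \<in> bls N" "e \<in> bls N" "f \<in> bls N"
    and f: "E * f = f * E" "F * f = f * F"
    and L: "\<And>x. x \<in> L \<Longrightarrow> x \<notin> \<int>"
    and e: "(\<Sum>j<r. \<Sum>i<r. E ^ (r - 1 - j) * F ^ (r - 1 - i) * e * F ^ i * E ^ j) = sc c"
  shows "tr N (e * f) = c * tr N (f * psi)"
proof -
  have psi: "psi \<in> bls N"
    unfolding psi_def prj_def using N by (intro bls_mult bls_power) auto
  have pw: "E ^ j * f = f * E ^ j" "F ^ j * f = f * F ^ j" for j
    using power_commuting_commutes[of E f j] power_commuting_commutes[of F f j] f by auto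
  have t: "tr N (e * f * (F ^ i * E ^ j * psi * E ^ (r - 1 - j) * F ^ (r - 1 - i))) =
     tr N (E ^ (r - 1 - j) * F ^ (r - 1 - i) * e * F ^ i * E ^ j * (f * psi))" for i j
  proof -
    have "e * f * (F ^ i * E ^ j * psi * E ^ (r - 1 - j) * F ^ (r - 1 - i)) =
       (e * f * F ^ i * E ^ j * psi) * (E ^ (r - 1 - j) * F ^ (r - 1 - i))"
      by (simp add: mult.assoc)
    hence "tr N (e * f * (F ^ i * E ^ j * psi * E ^ (r - 1 - j) * F ^ (r - 1 - i))) =
       tr N ((E ^ (r - 1 - j) * F ^ (r - 1 - i)) * (e * f * F ^ i * E ^ j * psi))"
      by (simp only:) (intro tr_mult_commute bls_mult bls_power N psi)
    also have "(E ^ (r - 1 - j) * F ^ (r - 1 - i)) * (e * f * F ^ i * E ^ j * psi) =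
        E ^ (r - 1 - j) * F ^ (r - 1 - i) * e * ((f * F ^ i) * E ^ j) * psi"
      by (simp add: mult.assoc)
    also have "(f * F ^ i) * E ^ j = F ^ i * E ^ j * f"
      by (metis pw mult.assoc)
    finally show ?thesis by (simp add: mult.assoc)
  qed
  have "e * f = e * f * Av psi" using Av_psi[OF L] by simp
  also have "\<dots> = (\<Sum>i<r. \<Sum>j<r. e * f * (F ^ i * E ^ j * psi * E ^ (r - 1 - j) * F ^ (r - 1 - i)))"
    by (simp add: Av_def sum_distrib_left)
  finally have "tr N (e * f) = tr N (\<Sum>i<r. \<Sum>j<r. e * f * (F ^ i * E ^ j * psi * E ^ (r - 1 - j) * F ^ (r - 1 - i)))"
    by (rule arg_cong)
  also have "\<dots> = (\<Sum>i<r. \<Sum>j<r. tr N (E ^ (r - 1 - j) * F ^ (r - 1 - i) * e * F ^ i * E ^ j * (f * psi)))"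
    by (simp only: tr_sum t)
  also have "\<dots> = tr N ((\<Sum>j<r. \<Sum>i<r. E ^ (r - 1 - j) * F ^ (r - 1 - i) * e * F ^ i * E ^ j) * (f * psi))"
    by (subst sum.swap) (simp add: tr_sum sum_distrib_right)
  finally show ?thesis by (simp only: e tr_sc)
qed

section \<open>Matrix units on V_a and their conjugates by E and F\<close>

definition umat :: "nat \<Rightarrow> nat \<Rightarrow> nat \<Rightarrow> complex mat" where
  "umat n i j = mat n n (\<lambda>(p, q). if p = i \<and> q = j then 1 else 0)"

lemma umat_carrier [simp]: "umat n i j \<in> carrier_mat n n"
  and umat_dim [simp]: "dim_row (umat n i j) = n" "dim_col (umat n i j) = n"
  and umat_entry [simp]: "p < n \<Longrightarrow> q < n \<Longrightarrow> umat n i j $$ (p, q) = (if p = i \<and> q = j then 1 else 0)"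
  by (simp_all add: umat_def)

lemma mult_umat_entry:
  assumes "X \<in> carrier_mat n n" "i < n" "p < n" "q < n"
  shows "(X * umat n i j) $$ (p, q) = (if q = j then X $$ (p, i) else 0)"
proof -
  have "(\<Sum>l<n. X $$ (p, l) * umat n i j $$ (l, q)) = (\<Sum>l<n. if l = i then (if q = j then X $$ (p, i) else 0) else 0)"
    using assms by (intro sum.cong) auto
  thus ?thesis using assms by (simp add: mult_entry[of _ n n _ n])
qed

lemma umat_mult_entry:
  assumes "X \<in> carrier_mat n n" "j < n" "p < n" "q < n"
  shows "(umat n i j * X) $$ (p, q) = (if p = i then X $$ (j, q) else 0)"
proof -
  have "(\<Sum>l<n. umat n i j $$ (p, l) * X $$ (l, q)) = (\<Sum>l<n. if l = j then (if p = i then X $$ (j, q) else 0) else 0)"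
    using assms by (intro sum.cong) auto
  thus ?thesis using assms by (simp add: mult_entry[of _ n n _ n])
qed

lemma dgm_umat: "i < n \<Longrightarrow> dgm n d * umat n i j = d i \<cdot>\<^sub>m umat n i j"
  by (rule eq_matI) (auto simp: mult_umat_entry)

lemma umat_dgm: "j < n \<Longrightarrow> umat n i j * dgm n d = d j \<cdot>\<^sub>m umat n i j"
  by (rule eq_matI) (auto simp: umat_mult_entry)

definition ecf :: "nat \<Rightarrow> complex \<Rightarrow> nat \<Rightarrow> complex" where
  "ecf r a k = qint r (of_nat k) * qint r (a + of_nat r - of_nat k)"

lemma Vmod_entries:
  assumes "p < r" "q < r"
  shows "actE (Vmod r a) $$ (p, q) = (if q = Suc p then ecf r a q else 0)"
    "actF (Vmod r a) $$ (p, q) = (if p = Suc q then 1 else 0)"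
  using assms by (auto simp: Vmod_def ecf_def)

lemma Vmod_pow_entries:
  assumes "p < r" "q < r"
  shows "(actE (Vmod r a) ^\<^sub>m k) $$ (p, q) = (if q = p + k then (\<Prod>l\<in>{p<..q}. ecf r a l) else 0)"
    "(actF (Vmod r a) ^\<^sub>m k) $$ (p, q) = (if p = q + k then 1 else 0)"
proof -
  have cE: "actE (Vmod r a) \<in> carrier_mat r r" and cF: "actF (Vmod r a) \<in> carrier_mat r r"
    by (simp_all add: Vmod_def)
  show "(actE (Vmod r a) ^\<^sub>m k) $$ (p, q) = (if q = p + k then (\<Prod>l\<in>{p<..q}. ecf r a l) else 0)"
    using assms
  proof (induction k arbitrary: q)
    case 0
    then show ?case using cE by auto
  next
    case (Suc k)
    have "(actE (Vmod r a) ^\<^sub>m Suc k) $$ (p, q) =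
        (\<Sum>l<r. (actE (Vmod r a) ^\<^sub>m k) $$ (p, l) * actE (Vmod r a) $$ (l, q))"
      using Suc.prems cE by (simp add: mult_entry[of _ r r _ r])
    also have "\<dots> = (\<Sum>l<r. if l = p + k then (if q = Suc l then (\<Prod>l\<in>{p<..l}. ecf r a l) * ecf r a q else 0) else 0)"
      using Suc by (intro sum.cong) (auto simp: Vmod_entries)
    also have "\<dots> = (if q = p + Suc k then (\<Prod>l\<in>{p<..q}. ecf r a l) else 0)"
    proof -
      have "{p<..Suc (p + k)} = insert (Suc (p + k)) {p<..p + k}" by auto
      thus ?thesis using Suc.prems by (auto simp: mult.commute)
    qed
    finally show ?case .
  qed
  show "(actF (Vmod r a) ^\<^sub>m k) $$ (p, q) = (if p = q + k then 1 else 0)"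
    using assms
  proof (induction k arbitrary: q)
    case 0
    then show ?case using cF by auto
  next
    case (Suc k)
    have "(actF (Vmod r a) ^\<^sub>m Suc k) $$ (p, q) =
        (\<Sum>l<r. (actF (Vmod r a) ^\<^sub>m k) $$ (p, l) * actF (Vmod r a) $$ (l, q))"
      using Suc.prems cF by (simp add: mult_entry[of _ r r _ r])
    also have "\<dots> = (\<Sum>l<r. if l = Suc q then (if p = l + k then 1 else 0) else 0)"
      using Suc by (intro sum.cong) (auto simp: Vmod_entries)
    also have "\<dots> = (if p = q + Suc k then 1 else 0)"
      using Suc.prems by auto
    finally show ?case .
  qed
qed

text \<open>E^(r-1) carries the lowest vector v_(r-1) back to v_0 and collects every coefficient of
  E on the way; a + r - 1 is the highest weight of V_a.\<close>

lemma kap_Vmod: "r \<ge> 2 \<Longrightarrow> kap r (r - 1) (a + of_nat r - 1) = (\<Prod>l\<in>{0<..r - 1}. ecf r a l)"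
  unfolding kap_def ecf_def
  by (rule prod.reindex_bij_witness[of _ "\<lambda>l. l - 1" Suc]) (auto simp: algebra_simps)

text \<open>From the left, E^j lifts |v_(r-1)> to |v_(r-1-j)>; from the right, E^(r-1-j) turns <v_0|
  into <v_(r-1-j)|. The two strings of coefficients of E complement each other to the full product
  \<open>kap\<close>, whatever j is.\<close>

lemma Vmod_conj:
  assumes "r \<ge> 2" "j < r"
  shows "actE (Vmod r a) ^\<^sub>m j * umat r (r - 1) 0 * actE (Vmod r a) ^\<^sub>m (r - 1 - j) =
    kap r (r - 1) (a + of_nat r - 1) \<cdot>\<^sub>m umat r (r - 1 - j) (r - 1 - j)"
proof (rule eq_matI)
  have cE: "actE (Vmod r a) ^\<^sub>m k \<in> carrier_mat r r" for k by (auto simp: Vmod_def intro!: pow_carrier_mat)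
  fix p q assume "p < dim_row (kap r (r - 1) (a + of_nat r - 1) \<cdot>\<^sub>m umat r (r - 1 - j) (r - 1 - j))"
    "q < dim_col (kap r (r - 1) (a + of_nat r - 1) \<cdot>\<^sub>m umat r (r - 1 - j) (r - 1 - j))"
  hence pq: "p < r" "q < r" by auto
  have "(actE (Vmod r a) ^\<^sub>m j * umat r (r - 1) 0 * actE (Vmod r a) ^\<^sub>m (r - 1 - j)) $$ (p, q) =
    (\<Sum>l<r. (actE (Vmod r a) ^\<^sub>m j * umat r (r - 1) 0) $$ (p, l) * (actE (Vmod r a) ^\<^sub>m (r - 1 - j)) $$ (l, q))"
    by (rule mult_entry[of _ r r _ r]) (use pq cE umat_carrier in \<open>auto intro!: mult_carrier_mat[of _ r r _ r]\<close>)
  also have "\<dots> = (\<Sum>l<r. if l = 0 then (actE (Vmod r a) ^\<^sub>m j) $$ (p, r - 1) * (actE (Vmod r a) ^\<^sub>m (r - 1 - j)) $$ (0, q) else 0)"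
    using pq cE assms by (intro sum.cong) (auto simp: mult_umat_entry)
  also have "\<dots> = (actE (Vmod r a) ^\<^sub>m j) $$ (p, r - 1) * (actE (Vmod r a) ^\<^sub>m (r - 1 - j)) $$ (0, q)"
    using assms by simp
  also have "\<dots> = (if p = r - 1 - j \<and> q = r - 1 - j then
      (\<Prod>l\<in>{p<..r - 1}. ecf r a l) * (\<Prod>l\<in>{0<..q}. ecf r a l) else 0)"
    using assms pq by (subst (1 2) Vmod_pow_entries) auto
  also have "\<dots> = (if p = r - 1 - j \<and> q = r - 1 - j then kap r (r - 1) (a + of_nat r - 1) else 0)"
  proof -
    have "{0<..r - 1} = {p<..r - 1} \<union> {0<..p}" using pq by auto
    thus ?thesis unfolding kap_Vmod[OF assms(1)] by (auto simp: prod.union_disjoint)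
  qed
  finally show "(actE (Vmod r a) ^\<^sub>m j * umat r (r - 1) 0 * actE (Vmod r a) ^\<^sub>m (r - 1 - j)) $$ (p, q) =
    (kap r (r - 1) (a + of_nat r - 1) \<cdot>\<^sub>m umat r (r - 1 - j) (r - 1 - j)) $$ (p, q)"
    using pq by auto
qed (auto simp: Vmod_def)

text \<open>The image of F does not involve v_0, so <v_0| F^k = 0 for k > 0 and only the exponent 0
  on the right survives.\<close>

lemma Vmod_F_conj:
  assumes "r \<ge> 2" "j < r"
  shows "actF (Vmod r a) ^\<^sub>m j * umat r 0 0 * actF (Vmod r a) ^\<^sub>m (r - 1 - j) =
    (if j = r - 1 then umat r (r - 1) 0 else 0\<^sub>m r r)"
proof (rule eq_matI)
  have cF: "actF (Vmod r a) ^\<^sub>m k \<in> carrier_mat r r" for k by (auto simp: Vmod_def intro!: pow_carrier_mat)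
  fix p q assume "p < dim_row (if j = r - 1 then umat r (r - 1) 0 else 0\<^sub>m r r)"
    "q < dim_col (if j = r - 1 then umat r (r - 1) 0 else 0\<^sub>m r r)"
  hence pq: "p < r" "q < r" by (auto split: if_splits)
  have "(actF (Vmod r a) ^\<^sub>m j * umat r 0 0 * actF (Vmod r a) ^\<^sub>m (r - 1 - j)) $$ (p, q) =
    (\<Sum>l<r. (actF (Vmod r a) ^\<^sub>m j * umat r 0 0) $$ (p, l) * (actF (Vmod r a) ^\<^sub>m (r - 1 - j)) $$ (l, q))"
    by (rule mult_entry[of _ r r _ r]) (use pq cF umat_carrier in \<open>auto intro!: mult_carrier_mat[of _ r r _ r]\<close>)
  also have "\<dots> = (\<Sum>l<r. if l = 0 then (actF (Vmod r a) ^\<^sub>m j) $$ (p, 0) * (actF (Vmod r a) ^\<^sub>m (r - 1 - j)) $$ (0, q) else 0)"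
    using pq cF assms by (intro sum.cong) (auto simp: mult_umat_entry)
  also have "\<dots> = (actF (Vmod r a) ^\<^sub>m j) $$ (p, 0) * (actF (Vmod r a) ^\<^sub>m (r - 1 - j)) $$ (0, q)"
    using assms by simp
  also have "\<dots> = (if p = j \<and> q = 0 \<and> j = r - 1 then 1 else 0)"
    using assms pq by (subst (1 2) Vmod_pow_entries) auto
  finally show "(actF (Vmod r a) ^\<^sub>m j * umat r 0 0 * actF (Vmod r a) ^\<^sub>m (r - 1 - j)) $$ (p, q) =
    (if j = r - 1 then umat r (r - 1) 0 else 0\<^sub>m r r) $$ (p, q)"
    using pq by auto
qed (auto simp: Vmod_def)

text \<open>The pivotal element acts by the power $1-r$ of $K$, and $q^{-2(r-1)} = q^2$.\<close>

definition piv :: "nat \<Rightarrow> nat \<Rightarrow> (nat \<Rightarrow> complex) \<Rightarrow> complex mat" where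
  "piv r n h = dgm n (\<lambda>i. qp r (- h i) ^ (r - 1))"

lemma qp_two_r: "r \<ge> 2 \<Longrightarrow> qp r (2 * of_nat r) = 1"
  by (subst qp_eq_1_iff) (auto intro!: exI[of _ 1])

lemma piv_comm:
  assumes "r \<ge> 2" "umodule r n h M"
  shows "actF M * piv r n h = qp r 2 \<cdot>\<^sub>m (piv r n h * actF M)"
    and "actE M * piv r n h = qp r (- 2) \<cdot>\<^sub>m (piv r n h * actE M)"
proof -
  note D = umoduleD[OF assms(2)]
  have s: "dgm n (\<lambda>i. c * d i) * X = c \<cdot>\<^sub>m (dgm n d * X)" if "X \<in> carrier_mat n n" for c d X
    unfolding dgm_smult[symmetric] using that by (simp add: mult_smult_assoc_mat[of _ n n _ n])
  have p: "qp r (- x) ^ (r - 1) = qp r (x - of_nat r * x)" for x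
    using assms(1) by (simp add: qp_power of_nat_diff algebra_simps)
  have 1: "qp r (- (x + 2)) ^ (r - 1) = qp r 2 * qp r (- x) ^ (r - 1)" for x
  proof -
    have "x + 2 - of_nat r * (x + 2) = 2 + (x - of_nat r * x) - (2 * of_nat r :: complex)"
      by (simp add: algebra_simps)
    thus ?thesis unfolding p by (simp only: qp_diff qp_add qp_minus qp_two_r[OF assms(1)]) simp
  qed
  have 2: "qp r (- (x - 2)) ^ (r - 1) = qp r (- 2) * qp r (- x) ^ (r - 1)" for x
    using 1[of "x - 2"] by (simp add: mult.assoc[symmetric])
  show "actF M * piv r n h = qp r 2 \<cdot>\<^sub>m (piv r n h * actF M)"
    using shifts_dgm[OF D(3,8), of "\<lambda>x. qp r (- x) ^ (r - 1)"]
    unfolding piv_def diff_minus_eq_add 1 s[OF D(3)] .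
  show "actE M * piv r n h = qp r (- 2) \<cdot>\<^sub>m (piv r n h * actE M)"
    using shifts_dgm[OF D(2,7), of "\<lambda>x. qp r (- x) ^ (r - 1)"]
    unfolding piv_def 2 s[OF D(2)] .
qed

lemma piv_carrier [simp]: "piv r n h \<in> carrier_mat n n"
  by (simp add: piv_def)

definition umat_sum :: "nat \<Rightarrow> nat \<Rightarrow> complex mat" where
  "umat_sum r k = dgm r (\<lambda>i. if i < k then 1 else 0)"

context
  fixes r n :: nat and a :: complex and h :: "nat \<Rightarrow> complex" and M :: umod
  assumes r: "r \<ge> 2" and M: "umodule r n h M"
begin

abbreviation (input) "WE \<equiv> bl (r * n) (actE (tens (Vmod r a) M))"
abbreviation (input) "WF \<equiv> bl (r * n) (actF (tens (Vmod r a) M))"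

lemmas Vmod_props = umoduleD[OF umodule_Vmod[OF r, of a]] and M_facts = umoduleD[OF M]

lemma dims_pos: "r > 0" "n > 0" using r M_facts by auto

lemma Vmod_carriers: "actE (Vmod r a) \<in> carrier_mat r r" "actF (Vmod r a) \<in> carrier_mat r r"
  "actK (Vmod r a) \<in> carrier_mat r r" "actKi (Vmod r a) \<in> carrier_mat r r"
  and M_carriers: "actE M \<in> carrier_mat n n" "actF M \<in> carrier_mat n n"
  "actK M \<in> carrier_mat n n" "actKi M \<in> carrier_mat n n"
  by (simp_all add: M_facts(2-3) Vmod_props(2-3)) (simp_all add: M_facts(5-6) Vmod_props(5-6))

lemmas mult_simps = mult_carrier_mat[of _ r r _ r] mult_carrier_mat[of _ n n _ n]
  left_mult_one_mat[of _ n n] right_mult_one_mat[of _ n n] left_mult_one_mat[of _ r r] right_mult_one_mat[of _ r r]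

lemma WE_split: "WE = kb r n (1\<^sub>m r) (actE M) + kb r n (actE (Vmod r a)) (actK M)"
  and WF_split: "WF = kb r n (actKi (Vmod r a)) (actF M) + kb r n (actF (Vmod r a)) (1\<^sub>m n)"
  unfolding tens_simps[OF umodule_Vmod[OF r, of a] M] kb_def using dims_pos Vmod_carriers M_carriers by (auto intro!: bl_add)

text \<open>The exponent 1 - r of the pivotal element is what makes this work: moving F past it
  costs q^2, the same factor by which the summands K^(-1) \<otimes> F and F \<otimes> 1 commute.
  Hence \<open>twisted_conj_sum\<close> applies and removes the summand that acts on the second
  factor by F.\<close>

lemma F_conj_sum:
  "(\<Sum>i<r. WF ^ i * kb r n (umat r 0 0) (piv r n h) * WF ^ (r - 1 - i)) =
    kb r n (umat r (r - 1) 0) (piv r n h)"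
proof -
  let ?A = "kb r n (actKi (Vmod r a)) (actF M)" and ?B = "kb r n (actF (Vmod r a)) (1\<^sub>m n)"
  let ?e = "kb r n (umat r 0 0) (piv r n h)"
  note car = Vmod_carriers M_carriers umat_carrier piv_carrier
  have AB: "?A * ?B = sc (qp r 2) * ?B * ?A"
    using car dims_pos by (simp add: mult_simps kb_mult kb_smult mult.assoc umodule_K_E(4)[OF umodule_Vmod[OF r, of a]])
  have "actKi (Vmod r a) * umat r 0 0 = umat r 0 0 * actKi (Vmod r a)"
    using dims_pos by (simp add: Vmod_props(6) dgm_umat umat_dgm)
  hence Ae: "?A * ?e = sc (qp r 2) * ?e * ?A"
    using car dims_pos by (simp add: mult_simps kb_mult kb_smult mult.assoc piv_comm[OF r M])
  have "(\<Sum>i<r. WF ^ i * ?e * WF ^ (r - 1 - i)) = (\<Sum>i<r. ?B ^ i * ?e * ?B ^ (r - 1 - i))"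
    unfolding WF_split by (rule twisted_conj_sum[OF primitive_root_qp(1)[OF r] AB Ae])
  also have "\<dots> = (\<Sum>i<r. if i = r - 1 then kb r n (umat r (r - 1) 0) (piv r n h) else 0)"
  proof (rule sum.cong)
    fix i assume i: "i \<in> {..<r}"
    have "?B ^ i * ?e * ?B ^ (r - 1 - i) =
      kb r n (actF (Vmod r a) ^\<^sub>m i * umat r 0 0 * actF (Vmod r a) ^\<^sub>m (r - 1 - i)) (1\<^sub>m n ^\<^sub>m i * piv r n h * 1\<^sub>m n ^\<^sub>m (r - 1 - i))"
      using car dims_pos by (simp add: mult_simps kb_pow kb_mult)
    also have "1\<^sub>m n ^\<^sub>m i * piv r n h * 1\<^sub>m n ^\<^sub>m (r - 1 - i) = piv r n h"
      unfolding dgm_one[symmetric] dgm_pow piv_def dgm_mult by simp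
    finally show "?B ^ i * ?e * ?B ^ (r - 1 - i) = (if i = r - 1 then kb r n (umat r (r - 1) 0) (piv r n h) else 0)"
      using i Vmod_F_conj[OF r, of i a] dims_pos by (simp add: kb_zero(1)[OF dims_pos one_carrier_mat])
  qed simp
  finally show ?thesis using dims_pos by simp
qed

text \<open>Here the common twist is q^(-2), and 1 \<otimes> E is the summand that drops out. The
  powers of K coming from E \<otimes> K on the two sides add up to K^(r-1), which cancels the
  pivotal element. On the first factor the matrix units |v_i><v_i| remain, each with the same
  scalar, and they add up to 1.\<close>

lemma E_conj_sum:
  "(\<Sum>j<r. WE ^ j * kb r n (umat r (r - 1) 0) (piv r n h) * WE ^ (r - 1 - j)) =
    sc (kap r (r - 1) (a + of_nat r - 1))"
proof -
  let ?A = "kb r n (1\<^sub>m r) (actE M)" and ?B = "kb r n (actE (Vmod r a)) (actK M)"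
  let ?e = "kb r n (umat r (r - 1) 0) (piv r n h)" and ?k = "kap r (r - 1) (a + of_nat r - 1)"
  note car = Vmod_carriers M_carriers umat_carrier piv_carrier
  have BA: "?B * ?A = sc (qp r 2) * ?A * ?B"
    using car dims_pos by (simp add: mult_simps kb_mult kb_smult mult.assoc umodule_K_E(1)[OF M])
  have AB: "?A * ?B = sc (qp r (- 2)) * ?B * ?A"
    unfolding mult.assoc BA by (simp add: mult.assoc[symmetric] sc_mult[symmetric])
  have Ae: "?A * ?e = sc (qp r (- 2)) * ?e * ?A"
    using car dims_pos by (simp add: mult_simps kb_mult kb_smult mult.assoc piv_comm[OF r M])
  have "(\<Sum>j<r. WE ^ j * ?e * WE ^ (r - 1 - j)) = (\<Sum>j<r. ?B ^ j * ?e * ?B ^ (r - 1 - j))"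
    unfolding WE_split by (rule twisted_conj_sum[OF primitive_root_qp(2)[OF r] AB Ae])
  also have "\<dots> = (\<Sum>j<r. sc ?k * kb r n (umat r (r - 1 - j) (r - 1 - j)) (1\<^sub>m n))"
  proof (rule sum.cong)
    fix j assume j: "j \<in> {..<r}"
    have "?B ^ j * ?e * ?B ^ (r - 1 - j) =
      kb r n (actE (Vmod r a) ^\<^sub>m j * umat r (r - 1) 0 * actE (Vmod r a) ^\<^sub>m (r - 1 - j)) (actK M ^\<^sub>m j * piv r n h * actK M ^\<^sub>m (r - 1 - j))"
      using car dims_pos by (simp add: mult_simps kb_pow kb_mult)
    also have "actK M ^\<^sub>m j * piv r n h * actK M ^\<^sub>m (r - 1 - j) = 1\<^sub>m n"
    proof -
      have "qp r x ^ j * qp r (- x) ^ (r - 1) * qp r x ^ (r - 1 - j) = 1" for x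
      proof -
        have "qp r x ^ j * qp r (- x) ^ (r - 1) * qp r x ^ (r - 1 - j) = qp r (- x) ^ (r - 1) * qp r x ^ (j + (r - 1 - j))"
          by (simp add: power_add)
        also have "j + (r - 1 - j) = r - 1" using j by simp
        finally show ?thesis by (simp add: power_mult_distrib[symmetric])
      qed
      thus ?thesis unfolding M_facts(5) dgm_pow piv_def dgm_mult by (simp add: dgm_one)
    qed
    finally show "?B ^ j * ?e * ?B ^ (r - 1 - j) = sc ?k * kb r n (umat r (r - 1 - j) (r - 1 - j)) (1\<^sub>m n)"
      using j Vmod_conj[OF r, of j a] dims_pos by (simp add: kb_smult)
  qed simp
  also have "\<dots> = sc ?k * (\<Sum>j<r. kb r n (umat r (r - 1 - j) (r - 1 - j)) (1\<^sub>m n))"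
    by (simp add: sum_distrib_left)
  also have "(\<Sum>j<r. kb r n (umat r (r - 1 - j) (r - 1 - j)) (1\<^sub>m n)) = (\<Sum>j<r. kb r n (umat r j j) (1\<^sub>m n))"
    by (rule sum.reindex_bij_witness[of _ "\<lambda>j. r - 1 - j" "\<lambda>j. r - 1 - j"]) auto
  also have "\<dots> = kb r n (umat_sum r r) (1\<^sub>m n)"
  proof -
    have "(\<Sum>j<k. kb r n (umat r j j) (1\<^sub>m n)) = kb r n (umat_sum r k) (1\<^sub>m n)" for k
    proof (induction k)
      case 0
      have "umat_sum r 0 = 0\<^sub>m r r" by (rule eq_matI) (auto simp: umat_sum_def)
      then show ?case using dims_pos by (simp add: kb_zero(1)[OF dims_pos one_carrier_mat])
    next
      case (Suc k)
      have "umat_sum r (Suc k) = umat_sum r k + umat r k k"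
        by (rule eq_matI) (auto simp: umat_sum_def)
      then show ?case using dims_pos Suc.IH by (simp add: kb_add_left umat_sum_def)
    qed
    thus ?thesis .
  qed
  also have "umat_sum r r = 1\<^sub>m r" by (rule eq_matI) (auto simp: umat_sum_def)
  finally show ?thesis using dims_pos by (simp add: kb_one)
qed

lemma conj_sum:
  "(\<Sum>j<r. \<Sum>i<r. WE ^ (r - 1 - j) * WF ^ (r - 1 - i) * kb r n (umat r 0 0) (piv r n h) * WF ^ i * WE ^ j) =
    sc (kap r (r - 1) (a + of_nat r - 1))"
proof -
  let ?e = "kb r n (umat r 0 0) (piv r n h)"
  have flip: "(\<Sum>j<r. g j (r - 1 - j)) = (\<Sum>j<r. g (r - 1 - j) j)" for g :: "nat \<Rightarrow> nat \<Rightarrow> lop"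
    by (rule sum.reindex_bij_witness[of _ "\<lambda>j. r - 1 - j" "\<lambda>j. r - 1 - j"]) auto
  have "(\<Sum>j<r. \<Sum>i<r. WE ^ (r - 1 - j) * WF ^ (r - 1 - i) * ?e * WF ^ i * WE ^ j) =
     (\<Sum>j<r. WE ^ (r - 1 - j) * (\<Sum>i<r. WF ^ (r - 1 - i) * ?e * WF ^ i) * WE ^ j)"
    by (simp add: sum_distrib_left sum_distrib_right mult.assoc)
  also have "\<dots> = (\<Sum>j<r. WE ^ j * (\<Sum>i<r. WF ^ i * ?e * WF ^ (r - 1 - i)) * WE ^ (r - 1 - j))"
    by (simp only: flip[of "\<lambda>i j. WF ^ i * ?e * WF ^ j"] flip[of "\<lambda>i j. WE ^ i * X * WE ^ j" for X])
  finally show ?thesis by (simp only: F_conj_sum E_conj_sum)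
qed

text \<open>The difference of the operators |v_(i+1)><v_(i+1)| \<otimes> K^(1-r) and |v_i><v_i|
  \<otimes> K^(1-r) is the commutator of F with |v_i><v_(i+1)| \<otimes> K^(1-r), and the trace of
  such a commutator against an operator commuting with F vanishes. Thus the diagonal entries of the
  partial trace of f all agree.\<close>

lemma tr_umat_step:
  assumes f: "f \<in> bls (r * n)" "WF * f = f * WF" and i: "Suc i < r"
  shows "tr (r * n) (kb r n (umat r (Suc i) (Suc i)) (piv r n h) * f) = tr (r * n) (kb r n (umat r i i) (piv r n h) * f)"
proof -
  let ?A = "kb r n (actKi (Vmod r a)) (actF M)" and ?B = "kb r n (actF (Vmod r a)) (1\<^sub>m n)"
  let ?t = "kb r n (umat r i (Suc i)) (piv r n h)"
  note car = Vmod_carriers M_carriers umat_carrier piv_carrier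
  have "actF (Vmod r a) * umat r i (Suc i) = umat r (Suc i) (Suc i)"
    using i Vmod_carriers by (intro eq_matI) (auto simp: mult_umat_entry Vmod_entries)
  hence Bt: "?B * ?t = kb r n (umat r (Suc i) (Suc i)) (piv r n h)"
    using car dims_pos by (simp add: mult_simps kb_mult)
  have "umat r i (Suc i) * actF (Vmod r a) = umat r i i"
    using i Vmod_carriers by (intro eq_matI) (auto simp: umat_mult_entry Vmod_entries)
  hence tB: "?t * ?B = kb r n (umat r i i) (piv r n h)"
    using car dims_pos by (simp add: mult_simps kb_mult)
  \<comment> \<open>The eigenvalues of K^(-1) on v_i and v_(i+1) differ by q^2, which compensates
    the q^2 from moving F past the pivotal element.\<close>
  have "- wt r a (Suc i) = - wt r a i + 2" by (simp add: wt_def)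
  hence "qp r (- wt r a (Suc i)) = qp r (- wt r a i) * qp r 2" by (simp only: qp_add)
  hence At: "?A * ?t = ?t * ?A"
    using car dims_pos i by (simp add: mult_simps kb_mult Vmod_props(6) dgm_umat umat_dgm kb_smult piv_comm[OF r M] sc_mult mult.assoc)
      (rule sc_left_commute)
  have "kb r n (umat r (Suc i) (Suc i)) (piv r n h) = WF * ?t - ?t * WF + kb r n (umat r i i) (piv r n h)"
    unfolding WF_split by (simp add: distrib_left distrib_right At Bt tB)
  hence "kb r n (umat r (Suc i) (Suc i)) (piv r n h) * f = (WF * ?t - ?t * WF + kb r n (umat r i i) (piv r n h)) * f"
    by (rule arg_cong)
  also have "\<dots> = WF * ?t * f + sc (- 1) * (?t * WF * f) + kb r n (umat r i i) (piv r n h) * f"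
    by (simp add: left_diff_distrib distrib_right sc_minus)
  finally have "tr (r * n) (kb r n (umat r (Suc i) (Suc i)) (piv r n h) * f) =
     tr (r * n) (WF * ?t * f + sc (- 1) * (?t * WF * f)) + tr (r * n) (kb r n (umat r i i) (piv r n h) * f)"
    by (simp only: tr_add)
  also have "tr (r * n) (WF * ?t * f + sc (- 1) * (?t * WF * f)) =
     tr (r * n) (WF * (?t * f)) - tr (r * n) ((?t * f) * WF)"
    using f(2) by (simp add: tr_add tr_sc mult.assoc)
  also have "tr (r * n) (WF * (?t * f)) = tr (r * n) ((?t * f) * WF)"
  proof (intro tr_mult_commute bls_mult f(1))
    show "?t \<in> bls (r * n)" using dims_pos by (intro kb_bls) auto
    show "WF \<in> bls (r * n)" unfolding WF_split using dims_pos Vmod_carriers M_carriers by (intro bls_add kb_bls) auto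
  qed (use dims_pos in auto)
  finally show ?thesis by simp
qed

end

section \<open>Traces on spaces of homomorphisms\<close>

lemma smult_entry:
  "X \<in> carrier_mat m n \<Longrightarrow> i < m \<Longrightarrow> j < n \<Longrightarrow> (c \<cdot>\<^sub>m X) $$ (i, j) = c * X $$ (i, j)"
  by auto

lemma msum_carrier:
  assumes "\<And>i. i < k \<Longrightarrow> f i \<in> carrier_mat nr nc"
  shows "msum nr nc f k \<in> carrier_mat nr nc"
proof -
  have "foldr (\<lambda>i M. f i + M) xs (0\<^sub>m nr nc) \<in> carrier_mat nr nc" if "\<forall>i\<in>set xs. i < k" for xs
    using that assms by (induction xs) auto
  thus ?thesis by (simp add: msum_def)
qed

lemma msum_entry:
  assumes "\<And>i. i < k \<Longrightarrow> f i \<in> carrier_mat nr nc" "p < nr" "q < nc"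
  shows "msum nr nc f k $$ (p, q) = (\<Sum>i<k. f i $$ (p, q))"
proof -
  have "foldr (\<lambda>i M. f i + M) xs (0\<^sub>m nr nc) \<in> carrier_mat nr nc \<and>
     foldr (\<lambda>i M. f i + M) xs (0\<^sub>m nr nc) $$ (p, q) = (\<Sum>i\<leftarrow>xs. f i $$ (p, q))"
    if "\<forall>i\<in>set xs. i < k" for xs
    using that assms by (induction xs) auto
  from this[of "[0..<k]"] show ?thesis
    by (simp add: msum_def interv_sum_list_conv_sum_set_nat lessThan_atLeast0)
qed

lemma msum_eq_iff:
  assumes "\<And>i. i < k \<Longrightarrow> f i \<in> carrier_mat nr nc" "Y \<in> carrier_mat nr nc"
  shows "Y = msum nr nc f k \<longleftrightarrow> (\<forall>p<nr. \<forall>q<nc. Y $$ (p, q) = (\<Sum>i<k. f i $$ (p, q)))"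
proof
  assume "Y = msum nr nc f k"
  thus "\<forall>p<nr. \<forall>q<nc. Y $$ (p, q) = (\<Sum>i<k. f i $$ (p, q))"
    using msum_entry[OF assms(1)] by simp
next
  assume "\<forall>p<nr. \<forall>q<nc. Y $$ (p, q) = (\<Sum>i<k. f i $$ (p, q))"
  moreover have "msum nr nc f k \<in> carrier_mat nr nc" by (rule msum_carrier) (rule assms(1))
  ultimately show "Y = msum nr nc f k"
    using assms(2) by (intro eq_matI) (auto simp: msum_entry[OF assms(1)])
qed

text \<open>A minimal spanning subfamily is linearly independent.\<close>

lemma ex_basis_list:
  fixes J :: "'i \<Rightarrow> complex mat"
  assumes S: "S \<subseteq> carrier_mat nr nc" and J: "\<And>p. p \<in> I \<Longrightarrow> J p \<in> S" and I: "finite I"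
    and span: "\<And>Y. Y \<in> S \<Longrightarrow> \<exists>c. \<forall>i<nr. \<forall>j<nc. Y $$ (i, j) = (\<Sum>p\<in>I. c p * J p $$ (i, j))"
  shows "\<exists>Bs. is_basis_list S Bs nr nc"
proof -
  define spans where "spans A \<longleftrightarrow> A \<subseteq> I \<and> (\<forall>Y\<in>S. \<exists>c. \<forall>i<nr. \<forall>j<nc. Y $$ (i, j) = (\<Sum>p\<in>A. c p * J p $$ (i, j)))" for A
  have "spans I" using span by (auto simp: spans_def)
  then obtain A where A: "spans A" and min: "\<And>B. spans B \<Longrightarrow> card A \<le> card B"
    using ex_has_least_nat[of spans I card] by blast
  have fA: "finite A" and AI: "A \<subseteq> I" using A I finite_subset by (auto simp: spans_def)
  have indep: "c k = 0" if c: "\<forall>i<nr. \<forall>j<nc. (\<Sum>p\<in>A. c p * J p $$ (i, j)) = 0" and k: "k \<in> A" for c k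
  proof (rule ccontr)
    assume nz: "c k \<noteq> 0"
    have Jk: "J k $$ (i, j) = (\<Sum>p\<in>A - {k}. (- c p / c k) * J p $$ (i, j))" if "i < nr" "j < nc" for i j
    proof -
      have "c k * J k $$ (i, j) + (\<Sum>p\<in>A - {k}. c p * J p $$ (i, j)) = 0"
        using c that sum.remove[OF fA k, of "\<lambda>p. c p * J p $$ (i, j)"] by simp
      hence "J k $$ (i, j) = - (\<Sum>p\<in>A - {k}. c p * J p $$ (i, j)) / c k"
        using nz by (simp add: field_simps add_eq_0_iff)
      thus ?thesis by (simp add: sum_negf[symmetric] sum_divide_distrib)
    qed
    have "spans (A - {k})"
      unfolding spans_def
    proof (intro conjI ballI)
      show "A - {k} \<subseteq> I" using AI by auto
      fix Y assume "Y \<in> S"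
      then obtain d where d: "\<forall>i<nr. \<forall>j<nc. Y $$ (i, j) = (\<Sum>p\<in>A. d p * J p $$ (i, j))"
        using A unfolding spans_def by blast
      show "\<exists>c. \<forall>i<nr. \<forall>j<nc. Y $$ (i, j) = (\<Sum>p\<in>A - {k}. c p * J p $$ (i, j))"
      proof (intro exI[of _ "\<lambda>p. d p + d k * (- c p / c k)"] allI impI)
        fix i j assume ij: "i < nr" "j < nc"
        have "Y $$ (i, j) = d k * J k $$ (i, j) + (\<Sum>p\<in>A - {k}. d p * J p $$ (i, j))"
          using d ij fA k by (simp add: sum.remove)
        also have "d k * J k $$ (i, j) = (\<Sum>p\<in>A - {k}. (d k * (- c p / c k)) * J p $$ (i, j))"
          unfolding Jk[OF ij] by (simp add: sum_distrib_left mult.assoc)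
        finally show "Y $$ (i, j) = (\<Sum>p\<in>A - {k}. (d p + d k * (- c p / c k)) * J p $$ (i, j))"
          by (simp add: sum.distrib[symmetric] algebra_simps)
      qed
    qed
    from min[OF this] k fA show False by (metis card_Diff1_less not_le)
  qed
  obtain xs where xs: "set xs = A" "distinct xs" using finite_distinct_list[OF fA] by blast
  have bij: "bij_betw (\<lambda>i. xs ! i) {..<length xs} A"
    using bij_betw_nth[OF xs(2) refl xs(1)[symmetric]] .
  have inv: "inv_into {..<length xs} (\<lambda>i. xs ! i) (xs ! i) = i" if "i < length xs" for i
    using that by (intro inv_into_f_f bij_betw_imp_inj_on[OF bij]) auto
  have conv: "(\<Sum>i<length xs. c (xs ! i) * J (xs ! i) $$ (p, q)) = (\<Sum>k\<in>A. c k * J k $$ (p, q))" for c p q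
    by (rule sum.reindex_bij_betw[OF bij, of "\<lambda>k. c k * J k $$ (p, q)"])
  have conv': "(\<Sum>i<length xs. c i * J (xs ! i) $$ (p, q)) =
      (\<Sum>k\<in>A. c (inv_into {..<length xs} (\<lambda>i. xs ! i) k) * J k $$ (p, q))" for c p q
    unfolding conv[symmetric] by (intro sum.cong) (auto simp: inv)
  have carJ: "J (xs ! i) \<in> carrier_mat nr nc" if "i < length xs" for i
  proof -
    have "xs ! i \<in> I" using that xs(1) AI nth_mem[of i xs] by auto
    thus ?thesis using J S by auto
  qed
  have car: "c \<cdot>\<^sub>m map J xs ! i \<in> carrier_mat nr nc" if "i < length (map J xs)" for c i
    using that carJ by simp
  have "is_basis_list S (map J xs) nr nc"
    unfolding is_basis_list_def
  proof (intro conjI allI impI ballI)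
    show "set (map J xs) \<subseteq> S" using xs(1) AI J by auto
  next
    fix c i
    assume z: "msum nr nc (\<lambda>i. c i \<cdot>\<^sub>m map J xs ! i) (length (map J xs)) = 0\<^sub>m nr nc"
      and i: "i < length (map J xs)"
    have "(\<Sum>i<length xs. c i * J (xs ! i) $$ (p, q)) = 0" if "p < nr" "q < nc" for p q
      using msum_eq_iff[of "length (map J xs)" "\<lambda>i. c i \<cdot>\<^sub>m map J xs ! i" nr nc "0\<^sub>m nr nc", OF car] z that
      by (simp add: smult_entry[OF carJ])
    hence "c (inv_into {..<length xs} (\<lambda>i. xs ! i) (xs ! i)) = 0"
      using i xs(1) by (intro indep) (auto simp: conv'[symmetric])
    thus "c i = 0" using i inv by simp
  next
    fix Y assume Y: "Y \<in> S"
    then obtain d where d: "\<forall>i<nr. \<forall>j<nc. Y $$ (i, j) = (\<Sum>p\<in>A. d p * J p $$ (i, j))"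
      using A unfolding spans_def by blast
    show "\<exists>c. Y = msum nr nc (\<lambda>i. c i \<cdot>\<^sub>m map J xs ! i) (length (map J xs))"
      by (rule exI[of _ "\<lambda>i. d (xs ! i)"], subst msum_eq_iff)
        (use car Y S d in \<open>auto simp: smult_entry[OF carJ] conv\<close>)
  qed
  thus ?thesis by blast
qed

text \<open>The J p span S but are in general linearly dependent. By \<open>span\<close> the
  identity of S is the sum over p of the rank one maps Y \<mapsto> Y_(p,0) J p, so the trace of any
  endomorphism of S is the sum of the (p,0) entries of the images of the J p. This computes the
  trace in every basis at once, and so settles its independence of the basis.\<close>

lemma trace_on_eq:
  fixes J :: "nat \<Rightarrow> complex mat"
  assumes nc: "nc > 0" and S: "S \<subseteq> carrier_mat nr nc" and J: "\<And>p. p < nr \<Longrightarrow> J p \<in> S"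
    and span: "\<And>Y i j. Y \<in> S \<Longrightarrow> i < nr \<Longrightarrow> j < nc \<Longrightarrow> Y $$ (i, j) = (\<Sum>p<nr. Y $$ (p, 0) * J p $$ (i, j))"
    and A: "A \<in> carrier_mat nr nr" and AS: "\<And>Y. Y \<in> S \<Longrightarrow> A * Y \<in> S"
  shows "trace_on S nr nc (\<lambda>Y. A * Y) = (\<Sum>p<nr. (A * J p) $$ (p, 0))"
proof -
  let ?T = "\<lambda>Bs c. is_basis_list S Bs nr nc \<and>
      (\<forall>j<length Bs. A * Bs ! j = msum nr nc (\<lambda>i. c i j \<cdot>\<^sub>m Bs ! i) (length Bs))"
  have uniq: "(\<Sum>i<length Bs. c i i) = (\<Sum>p<nr. (A * J p) $$ (p, 0))" if T: "?T Bs c" for Bs c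
  proof -
    let ?l = "length Bs"
    have BS: "Bs ! i \<in> S" if "i < ?l" for i using T that by (auto simp: is_basis_list_def)
    have Bc: "Bs ! i \<in> carrier_mat nr nc" if "i < ?l" for i using BS[OF that] S by auto
    have car: "d i \<cdot>\<^sub>m Bs ! i \<in> carrier_mat nr nc" if "i < ?l" for d i using Bc[OF that] by simp
    have ent: "(d i \<cdot>\<^sub>m Bs ! i) $$ (p, q) = d i * Bs ! i $$ (p, q)" if "i < ?l" "p < nr" "q < nc" for d i p q
      using that Bc[of i] by auto
    have ms: "Y = msum nr nc (\<lambda>i. d i \<cdot>\<^sub>m Bs ! i) ?l \<longleftrightarrow>
        (\<forall>p<nr. \<forall>q<nc. Y $$ (p, q) = (\<Sum>i<?l. d i * Bs ! i $$ (p, q)))" if "Y \<in> carrier_mat nr nc" for Y d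
      by (subst msum_eq_iff[OF car that]) (auto simp: ent)
    have "\<forall>p. \<exists>d. p < nr \<longrightarrow> J p = msum nr nc (\<lambda>i. d i \<cdot>\<^sub>m Bs ! i) ?l"
      using T J unfolding is_basis_list_def by blast
    from choice[OF this] obtain L where "\<And>p. p < nr \<Longrightarrow> J p = msum nr nc (\<lambda>i. L p i \<cdot>\<^sub>m Bs ! i) ?l" by blast
    hence L: "J p $$ (i, j) = (\<Sum>k<?l. L p k * Bs ! k $$ (i, j))" if "p < nr" "i < nr" "j < nc" for p i j
      using ms[of "J p" "L p"] J[of p] S that by (auto simp: subset_iff)
    \<comment> \<open>Expanding a basis element by \<open>span\<close>, and then each J p by L,
      writes it as a combination of the basis; independence forces the coefficients to be a
      Kronecker delta.\<close>
    have delta: "(\<Sum>p<nr. Bs ! l $$ (p, 0) * L p i) = (if i = l then 1 else 0)" if l: "l < ?l" and i: "i < ?l" for l i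
    proof -
      let ?d = "\<lambda>i. (\<Sum>p<nr. Bs ! l $$ (p, 0) * L p i) - (if i = l then 1 else 0)"
      have "(\<Sum>k<?l. ?d k * Bs ! k $$ (p', q)) = 0" if pq: "p' < nr" "q < nc" for p' q
      proof -
        have "Bs ! l $$ (p', q) = (\<Sum>p<nr. Bs ! l $$ (p, 0) * (\<Sum>k<?l. L p k * Bs ! k $$ (p', q)))"
          using span[OF BS[OF l] pq] L pq by simp
        also have "\<dots> = (\<Sum>k<?l. (\<Sum>p<nr. Bs ! l $$ (p, 0) * L p k) * Bs ! k $$ (p', q))"
          unfolding sum_distrib_left sum_distrib_right by (subst sum.swap) (simp add: mult.assoc)
        finally have "(\<Sum>k<?l. (\<Sum>p<nr. Bs ! l $$ (p, 0) * L p k) * Bs ! k $$ (p', q)) = Bs ! l $$ (p', q)" ..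
        moreover have "(\<Sum>k<?l. (if k = l then 1 else 0) * Bs ! k $$ (p', q)) = Bs ! l $$ (p', q)"
        proof -
          have "(\<Sum>k<?l. (if k = l then 1 else 0) * Bs ! k $$ (p', q)) = (\<Sum>k<?l. if k = l then Bs ! k $$ (p', q) else 0)"
            by (rule sum.cong) auto
          thus ?thesis using l by simp
        qed
        ultimately show ?thesis by (simp add: left_diff_distrib sum_subtractf)
      qed
      hence "0\<^sub>m nr nc = msum nr nc (\<lambda>i. ?d i \<cdot>\<^sub>m Bs ! i) ?l"
        by (subst ms) auto
      moreover have "\<forall>c. msum nr nc (\<lambda>i. c i \<cdot>\<^sub>m Bs ! i) ?l = 0\<^sub>m nr nc \<longrightarrow> (\<forall>i<?l. c i = 0)"
        using T unfolding is_basis_list_def by (elim conjE)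
      ultimately have "?d i = 0" using i by (elim allE[of _ ?d]) simp
      thus ?thesis by simp
    qed
    have c: "(\<Sum>q<nr. A $$ (p, q) * Bs ! i $$ (q, 0)) = (\<Sum>l<?l. c l i * Bs ! l $$ (p, 0))" if "i < ?l" "p < nr" for i p
    proof -
      have "A * Bs ! i \<in> carrier_mat nr nc" using A Bc[OF that(1)] by simp
      hence "(A * Bs ! i) $$ (p, 0) = (\<Sum>l<?l. c l i * Bs ! l $$ (p, 0))"
        using ms[of "A * Bs ! i" "\<lambda>l. c l i"] T that nc by blast
      thus ?thesis using A Bc[OF that(1)] that nc by (simp add: mult_entry[of _ nr nr _ nc])
    qed
    have "(\<Sum>p<nr. (A * J p) $$ (p, 0)) = (\<Sum>p<nr. \<Sum>q<nr. A $$ (p, q) * (\<Sum>i<?l. L p i * Bs ! i $$ (q, 0)))"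
    proof (rule sum.cong)
      fix p assume p: "p \<in> {..<nr}"
      hence "J p \<in> carrier_mat nr nc" using J S by auto
      thus "(A * J p) $$ (p, 0) = (\<Sum>q<nr. A $$ (p, q) * (\<Sum>i<?l. L p i * Bs ! i $$ (q, 0)))"
        using p A nc L by (simp add: mult_entry[of _ nr nr _ nc])
    qed simp
    also have "\<dots> = (\<Sum>p<nr. \<Sum>i<?l. L p i * (\<Sum>q<nr. A $$ (p, q) * Bs ! i $$ (q, 0)))"
      unfolding sum_distrib_left by (rule sum.cong[OF refl], subst sum.swap) (simp add: mult_ac)
    also have "\<dots> = (\<Sum>p<nr. \<Sum>i<?l. L p i * (\<Sum>l<?l. c l i * Bs ! l $$ (p, 0)))"
      using c by simp
    also have "\<dots> = (\<Sum>i<?l. \<Sum>l<?l. c l i * (\<Sum>p<nr. Bs ! l $$ (p, 0) * L p i))"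
      unfolding sum_distrib_left
      by (subst sum.swap, rule sum.cong[OF refl], subst sum.swap) (simp add: mult_ac)
    also have "\<dots> = (\<Sum>i<?l. \<Sum>l<?l. if l = i then c l i else 0)"
      using delta by (intro sum.cong) auto
    also have "\<dots> = (\<Sum>i<?l. c i i)" by simp
    finally show ?thesis ..
  qed
  \<comment> \<open>A basis must exist for the choice in \<open>trace_on\<close> to have a candidate
    at all.\<close>
  have "\<exists>Bs. is_basis_list S Bs nr nc"
  proof (rule ex_basis_list[OF S, of "{..<nr}" J])
    fix Y assume "Y \<in> S"
    thus "\<exists>c. \<forall>i<nr. \<forall>j<nc. Y $$ (i, j) = (\<Sum>p<nr. c p * J p $$ (i, j))"
      using span by (intro exI[of _ "\<lambda>p. Y $$ (p, 0)"]) auto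
  qed (use J in auto)
  then obtain Bs where Bs: "is_basis_list S Bs nr nc" by blast
  have "\<forall>j. \<exists>d. j < length Bs \<longrightarrow> A * Bs ! j = msum nr nc (\<lambda>i. d i \<cdot>\<^sub>m Bs ! i) (length Bs)"
  proof (intro allI)
    fix j
    show "\<exists>d. j < length Bs \<longrightarrow> A * Bs ! j = msum nr nc (\<lambda>i. d i \<cdot>\<^sub>m Bs ! i) (length Bs)"
    proof (cases "j < length Bs")
      case True
      hence "A * Bs ! j \<in> S" using Bs by (intro AS) (auto simp: is_basis_list_def)
      thus ?thesis using Bs unfolding is_basis_list_def by blast
    qed simp
  qed
  from choice[OF this] obtain d where
    "\<forall>j<length Bs. A * Bs ! j = msum nr nc (\<lambda>i. d j i \<cdot>\<^sub>m Bs ! i) (length Bs)" by blast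
  hence T: "?T Bs (\<lambda>i j. d j i)" using Bs by simp
  show ?thesis unfolding trace_on_def
  proof (rule some_equality)
    show "\<exists>Bs c. is_basis_list S Bs nr nc \<and>
      (\<forall>j<length Bs. A * Bs ! j = msum nr nc (\<lambda>i. c i j \<cdot>\<^sub>m Bs ! i) (length Bs)) \<and>
      (\<Sum>p<nr. (A * J p) $$ (p, 0)) = (\<Sum>i<length Bs. c i i)"
      using T uniq[OF T] by (intro exI[of _ Bs] exI[of _ "\<lambda>i j. d j i"]) auto
  next
    fix t assume "\<exists>Bs c. is_basis_list S Bs nr nc \<and>
      (\<forall>j<length Bs. A * Bs ! j = msum nr nc (\<lambda>i. c i j \<cdot>\<^sub>m Bs ! i) (length Bs)) \<and>
      t = (\<Sum>i<length Bs. c i i)"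
    thus "t = (\<Sum>p<nr. (A * J p) $$ (p, 0))" using uniq by blast
  qed
qed

section \<open>Homomorphisms out of a highest weight module\<close>

lemma mult_Vmod_col:
  assumes "Y \<in> carrier_mat n r" "i < n" "j < r"
  shows "(Y * actE (Vmod r g)) $$ (i, j) =
      (if j = 0 then 0 else qint r (of_nat j) * qint r (g + of_nat r - of_nat j) * Y $$ (i, j - 1))"
    and "(Y * actF (Vmod r g)) $$ (i, j) = (if Suc j < r then Y $$ (i, Suc j) else 0)"
proof -
  let ?e = "qint r (of_nat j) * qint r (g + of_nat r - of_nat j)"
  have c: "actE (Vmod r g) \<in> carrier_mat r r" "actF (Vmod r g) \<in> carrier_mat r r"
    by (simp_all add: Vmod_def)
  have "(\<Sum>l<r. Y $$ (i, l) * actE (Vmod r g) $$ (l, j)) =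
      (\<Sum>l<r. if l = j - 1 then (if j = 0 then 0 else ?e * Y $$ (i, j - 1)) else 0)"
    using assms by (intro sum.cong) (auto simp: Vmod_def)
  thus "(Y * actE (Vmod r g)) $$ (i, j) = (if j = 0 then 0 else ?e * Y $$ (i, j - 1))"
    using assms c by (simp add: mult_entry[of _ n r _ r])
  have "(\<Sum>l<r. Y $$ (i, l) * actF (Vmod r g) $$ (l, j)) = (\<Sum>l<r. if l = Suc j then Y $$ (i, Suc j) else 0)"
    using assms by (intro sum.cong) (auto simp: Vmod_def)
  thus "(Y * actF (Vmod r g)) $$ (i, j) = (if Suc j < r then Y $$ (i, Suc j) else 0)"
    using assms c by (simp add: mult_entry[of _ n r _ r])
qed

lemma Vmod_diag:
  "actH (Vmod r g) = dgm r (wt r g)" "actK (Vmod r g) = dgm r (\<lambda>i. qp r (wt r g i))"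
  by (simp_all add: Vmod_def dgm_def)

context
  fixes r n :: nat and h :: "nat \<Rightarrow> complex" and M :: umod and g :: complex
  assumes r: "r \<ge> 2" and M: "umodule r n h M" and L: "\<And>i. i < n \<Longrightarrow> h i \<notin> \<int>"
begin

interpretation wmod r "bl n (actE M)" "bl n (actF M)" "dgl n h" "h ` {..<n}"
  by (rule umodule_wmod[OF r M])

lemmas M_props = umoduleD[OF M]

definition hw_proj :: "complex mat" where
  "hw_proj = actE M ^\<^sub>m (r - 1) * actF M ^\<^sub>m (r - 1) * dgm n (\<lambda>i. inverse (kap r (r - 1) (h i))) *
     dgm n (\<lambda>i. if h i = g + of_nat r - 1 then 1 else 0)"

lemma hw_proj_carrier: "hw_proj \<in> carrier_mat n n"
  unfolding hw_proj_def using M_props by (intro mult_carrier_mat[of _ n n _ n]) auto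

lemma bl_hw_proj: "bl n hw_proj = prj * dgl n h (\<lambda>x. if x = g + of_nat r - 1 then 1 else 0)"
  unfolding hw_proj_def prj_def dgl_def using M_props
  by (simp add: bl_mult bl_pow mult_carrier_mat[of _ n n _ n])

text \<open>A homomorphism from V_g is determined by the image of v_0, since v_j = F^j v_0. This is
  the homomorphism for which that image is the p-th column of \<open>hw_proj\<close>.\<close>

definition hom_col :: "nat \<Rightarrow> complex mat" where
  "hom_col p = mat n r (\<lambda>(i, j). (actF M ^\<^sub>m j * hw_proj) $$ (i, p))"

lemma F_hw_proj_carrier: "actF M ^\<^sub>m j * hw_proj \<in> carrier_mat n n"
  using M_props(3) hw_proj_carrier by (intro mult_carrier_mat[of _ n n _ n]) auto

lemma dg_hw_proj: "dgm n (\<lambda>i. c (h i)) * (actF M ^\<^sub>m j * hw_proj) = c (g + of_nat r - 1 - 2 * of_nat j) \<cdot>\<^sub>m (actF M ^\<^sub>m j * hw_proj)"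
proof (rule bl_inj[of n])
  let ?x = "g + of_nat r - 1"
  have "dgl n h c * (bl n (actF M) ^ j * bl n hw_proj) = bl n (actF M) ^ j *
      ((dgl n h (\<lambda>x. c (x - 2 * of_nat j)) * prj) * dgl n h (\<lambda>x. if x = ?x then 1 else 0))"
    unfolding bl_hw_proj by (simp only: mult.assoc[symmetric] dg_Fpow)
  also have "\<dots> =
     bl n (actF M) ^ j * (prj * (dgl n h (\<lambda>x. c (x - 2 * of_nat j)) * dgl n h (\<lambda>x. if x = ?x then 1 else 0)))"
    by (simp only: dg_prj mult.assoc)
  also have "dgl n h (\<lambda>x. c (x - 2 * of_nat j)) * dgl n h (\<lambda>x. if x = ?x then 1 else 0) =
      sc (c (?x - 2 * of_nat j)) * dgl n h (\<lambda>x. if x = ?x then 1 else 0)"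
    unfolding dg_const[symmetric] dg_mult by (rule dg_cong) simp
  also have "bl n (actF M) ^ j * (prj * (sc (c (?x - 2 * of_nat j)) * dgl n h (\<lambda>x. if x = ?x then 1 else 0))) =
      sc (c (?x - 2 * of_nat j)) * (bl n (actF M) ^ j * bl n hw_proj)"
    by (simp add: bl_hw_proj sc_left_commute[of prj] sc_left_commute[of "bl n (actF M) ^ j"])
  finally show "bl n (dgm n (\<lambda>i. c (h i)) * (actF M ^\<^sub>m j * hw_proj)) =
     bl n (c (?x - 2 * of_nat j) \<cdot>\<^sub>m (actF M ^\<^sub>m j * hw_proj))"
    using M_props(1,3) hw_proj_carrier F_hw_proj_carrier[of j]
    by (simp add: bl_mult bl_smult bl_pow dgl_def)
qed (use F_hw_proj_carrier[of j] in \<open>auto intro!: mult_carrier_mat[of _ n n _ n]\<close>)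

lemma E_hw_proj: "actE M * (actF M ^\<^sub>m j * hw_proj) = (if j = 0 then 0\<^sub>m n n else
    (qint r (of_nat j) * qint r (g + of_nat r - of_nat j)) \<cdot>\<^sub>m (actF M ^\<^sub>m (j - 1) * hw_proj))"
proof (rule bl_inj[of n])
  let ?x = "g + of_nat r - 1"
  have E_hw_proj0: "bl n (actE M) * bl n hw_proj = 0"
    unfolding bl_hw_proj by (simp add: mult.assoc[symmetric] E_prj)
  have "bl n (actE M) * (bl n (actF M) ^ j * bl n hw_proj) = (if j = 0 then 0 else
    sc (qint r (of_nat j) * qint r (g + of_nat r - of_nat j)) * (bl n (actF M) ^ (j - 1) * bl n hw_proj))"
  proof (cases j)
    case 0
    then show ?thesis using E_hw_proj0 by simp
  next
    case (Suc k)
    have "dgl n h (\<lambda>x. qint r (of_nat (Suc k)) * qint r (x - of_nat k)) * bl n hw_proj =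
      sc (qint r (of_nat (Suc k)) * qint r (?x - of_nat k)) * bl n hw_proj"
      using dg_hw_proj[of "\<lambda>x. qint r (of_nat (Suc k)) * qint r (x - of_nat k)" 0] M_props(1,3) hw_proj_carrier
      by (simp add: dgl_def bl_mult[symmetric] bl_smult[symmetric] del: of_nat_Suc)
    thus ?thesis using EF_hw[OF E_hw_proj0, of k] Suc
      by (simp add: sc_left_commute[of "bl n (actF M) ^ k"] algebra_simps)
  qed
  thus "bl n (actE M * (actF M ^\<^sub>m j * hw_proj)) = bl n (if j = 0 then 0\<^sub>m n n else
    (qint r (of_nat j) * qint r (g + of_nat r - of_nat j)) \<cdot>\<^sub>m (actF M ^\<^sub>m (j - 1) * hw_proj))"
    using M_props(1,2,3) hw_proj_carrier F_hw_proj_carrier by (simp add: bl_mult bl_smult bl_pow bl_zero)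
qed (use M_props(2) F_hw_proj_carrier in \<open>auto intro!: mult_carrier_mat[of _ n n _ n]\<close>)

lemma F_pow_mult:
  assumes X: "X \<in> carrier_mat n n"
  shows "actF M * (actF M ^\<^sub>m j * X) = actF M ^\<^sub>m Suc j * X"
proof (rule bl_inj[of n])
  show "bl n (actF M * (actF M ^\<^sub>m j * X)) = bl n (actF M ^\<^sub>m Suc j * X)"
    using M_props(1,3) X by (simp add: bl_mult bl_pow mult_carrier_mat[of _ n n _ n] mult.assoc del: pow_mat.simps)
qed (use M_props(3) X in \<open>auto intro!: mult_carrier_mat[of _ n n _ n] pow_carrier_mat simp del: pow_mat.simps\<close>)

lemmas F_hw_proj = F_pow_mult[OF hw_proj_carrier]

lemma F_hw_proj_r: "actF M ^\<^sub>m r * hw_proj = 0\<^sub>m n n"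
  using M_props(11) hw_proj_carrier by simp

lemma mult_hom_col:
  assumes "X \<in> carrier_mat n n" "i < n" "j < r" "p < n"
  shows "(X * hom_col p) $$ (i, j) = (X * (actF M ^\<^sub>m j * hw_proj)) $$ (i, p)"
proof -
  have "hom_col p \<in> carrier_mat n r" by (simp add: hom_col_def)
  thus ?thesis using assms F_hw_proj_carrier[of j] by (simp add: mult_entry[of _ n n _ r] mult_entry[of _ n n _ n] hom_col_def)
qed

lemma hom_col_HomC:
  assumes p: "p < n"
  shows "hom_col p \<in> HomC r g M"
proof -
  have c: "hom_col p \<in> carrier_mat n r" by (simp add: hom_col_def)
  have V: "actE (Vmod r g) \<in> carrier_mat r r" "actF (Vmod r g) \<in> carrier_mat r r"
    by (simp_all add: Vmod_def)
  have E: "hom_col p * actE (Vmod r g) = actE M * hom_col p"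
  proof (rule eq_matI)
    fix i j assume "i < dim_row (actE M * hom_col p)" "j < dim_col (actE M * hom_col p)"
    hence ij: "i < n" "j < r" using M_props c by auto
    have "(actE M * hom_col p) $$ (i, j) = (actE M * (actF M ^\<^sub>m j * hw_proj)) $$ (i, p)"
      using mult_hom_col[OF M_props(2) ij p] .
    also have "\<dots> = (hom_col p * actE (Vmod r g)) $$ (i, j)"
      unfolding E_hw_proj mult_Vmod_col(1)[OF c ij] using ij p by (auto simp: hom_col_def smult_entry[OF F_hw_proj_carrier])
    finally show "(hom_col p * actE (Vmod r g)) $$ (i, j) = (actE M * hom_col p) $$ (i, j)" ..
  qed (use c V M_props in auto)
  have F: "hom_col p * actF (Vmod r g) = actF M * hom_col p"
  proof (rule eq_matI)
    fix i j assume "i < dim_row (actF M * hom_col p)" "j < dim_col (actF M * hom_col p)"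
    hence ij: "i < n" "j < r" using M_props c by auto
    have "(actF M * hom_col p) $$ (i, j) = (actF M ^\<^sub>m Suc j * hw_proj) $$ (i, p)"
      using mult_hom_col[OF M_props(3) ij p] F_hw_proj[of j] by simp
    also have "\<dots> = (hom_col p * actF (Vmod r g)) $$ (i, j)"
    proof (cases "Suc j < r")
      case True
      then show ?thesis unfolding mult_Vmod_col(2)[OF c ij] using ij p by (simp add: hom_col_def del: pow_mat.simps)
    next
      \<comment> \<open>The last column: F v_(r-1) = 0 on the source, which matches F^r = 0 on the
        target.\<close>
      case False
      hence "Suc j = r" using ij by simp
      then show ?thesis unfolding mult_Vmod_col(2)[OF c ij] using ij p F_hw_proj_r by (simp del: pow_mat.simps)
    qed
    finally show "(hom_col p * actF (Vmod r g)) $$ (i, j) = (actF M * hom_col p) $$ (i, j)" ..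
  qed (use c V M_props in auto)
  have dg: "hom_col p * dgm r (\<lambda>i. d (wt r g i)) = dgm n (\<lambda>i. d (h i)) * hom_col p" for d
  proof (rule eq_matI)
    fix i j assume "i < dim_row (dgm n (\<lambda>i. d (h i)) * hom_col p)" "j < dim_col (dgm n (\<lambda>i. d (h i)) * hom_col p)"
    hence ij: "i < n" "j < r" using c by auto
    have "(dgm n (\<lambda>i. d (h i)) * hom_col p) $$ (i, j) = d (wt r g j) * (actF M ^\<^sub>m j * hw_proj) $$ (i, p)"
      using mult_hom_col[OF dgm_carrier ij p] dg_hw_proj[of d j] ij p by (simp add: wt_def smult_entry[OF F_hw_proj_carrier])
    thus "(hom_col p * dgm r (\<lambda>i. d (wt r g i))) $$ (i, j) = (dgm n (\<lambda>i. d (h i)) * hom_col p) $$ (i, j)"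
      using ij by (simp add: mult_dgm_entry[OF c ij]) (simp add: hom_col_def)
  qed (use c in auto)
  show ?thesis unfolding HomC_def
    using c M_props E F dg[of "\<lambda>x. x"] dg[of "qp r"] by (simp add: Vmod_diag)
qed

text \<open>The first column of Y is a highest weight vector of weight g + r - 1, hence fixed by
  \<open>hw_proj\<close> and a combination of its columns, with its own entries as coefficients.
  Applying F^j extends this to the column j.\<close>

lemma HomC_expand:
  assumes Y: "Y \<in> HomC r g M" and ij: "i < n" "j < r"
  shows "Y $$ (i, j) = (\<Sum>p<n. Y $$ (p, 0) * hom_col p $$ (i, j))"
proof -
  have c: "Y \<in> carrier_mat n r" and E: "Y * actE (Vmod r g) = actE M * Y"
    and F: "Y * actF (Vmod r g) = actF M * Y" and H: "Y * actH (Vmod r g) = actH M * Y"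
    using Y M_props by (auto simp: HomC_def)
  \<comment> \<open>The first column of Y, repeated to fill a square matrix, so that the statements
    about operators apply to a vector.\<close>
  define X where "X = mat n n (\<lambda>(i, j). Y $$ (i, 0))"
  have X: "X \<in> carrier_mat n n" by (simp add: X_def)
  have mX: "(Z * X) $$ (i, j) = (Z * Y) $$ (i, 0)" if "Z \<in> carrier_mat n n" "i < n" "j < n" for Z i j
    using that X c r by (simp add: mult_entry[of _ n n _ n] mult_entry[of _ n n _ r] X_def)
  have "actE M * X = 0\<^sub>m n n"
  proof (rule eq_matI)
    fix i j assume "i < dim_row (0\<^sub>m n n :: complex mat)" "j < dim_col (0\<^sub>m n n :: complex mat)"
    thus "(actE M * X) $$ (i, j) = 0\<^sub>m n n $$ (i, j)"
      using mX[OF M_props(2), of i j] mult_Vmod_col(1)[OF c, of i 0 g] r E by simp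
  qed (use M_props X in auto)
  hence EX: "bl n (actE M) * bl n X = 0"
    using M_props(1,2) X by (simp add: bl_mult[symmetric] bl_zero)
  have "dgm n (\<lambda>i. if h i = g + of_nat r - 1 then 1 else 0) * X = X"
  proof (rule eq_matI)
    fix i j assume "i < dim_row X" "j < dim_col X"
    hence ij: "i < n" "j < n" using X by auto
    have "(Y * actH (Vmod r g)) $$ (i, 0) = Y $$ (i, 0) * wt r g 0"
      unfolding Vmod_diag using r ij by (simp add: mult_dgm_entry[OF c])
    moreover have "(actH M * Y) $$ (i, 0) = h i * Y $$ (i, 0)"
      unfolding M_props(4) using r ij by (simp add: dgm_mult_entry[OF c])
    ultimately have "Y $$ (i, 0) * (h i - (g + of_nat r - 1)) = 0"
      using H by (simp add: wt_def algebra_simps)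
    thus "(dgm n (\<lambda>i. if h i = g + of_nat r - 1 then 1 else 0) * X) $$ (i, j) = X $$ (i, j)"
      using ij by (simp add: dgm_mult_entry[OF X ij]) (auto simp: X_def)
  qed (use X in auto)
  hence dX: "dgl n h (\<lambda>x. if x = g + of_nat r - 1 then 1 else 0) * bl n X = bl n X"
    using M_props(1) X by (simp add: dgl_def bl_mult[symmetric])
  have "bl n hw_proj * bl n X = bl n X"
    unfolding bl_hw_proj using EX dX L by (simp add: mult.assoc) (rule prj_hw, auto)
  hence hw_proj_X: "hw_proj * X = X" using M_props(1) X hw_proj_carrier by (intro bl_inj[of n]) (auto simp: bl_mult)
  have col: "Y $$ (i, j) = (actF M ^\<^sub>m j * X) $$ (i, 0)" if "i < n" "j < r" for i j
    using that
  proof (induction j arbitrary: i)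
    case 0
    then show ?case using X M_props(3) by (simp add: X_def)
  next
    case (Suc j)
    have cF: "actF M ^\<^sub>m j * X \<in> carrier_mat n n" using M_props(3) X by (intro mult_carrier_mat[of _ n n _ n]) auto
    have "Y $$ (i, Suc j) = (actF M * Y) $$ (i, j)"
      using mult_Vmod_col(2)[OF c, of i j g] Suc.prems F by simp
    also have "\<dots> = (actF M * (actF M ^\<^sub>m j * X)) $$ (i, 0)"
      using Suc M_props(1,3) c cF by (simp add: mult_entry[of _ n n _ r] mult_entry[of _ n n _ n])
    also have "actF M * (actF M ^\<^sub>m j * X) = actF M ^\<^sub>m Suc j * X" by (rule F_pow_mult[OF X])
    finally show ?case .
  qed
  have "Y $$ (i, j) = (actF M ^\<^sub>m j * (hw_proj * X)) $$ (i, 0)" using col[OF ij] hw_proj_X by simp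
  also have "actF M ^\<^sub>m j * (hw_proj * X) = (actF M ^\<^sub>m j * hw_proj) * X"
    using M_props(3) hw_proj_carrier X by (intro assoc_mult_mat[symmetric, of _ n n _ n _ n]) auto
  also have "\<dots> $$ (i, 0) = (\<Sum>p<n. (actF M ^\<^sub>m j * hw_proj) $$ (i, p) * X $$ (p, 0))"
    using ij M_props(1) F_hw_proj_carrier[of j] X by (intro mult_entry) auto
  finally show ?thesis using ij M_props(1) by (simp add: X_def hom_col_def mult.commute)
qed

text \<open>The maps \<open>hom_col p\<close> form a spanning family as in
  \<open>trace_on_eq\<close>. Their first columns make up \<open>hw_proj\<close>, so the (p,0) entry
  of the image of \<open>hom_col p\<close> is the p-th diagonal entry of f times
  \<open>hw_proj\<close>.\<close>

lemma trace_HomC: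
  assumes f: "f \<in> carrier_mat n n" "f * actE M = actE M * f" "f * actF M = actF M * f"
    "f * actH M = actH M * f" "f * actK M = actK M * f"
  shows "trace_on (HomC r g M) n r (\<lambda>Y. f * Y) =
    tr n (bl n f * (prj * dgl n h (\<lambda>x. if x = g + of_nat r - 1 then 1 else 0)))"
proof -
  have "trace_on (HomC r g M) n r (\<lambda>Y. f * Y) = (\<Sum>p<n. (f * hom_col p) $$ (p, 0))"
  proof (rule trace_on_eq)
    show "HomC r g M \<subseteq> carrier_mat n r" using M_props by (auto simp: HomC_def)
    show "r > 0" using r by simp
    show "f \<in> carrier_mat n n" by (rule f(1))
    show "hom_col p \<in> HomC r g M" if "p < n" for p using that by (rule hom_col_HomC)
    show "Y $$ (i, j) = (\<Sum>p<n. Y $$ (p, 0) * hom_col p $$ (i, j))"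
      if "Y \<in> HomC r g M" "i < n" "j < r" for Y i j
      using that by (rule HomC_expand)
    fix Y assume Y: "Y \<in> HomC r g M"
    have c: "Y \<in> carrier_mat n r" using Y M_props by (auto simp: HomC_def)
    have comm: "(f * Y) * X' = X * (f * Y)"
      if "X \<in> carrier_mat n n" "X' \<in> carrier_mat r r" "f * X = X * f" "Y * X' = X * Y" for X X'
    proof -
      have "(f * Y) * X' = f * (Y * X')" using f(1) c that by (intro assoc_mult_mat) auto
      also have "\<dots> = f * (X * Y)" by (simp only: that(4))
      also have "\<dots> = (f * X) * Y" using f(1) c that by (intro assoc_mult_mat[symmetric]) auto
      also have "\<dots> = X * (f * Y)" unfolding that(3) using f(1) c that by (intro assoc_mult_mat) auto
      finally show ?thesis .
    qed
    have cM: "actH M \<in> carrier_mat n n" "actK M \<in> carrier_mat n n" using M_props by auto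
    have cV: "actE (Vmod r g) \<in> carrier_mat r r" "actF (Vmod r g) \<in> carrier_mat r r"
      "actH (Vmod r g) \<in> carrier_mat r r" "actK (Vmod r g) \<in> carrier_mat r r" by (simp_all add: Vmod_def)
    have "(f * Y) * actE (Vmod r g) = actE M * (f * Y)" "(f * Y) * actF (Vmod r g) = actF M * (f * Y)"
      "(f * Y) * actH (Vmod r g) = actH M * (f * Y)" "(f * Y) * actK (Vmod r g) = actK M * (f * Y)"
      using comm[OF M_props(2) cV(1) f(2)] comm[OF M_props(3) cV(2) f(3)] comm[OF cM(1) cV(3) f(4)]
        comm[OF cM(2) cV(4) f(5)] Y by (auto simp: HomC_def)
    thus "f * Y \<in> HomC r g M"
      using f(1) M_props(12) c by (simp add: HomC_def)
  qed
  also have "\<dots> = (\<Sum>p<n. (f * hw_proj) $$ (p, p))"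
    using mult_hom_col[OF f(1), of _ 0] r M_props(3) hw_proj_carrier by (intro sum.cong) auto
  also have "\<dots> = tr n (bl n f * bl n hw_proj)"
    using M_props(1) f(1) hw_proj_carrier by (simp add: bl_mult[symmetric] tr_bl)
  finally show ?thesis by (simp add: bl_hw_proj)
qed

end

section \<open>Intertwining operators\<close>

definition intertwines :: "nat \<Rightarrow> umod \<Rightarrow> complex mat \<Rightarrow> bool" where
  "intertwines n M f \<longleftrightarrow> f \<in> carrier_mat n n \<and>
     (\<forall>X\<in>{actE M, actF M, actH M, actK M, actKi M}. X \<in> carrier_mat n n \<and> f * X = X * f)"

lemma intertwines_one:
  assumes "umodule r n h M" shows "intertwines n M (1\<^sub>m n)"
  using umoduleD[OF assms] by (auto simp: intertwines_def)

lemma intertwines_mult: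
  assumes "intertwines n M f" "intertwines n M g"
  shows "intertwines n M (f * g)"
proof -
  have c: "f \<in> carrier_mat n n" "g \<in> carrier_mat n n" using assms by (auto simp: intertwines_def)
  have "f * g * X = X * (f * g)" if "X \<in> carrier_mat n n" "f * X = X * f" "g * X = X * g" for X
  proof -
    have "f * g * X = f * (g * X)" using c that(1) by (intro assoc_mult_mat) auto
    also have "\<dots> = (f * X) * g" unfolding that(3) using c that(1) by (intro assoc_mult_mat[symmetric]) auto
    also have "\<dots> = X * (f * g)" unfolding that(2) using c that(1) by (intro assoc_mult_mat) auto
    finally show ?thesis .
  qed
  moreover have "f * g \<in> carrier_mat n n" using c by (rule mult_carrier_mat)
  ultimately show ?thesis using assms unfolding intertwines_def by blast
qed

lemma intertwines_inverse:
  assumes f: "intertwines n M f" and g: "g \<in> carrier_mat n n" "g * f = 1\<^sub>m n" "f * g = 1\<^sub>m n"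
  shows "intertwines n M g"
proof -
  have c: "f \<in> carrier_mat n n" using f by (auto simp: intertwines_def)
  have "g * X = X * g" if X: "X \<in> carrier_mat n n" "f * X = X * f" for X
  proof -
    have "g * X = g * (X * (f * g))" using X g by simp
    also have "X * (f * g) = (f * X) * g" unfolding X(2) using c g X by (intro assoc_mult_mat[symmetric]) auto
    also have "g * (f * X * g) = g * (f * (X * g))"
      by (subst assoc_mult_mat[OF c X(1) g(1)]) (rule refl)
    also have "\<dots> = (g * f) * (X * g)"
      using c g X by (intro assoc_mult_mat[symmetric, of _ n n _ n _ n]) (auto intro: mult_carrier_mat[of _ n n _ n])
    also have "\<dots> = X * g" using g X by (simp add: left_mult_one_mat[of _ n n] mult_carrier_mat[of _ n n _ n])
    finally show ?thesis .
  qed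
  thus ?thesis using f g(1) unfolding intertwines_def by blast
qed

lemma intertwines_kron:
  assumes M: "umodule r m hM M" and N: "umodule r n hN N"
  shows "intertwines n N f \<Longrightarrow> intertwines (m * n) (tens M N) (kron (1\<^sub>m m) f)"
    and "intertwines m M g \<Longrightarrow> intertwines (m * n) (tens M N) (kron g (1\<^sub>m n))"
proof -
  note DM = umoduleD[OF M] and DN = umoduleD[OF N]
  have mn: "m > 0" "n > 0" using DM DN by auto
  have car: "actE M \<in> carrier_mat m m" "actF M \<in> carrier_mat m m" "actH M \<in> carrier_mat m m"
    "actK M \<in> carrier_mat m m" "actKi M \<in> carrier_mat m m"
    "actE N \<in> carrier_mat n n" "actF N \<in> carrier_mat n n" "actH N \<in> carrier_mat n n"
    "actK N \<in> carrier_mat n n" "actKi N \<in> carrier_mat n n"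
    using DM DN by auto
  note dims = DM(12) DN(12)
  have tc: "actE (tens M N) \<in> carrier_mat (m * n) (m * n)" "actF (tens M N) \<in> carrier_mat (m * n) (m * n)"
    "actH (tens M N) \<in> carrier_mat (m * n) (m * n)" "actK (tens M N) \<in> carrier_mat (m * n) (m * n)"
    "actKi (tens M N) \<in> carrier_mat (m * n) (m * n)"
    using car by (auto simp: tens_sel dims)
  have t: "bl (m * n) (actE (tens M N)) = kb m n (1\<^sub>m m) (actE N) + kb m n (actE M) (actK N)"
    "bl (m * n) (actF (tens M N)) = kb m n (actKi M) (actF N) + kb m n (actF M) (1\<^sub>m n)"
    "bl (m * n) (actH (tens M N)) = kb m n (actH M) (1\<^sub>m n) + kb m n (1\<^sub>m m) (actH N)"
    "bl (m * n) (actK (tens M N)) = kb m n (actK M) (actK N)"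
    "bl (m * n) (actKi (tens M N)) = kb m n (actKi M) (actKi N)"
    using car mn by (simp_all add: tens_sel dims kb_def) (simp_all add: bl_add[of "m * n"])
  have lift: "intertwines (m * n) (tens M N) X"
    if "X \<in> carrier_mat (m * n) (m * n)"
      "\<And>Y. Y \<in> {actE (tens M N), actF (tens M N), actH (tens M N), actK (tens M N), actKi (tens M N)} \<Longrightarrow>
        bl (m * n) X * bl (m * n) Y = bl (m * n) Y * bl (m * n) X" for X
    unfolding intertwines_def
  proof (intro conjI ballI that(1))
    fix Y assume Y: "Y \<in> {actE (tens M N), actF (tens M N), actH (tens M N), actK (tens M N), actKi (tens M N)}"
    show c: "Y \<in> carrier_mat (m * n) (m * n)" using Y tc by auto
    show "X * Y = Y * X"
      using that(2)[OF Y] that(1) c mn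
      by (intro bl_inj[of "m * n"]) (auto simp: bl_mult intro!: mult_carrier_mat[of _ "m * n" "m * n"])
  qed
  note one = left_mult_one_mat[of _ n n] right_mult_one_mat[of _ n n] left_mult_one_mat[of _ m m] right_mult_one_mat[of _ m m]
  show "intertwines (m * n) (tens M N) (kron (1\<^sub>m m) f)" if f: "intertwines n N f"
  proof (rule lift)
    have cf: "f \<in> carrier_mat n n" and comm: "f * actE N = actE N * f" "f * actF N = actF N * f"
      "f * actH N = actH N * f" "f * actK N = actK N * f" "f * actKi N = actKi N * f"
      using f by (auto simp: intertwines_def)
    show "kron (1\<^sub>m m) f \<in> carrier_mat (m * n) (m * n)" using cf by simp
    fix Y assume "Y \<in> {actE (tens M N), actF (tens M N), actH (tens M N), actK (tens M N), actKi (tens M N)}"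
    thus "bl (m * n) (kron (1\<^sub>m m) f) * bl (m * n) Y = bl (m * n) Y * bl (m * n) (kron (1\<^sub>m m) f)"
      unfolding kb_def[symmetric]
      by safe (use car cf comm mn in \<open>simp_all only: t distrib_left distrib_right\<close>, 
        use car cf comm mn in \<open>simp_all add: kb_mult one\<close>)
  qed
  show "intertwines (m * n) (tens M N) (kron g (1\<^sub>m n))" if g: "intertwines m M g"
  proof (rule lift)
    have cg: "g \<in> carrier_mat m m" and comm: "g * actE M = actE M * g" "g * actF M = actF M * g"
      "g * actH M = actH M * g" "g * actK M = actK M * g" "g * actKi M = actKi M * g"
      using g by (auto simp: intertwines_def)
    show "kron g (1\<^sub>m n) \<in> carrier_mat (m * n) (m * n)" using cg by simp
    fix Y assume "Y \<in> {actE (tens M N), actF (tens M N), actH (tens M N), actK (tens M N), actKi (tens M N)}"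
    thus "bl (m * n) (kron g (1\<^sub>m n)) * bl (m * n) Y = bl (m * n) Y * bl (m * n) (kron g (1\<^sub>m n))"
      unfolding kb_def[symmetric]
      by safe (use car cg comm mn in \<open>simp_all only: t distrib_left distrib_right\<close>, 
        use car cg comm mn in \<open>simp_all add: kb_mult one\<close>)
  qed
qed

section \<open>The braiding\<close>

lemma bl_msum:
  assumes "n > 0" "\<And>i. i < k \<Longrightarrow> f i \<in> carrier_mat n n"
  shows "bl n (msum n n f k) = (\<Sum>i<k. bl n (f i))"
proof -
  have "foldr (\<lambda>i M. f i + M) xs (0\<^sub>m n n) \<in> carrier_mat n n \<and>
     bl n (foldr (\<lambda>i M. f i + M) xs (0\<^sub>m n n)) = (\<Sum>i\<leftarrow>xs. bl n (f i))"
    if "\<forall>i\<in>set xs. i < k" for xs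
    using that assms by (induction xs) (auto simp: bl_zero bl_add)
  from this[of "[0..<k]"] show ?thesis
    by (simp add: msum_def interv_sum_list_conv_sum_set_nat lessThan_atLeast0)
qed

section \<open>The series in the truncated R-matrix\<close>

definition rco :: "nat \<Rightarrow> nat \<Rightarrow> complex" where
  "rco r k = qbr r 1 ^ (2 * k) / (\<Prod>j=1..k. qbr r (of_nat j)) * qp r (of_nat k * (of_nat k - 1) / 2)"

lemma rco_0: "rco r 0 = 1" by (simp add: rco_def)

text \<open>The ratio of successive coefficients of the R-matrix, in the form that makes the sums in
  \<open>Th_F\<close> and \<open>Th_E\<close> telescope. The bound on k keeps [k + 1] away from [r]
  = 0.\<close>

lemma rco_Suc:
  assumes "r \<ge> 2" "Suc k < r"
  shows "rco r (Suc k) * qint r (of_nat (Suc k)) * qint r y = rco r k * qp r (of_nat k) * qbr r y"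
proof -
  have nz: "qbr r (of_nat (Suc k)) \<noteq> 0" "qbr r 1 \<noteq> 0"
    using qbr_nat_nz[of "Suc k" r] qbr_1_nz assms by auto
  have q: "qp r (of_nat (Suc k) * (of_nat (Suc k) - 1) / 2) = qp r (of_nat k * (of_nat k - 1) / 2) * qp r (of_nat k)"
  proof -
    have "of_nat (Suc k) * (of_nat (Suc k) - 1) / 2 = of_nat k * (of_nat k - 1) / 2 + (of_nat k :: complex)"
      by (simp add: field_simps)
    thus ?thesis by (simp only: qp_add)
  qed
  have "(\<Prod>j=1..Suc k. qbr r (of_nat j)) = (\<Prod>j=1..k. qbr r (of_nat j)) * qbr r (of_nat (Suc k))"
    by (simp add: mult.commute)
  thus ?thesis unfolding rco_def q qint_def using nz
    by (simp add: power2_eq_square field_simps del: of_nat_Suc)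
qed

lemma sum_telescope_zero:
  fixes t :: "nat \<Rightarrow> lop"
  assumes "t 0 = 0" "t r = 0"
  shows "(\<Sum>k<r. t k - t (Suc k)) = 0"
  using assms by (simp add: sum_lessThan_telescope')

lemma power_mult_distrib_commuting:
  fixes x y :: "'a :: monoid_mult"
  assumes "x * y = y * x"
  shows "(x * y) ^ k = x ^ k * y ^ k"
proof (induction k)
  case (Suc k)
  have "(x * y) ^ Suc k = x * (y * x ^ k) * y ^ k" by (simp add: Suc.IH mult.assoc)
  also have "y * x ^ k = x ^ k * y" using power_commuting_commutes[OF assms, of k] by simp
  finally show ?case by (simp add: mult.assoc)
qed simp

text \<open>\<open>e1, f1, d1\<close> act on the first tensor factor, and \<open>e2, f2, d2\<close> on the second one.\<close>

locale rmat = w1: wmod r e1 f1 d1 L + w2: wmod r e2 f2 d2 L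
  for r e1 f1 d1 e2 f2 d2 L +
  assumes c: "e1 * e2 = e2 * e1" "e1 * f2 = f2 * e1" "e1 * d2 g = d2 g * e1"
    "f1 * f2 = f2 * f1" "d1 g * f2 = f2 * d1 g"
begin

text \<open>The quasi-R-matrix, that is, the R-matrix without its Cartan factor q^(H \<otimes> H /
  2).\<close>

definition Th :: lop where "Th = (\<Sum>k<r. sc (rco r k) * (e1 ^ k * f2 ^ k))"

lemma cp: "e1 ^ k * f2 = f2 * e1 ^ k" "f2 ^ k * f1 = f1 * f2 ^ k" "f2 ^ k * d1 g = d1 g * f2 ^ k"
  "e1 ^ k * e2 = e2 * e1 ^ k" "f2 ^ k * e1 = e1 * f2 ^ k" "e1 ^ k * d2 g = d2 g * e1 ^ k"
  using power_commuting_commutes[OF c(2), of k] power_commuting_commutes[OF c(4)[symmetric], of k]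
    power_commuting_commutes[OF c(5)[symmetric], of k] power_commuting_commutes[OF c(1), of k]
    power_commuting_commutes[OF c(2)[symmetric], of k] power_commuting_commutes[OF c(3), of k] by auto

text \<open>The quasi-R-matrix turns the coproduct of F into its variant with K in place of K^(-1).
  The k-th summand fails to do so by t k - t (k + 1): commuting E^k with F lowers the power of E and
  gives t k, while the terms with K raise the power of F and give - t (k + 1). The total is zero
  because t 0 = 0 and the last term contains F^r = 0.\<close>

lemma Th_F: "Th * (d1 (\<lambda>x. qp r (- x)) * f2 + f1) = (f1 + d1 (qp r) * f2) * Th"
proof -
  define t where "t k = (if k = 0 then 0 else
    sc (rco r k) * (e1 ^ (k - 1) * d1 (\<lambda>x. qint r (of_nat k) * qint r (x + of_nat (k - 1))) * f2 ^ k))" for k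
  have step: "sc (rco r k) * (e1 ^ k * f2 ^ k) * (d1 (\<lambda>x. qp r (- x)) * f2 + f1)
     - (f1 + d1 (qp r) * f2) * (sc (rco r k) * (e1 ^ k * f2 ^ k)) = t k - t (Suc k)" if k: "k < r" for k
  proof -
    have a: "e1 ^ k * f2 ^ k * f1 - f1 * (e1 ^ k * f2 ^ k) = (e1 ^ k * f1 - f1 * e1 ^ k) * f2 ^ k"
      by (simp add: mult.assoc cp left_diff_distrib)
    have t: "sc (rco r k) * ((e1 ^ k * f1 - f1 * e1 ^ k) * f2 ^ k) = t k"
    proof (cases k)
      case (Suc j)
      have "e1 ^ Suc j * f1 - f1 * e1 ^ Suc j = e1 ^ j * d1 (\<lambda>x. qint r (of_nat (Suc j)) * qint r (x + of_nat j))"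
        unfolding w1.Epow_F by simp
      thus ?thesis unfolding t_def Suc by (simp del: of_nat_Suc power_Suc)
    qed (simp add: t_def)
    have b: "e1 ^ k * f2 ^ k * (d1 (\<lambda>x. qp r (- x)) * f2) - d1 (qp r) * f2 * (e1 ^ k * f2 ^ k) =
      (e1 ^ k * d1 (\<lambda>x. qp r (- x)) - d1 (qp r) * e1 ^ k) * f2 ^ Suc k"
    proof -
      have "e1 ^ k * f2 ^ k * (d1 (\<lambda>x. qp r (- x)) * f2) = e1 ^ k * (f2 ^ k * d1 (\<lambda>x. qp r (- x))) * f2"
        by (simp add: mult.assoc)
      also have "\<dots> = e1 ^ k * d1 (\<lambda>x. qp r (- x)) * f2 ^ Suc k"
        by (simp only: cp(3)) (simp add: mult.assoc power_commutes)
      finally have 1: "e1 ^ k * f2 ^ k * (d1 (\<lambda>x. qp r (- x)) * f2) = e1 ^ k * d1 (\<lambda>x. qp r (- x)) * f2 ^ Suc k" .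
      have "d1 (qp r) * f2 * (e1 ^ k * f2 ^ k) = d1 (qp r) * (f2 * e1 ^ k) * f2 ^ k"
        by (simp add: mult.assoc)
      also have "\<dots> = d1 (qp r) * e1 ^ k * f2 ^ Suc k"
        by (simp only: cp(1)[symmetric]) (simp add: mult.assoc)
      finally show ?thesis unfolding 1 by (simp only: left_diff_distrib)
    qed
    have d: "e1 ^ k * d1 (\<lambda>x. qp r (- x)) - d1 (qp r) * e1 ^ k = e1 ^ k * d1 (\<lambda>x. - (qp r (x + 2 * of_nat k) - qp r (- x)))"
    proof -
      have "d1 (\<lambda>x. qp r (- x)) = d1 (\<lambda>x. - (qp r (x + 2 * of_nat k) - qp r (- x))) + d1 (\<lambda>x. qp r (x + 2 * of_nat k))"
        unfolding w1.dg_add by (rule w1.dg_cong) simp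
      thus ?thesis unfolding w1.dg_Epow by (simp add: distrib_left)
    qed
    have u: "sc (rco r k) * (e1 ^ k * d1 (\<lambda>x. - (qp r (x + 2 * of_nat k) - qp r (- x))) * f2 ^ Suc k) = - t (Suc k)"
    proof (cases "Suc k < r")
      case True
      have "d1 (\<lambda>x. rco r k * - (qp r (x + 2 * of_nat k) - qp r (- x))) =
          d1 (\<lambda>x. - rco r (Suc k) * (qint r (of_nat (Suc k)) * qint r (x + of_nat k)))"
      proof (rule w1.dg_cong)
        fix x
        have "qp r (of_nat k) * qbr r (x + of_nat k) = qp r (x + 2 * of_nat k) - qp r (- x)"
          by (simp add: qbr_def right_diff_distrib qp_add[symmetric] algebra_simps)
        thus "rco r k * - (qp r (x + 2 * of_nat k) - qp r (- x)) =
            - rco r (Suc k) * (qint r (of_nat (Suc k)) * qint r (x + of_nat k))"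
          using rco_Suc[OF w1.r2 True, of "x + of_nat k"] by (simp add: mult.assoc right_diff_distrib del: of_nat_Suc)
      qed
      hence e: "sc (rco r k) * d1 (\<lambda>x. - (qp r (x + 2 * of_nat k) - qp r (- x))) =
         sc (- rco r (Suc k)) * d1 (\<lambda>x. qint r (of_nat (Suc k)) * qint r (x + of_nat k))"
        by (simp only: w1.dg_const[symmetric] w1.dg_mult)
      have "sc (rco r k) * (e1 ^ k * d1 (\<lambda>x. - (qp r (x + 2 * of_nat k) - qp r (- x))) * f2 ^ Suc k) =
         e1 ^ k * (sc (rco r k) * d1 (\<lambda>x. - (qp r (x + 2 * of_nat k) - qp r (- x)))) * f2 ^ Suc k"
        by (simp only: mult.assoc sc_left_commute[of "e1 ^ k"])
      also have "\<dots> = - t (Suc k)"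
        unfolding e by (simp add: t_def mult.assoc sc_minus sc_left_commute[of "e1 ^ k"] del: of_nat_Suc power_Suc)
      finally show ?thesis .
    next
      \<comment> \<open>Here k = r - 1, where \<open>rco_Suc\<close> would divide by [r] = 0;
        instead both sides contain F^r = 0.\<close>
      case False
      hence "f2 ^ Suc k = 0" using k w2.F_zero_pow[of "Suc k"] by simp
      thus ?thesis by (simp add: t_def del: power_Suc)
    qed
    have "sc (rco r k) * (e1 ^ k * f2 ^ k) * (d1 (\<lambda>x. qp r (- x)) * f2 + f1)
       - (f1 + d1 (qp r) * f2) * (sc (rco r k) * (e1 ^ k * f2 ^ k)) =
       sc (rco r k) * (e1 ^ k * f2 ^ k * f1 - f1 * (e1 ^ k * f2 ^ k)) +
       sc (rco r k) * (e1 ^ k * f2 ^ k * (d1 (\<lambda>x. qp r (- x)) * f2) - d1 (qp r) * f2 * (e1 ^ k * f2 ^ k))"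
      by (simp only: distrib_left distrib_right right_diff_distrib sc_left_commute[of "f1"]
        sc_left_commute[of "d1 (qp r) * f2"] mult.assoc[of "sc (rco r k)"]) simp
    also have "\<dots> = t k - t (Suc k)" unfolding a t b d u by simp
    finally show ?thesis .
  qed
  have "Th * (d1 (\<lambda>x. qp r (- x)) * f2 + f1) - (f1 + d1 (qp r) * f2) * Th = (\<Sum>k<r. t k - t (Suc k))"
    unfolding Th_def sum_distrib_left sum_distrib_right sum_subtractf[symmetric]
    using step by (intro sum.cong) auto
  also have "\<dots> = 0" by (rule sum_telescope_zero) (simp_all add: t_def w2.Fr)
  finally show ?thesis by simp
qed

text \<open>The mirror image of \<open>Th_F\<close>: the commutator is now taken in the second
  factor by \<open>E_Fpow\<close>, and the telescoping ends because E^r = 0 in the first.\<close>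

lemma Th_E: "Th * (e2 + e1 * d2 (qp r)) = (e1 * d2 (\<lambda>x. qp r (- x)) + e2) * Th"
proof -
  define t where "t k = (if k = 0 then 0 else
    sc (rco r k) * (e1 ^ k * (f2 ^ (k - 1) * d2 (\<lambda>x. qint r (of_nat k) * qint r (x - of_nat (k - 1))))))" for k
  have step: "(e1 * d2 (\<lambda>x. qp r (- x)) + e2) * (sc (rco r k) * (e1 ^ k * f2 ^ k)) -
     sc (rco r k) * (e1 ^ k * f2 ^ k) * (e2 + e1 * d2 (qp r)) = t k - t (Suc k)" if k: "k < r" for k
  proof -
    have a: "e2 * (e1 ^ k * f2 ^ k) - e1 ^ k * f2 ^ k * e2 = e1 ^ k * (e2 * f2 ^ k - f2 ^ k * e2)"
      by (simp add: mult.assoc right_diff_distrib) (simp add: mult.assoc[symmetric] cp)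
    have t: "sc (rco r k) * (e1 ^ k * (e2 * f2 ^ k - f2 ^ k * e2)) = t k"
    proof (cases k)
      case (Suc j)
      have "e2 * f2 ^ Suc j - f2 ^ Suc j * e2 = f2 ^ j * d2 (\<lambda>x. qint r (of_nat (Suc j)) * qint r (x - of_nat j))"
        unfolding w2.E_Fpow by simp
      thus ?thesis unfolding t_def Suc by (simp del: of_nat_Suc power_Suc)
    qed (simp add: t_def)
    have b: "e1 * d2 (\<lambda>x. qp r (- x)) * (e1 ^ k * f2 ^ k) - e1 ^ k * f2 ^ k * (e1 * d2 (qp r)) =
      e1 ^ Suc k * (d2 (\<lambda>x. qp r (- x)) * f2 ^ k - f2 ^ k * d2 (qp r))"
    proof -
      have "e1 * d2 (\<lambda>x. qp r (- x)) * (e1 ^ k * f2 ^ k) = e1 * (d2 (\<lambda>x. qp r (- x)) * e1 ^ k) * f2 ^ k"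
        by (simp add: mult.assoc)
      also have "\<dots> = e1 ^ Suc k * (d2 (\<lambda>x. qp r (- x)) * f2 ^ k)"
        by (simp only: cp(6)[symmetric]) (simp add: mult.assoc)
      finally have 1: "e1 * d2 (\<lambda>x. qp r (- x)) * (e1 ^ k * f2 ^ k) = e1 ^ Suc k * (d2 (\<lambda>x. qp r (- x)) * f2 ^ k)" .
      have "e1 ^ k * f2 ^ k * (e1 * d2 (qp r)) = e1 ^ k * (f2 ^ k * e1) * d2 (qp r)"
        by (simp add: mult.assoc)
      also have "\<dots> = e1 ^ Suc k * (f2 ^ k * d2 (qp r))"
        by (simp only: cp(5)) (simp add: mult.assoc[symmetric] power_commutes)
      finally show ?thesis unfolding 1 by (simp only: right_diff_distrib)
    qed
    have d: "d2 (\<lambda>x. qp r (- x)) * f2 ^ k - f2 ^ k * d2 (qp r) = f2 ^ k * d2 (\<lambda>x. - (qp r x - qp r (- (x - 2 * of_nat k))))"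
    proof -
      have "d2 (\<lambda>x. qp r (- (x - 2 * of_nat k))) = d2 (\<lambda>x. - (qp r x - qp r (- (x - 2 * of_nat k)))) + d2 (qp r)"
        unfolding w2.dg_add by (rule w2.dg_cong) simp
      thus ?thesis unfolding w2.dg_Fpow by (simp add: distrib_left)
    qed
    have u: "sc (rco r k) * (e1 ^ Suc k * (f2 ^ k * d2 (\<lambda>x. - (qp r x - qp r (- (x - 2 * of_nat k)))))) = - t (Suc k)"
    proof (cases "Suc k < r")
      case True
      have "d2 (\<lambda>x. rco r k * - (qp r x - qp r (- (x - 2 * of_nat k)))) =
          d2 (\<lambda>x. - rco r (Suc k) * (qint r (of_nat (Suc k)) * qint r (x - of_nat k)))"
      proof (rule w2.dg_cong)
        fix x
        have "qp r (of_nat k) * qbr r (x - of_nat k) = qp r x - qp r (- (x - 2 * of_nat k))"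
          by (simp add: qbr_def right_diff_distrib qp_add[symmetric] algebra_simps)
        thus "rco r k * - (qp r x - qp r (- (x - 2 * of_nat k))) =
            - rco r (Suc k) * (qint r (of_nat (Suc k)) * qint r (x - of_nat k))"
          using rco_Suc[OF w1.r2 True, of "x - of_nat k"] by (simp add: mult.assoc right_diff_distrib del: of_nat_Suc)
      qed
      hence e: "sc (rco r k) * d2 (\<lambda>x. - (qp r x - qp r (- (x - 2 * of_nat k)))) =
         sc (- rco r (Suc k)) * d2 (\<lambda>x. qint r (of_nat (Suc k)) * qint r (x - of_nat k))"
        by (simp only: w2.dg_const[symmetric] w2.dg_mult)
      have "sc (rco r k) * (e1 ^ Suc k * (f2 ^ k * d2 (\<lambda>x. - (qp r x - qp r (- (x - 2 * of_nat k)))))) =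
         e1 ^ Suc k * (f2 ^ k * (sc (rco r k) * d2 (\<lambda>x. - (qp r x - qp r (- (x - 2 * of_nat k))))))"
        by (simp only: sc_left_commute[of "e1 ^ Suc k"] sc_left_commute[of "f2 ^ k"])
      also have "\<dots> = - t (Suc k)"
        unfolding e by (simp add: t_def mult.assoc sc_minus sc_left_commute[of "e1 ^ Suc k"] sc_left_commute[of "f2 ^ k"] del: of_nat_Suc power_Suc)
      finally show ?thesis .
    next
      case False
      hence "e1 ^ Suc k = 0" using k w1.E_zero_pow[of "Suc k"] by simp
      thus ?thesis by (simp add: t_def del: power_Suc)
    qed
    have "(e1 * d2 (\<lambda>x. qp r (- x)) + e2) * (sc (rco r k) * (e1 ^ k * f2 ^ k)) -
     sc (rco r k) * (e1 ^ k * f2 ^ k) * (e2 + e1 * d2 (qp r)) =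
       sc (rco r k) * (e2 * (e1 ^ k * f2 ^ k) - e1 ^ k * f2 ^ k * e2) +
       sc (rco r k) * (e1 * d2 (\<lambda>x. qp r (- x)) * (e1 ^ k * f2 ^ k) - e1 ^ k * f2 ^ k * (e1 * d2 (qp r)))"
      by (simp only: distrib_left distrib_right right_diff_distrib sc_left_commute[of e2]
        sc_left_commute[of "e1 * d2 (\<lambda>x. qp r (- x))"] mult.assoc[of "sc (rco r k)"]) simp
    also have "\<dots> = t k - t (Suc k)" unfolding a t b d u by simp
    finally show ?thesis .
  qed
  have "(e1 * d2 (\<lambda>x. qp r (- x)) + e2) * Th - Th * (e2 + e1 * d2 (qp r)) = (\<Sum>k<r. t k - t (Suc k))"
    unfolding Th_def sum_distrib_left sum_distrib_right sum_subtractf[symmetric]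
    using step by (intro sum.cong) auto
  also have "\<dots> = 0" by (rule sum_telescope_zero) (simp_all add: t_def w1.Er)
  finally show ?thesis by simp
qed

text \<open>The operator is a polynomial in the nilpotent y = E \<otimes> F with constant term 1, so
  a finite geometric series inverts it.\<close>

lemma Th_invertible:
  assumes N: "N > 0" "e1 \<in> bls N" "f2 \<in> bls N"
  shows "\<exists>U\<in>bls N. U * Th = 1 \<and> Th * U = 1"
proof -
  define y where "y = e1 * f2"
  have y: "y ^ k = e1 ^ k * f2 ^ k" for k
    unfolding y_def by (rule power_mult_distrib_commuting) (rule c)
  define S where "S = (\<Sum>k<r - 1. sc (rco r (Suc k)) * y ^ k)"
  define x where "x = - (y * S)"
  have Th: "Th = 1 - x"
  proof -
    have "Th = (\<Sum>k<Suc (r - 1). sc (rco r k) * y ^ k)"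
      unfolding Th_def y using w1.Suc_r by simp
    also have "\<dots> = 1 + (\<Sum>k<r - 1. y * (sc (rco r (Suc k)) * y ^ k))"
      by (subst sum.lessThan_Suc_shift) (simp add: rco_0 sc_left_commute[of y])
    also have "\<dots> = 1 + y * S" by (simp add: S_def sum_distrib_left)
    finally show ?thesis by (simp add: x_def)
  qed
  have yS: "y * S = S * y"
    by (simp only: S_def sum_distrib_left sum_distrib_right sc_left_commute[of y] mult.assoc power_commutes)
  have "(y * S) ^ r = y ^ r * S ^ r" by (rule power_mult_distrib_commuting[OF yS])
  hence "(y * S) ^ r = 0" by (simp add: y w1.Er)
  hence xr: "x ^ r = 0" unfolding x_def by (subst power_minus) simp
  have g: "(1 - x) * (\<Sum>k<n. x ^ k) = 1 - x ^ n \<and> (\<Sum>k<n. x ^ k) * (1 - x) = 1 - x ^ n" for n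
  proof (induction n)
    case (Suc n)
    have "(1 - x) * (\<Sum>k<Suc n. x ^ k) = (1 - x ^ n) + (1 - x) * x ^ n"
      "(\<Sum>k<Suc n. x ^ k) * (1 - x) = (1 - x ^ n) + x ^ n * (1 - x)"
      using Suc.IH by (simp_all only: sum.lessThan_Suc distrib_left distrib_right)
    thus ?case by (simp add: left_diff_distrib right_diff_distrib power_commutes)
  qed simp
  have "x \<in> bls N" unfolding x_def S_def y_def using N by (intro bls_uminus bls_mult bls_sum bls_power bls_sc) auto
  hence "(\<Sum>k<r. x ^ k) \<in> bls N" using N by (intro bls_sum bls_power) auto
  thus ?thesis using g[of r] xr Th by auto
qed

end

lemma one_pow_mat: "1\<^sub>m n ^\<^sub>m k = (1\<^sub>m n :: complex mat)"
  unfolding dgm_one[symmetric] dgm_pow by simp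

lemma mult_lt: "i < r \<Longrightarrow> j < r \<Longrightarrow> i * r + j < r * (r::nat)"
  using mult_le_mono1[of "Suc i" r r] by simp

section \<open>The flip of two tensor factors\<close>

lemma flip_entry:
  assumes "X \<in> carrier_mat (r * r) (r * r)" "i < r * r" "j < r * r"
  shows "(flipmat r * X) $$ (i, j) = X $$ (i mod r * r + i div r, j)"
    and "(X * flipmat r) $$ (i, j) = X $$ (i, j mod r * r + j div r)"
proof -
  have f: "flipmat r \<in> carrier_mat (r * r) (r * r)" by (simp add: flipmat_def)
  have lt: "k mod r * r + k div r < r * r" if "k < r * r" for k
    using that by (intro mult_lt div_lt mod_lt) auto
  have inv: "k = l mod r * r + l div r \<longleftrightarrow> l = k mod r * r + k div r" if "k < r * r" "l < r * r" for k l
    using that div_lt[of k r r] div_lt[of l r r] by (auto simp: div_mult_mod_eq)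
  have "(\<Sum>l<r * r. flipmat r $$ (i, l) * X $$ (l, j)) =
      (\<Sum>l<r * r. if l = i mod r * r + i div r then X $$ (l, j) else 0)"
    using assms by (intro sum.cong) (auto simp: flipmat_def)
  thus "(flipmat r * X) $$ (i, j) = X $$ (i mod r * r + i div r, j)"
    using assms f lt[of i] by (simp add: mult_entry[of _ "r * r" "r * r" _ "r * r"])
  have "(\<Sum>l<r * r. X $$ (i, l) * flipmat r $$ (l, j)) =
      (\<Sum>l<r * r. if l = j mod r * r + j div r then X $$ (i, l) else 0)"
    using assms inv[of j] by (intro sum.cong) (auto simp: flipmat_def)
  thus "(X * flipmat r) $$ (i, j) = X $$ (i, j mod r * r + j div r)"
    using assms f lt[of j] by (simp add: mult_entry[of _ "r * r" "r * r" _ "r * r"])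
qed

lemma flip_kron:
  assumes "A \<in> carrier_mat r r" "B \<in> carrier_mat r r"
  shows "flipmat r * kron A B = kron B A * flipmat r"
proof (rule eq_matI)
  have c: "kron A B \<in> carrier_mat (r * r) (r * r)" "kron B A \<in> carrier_mat (r * r) (r * r)" using assms by auto
  fix i j assume "i < dim_row (kron B A * flipmat r)" "j < dim_col (kron B A * flipmat r)"
  hence ij: "i < r * r" "j < r * r" using assms by (auto simp: flipmat_def)
  have lt: "k mod r * r + k div r < r * r" if "k < r * r" for k
    using that by (intro mult_lt div_lt mod_lt) auto
  show "(flipmat r * kron A B) $$ (i, j) = (kron B A * flipmat r) $$ (i, j)"
    using ij assms lt[of i] lt[of j] div_lt[of i r r] div_lt[of j r r]
    by (simp add: flip_entry[OF c(1) ij] flip_entry[OF c(2) ij] kron_entry)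
qed (use assms in \<open>auto simp: flipmat_def\<close>)

lemma flip_flip: "flipmat r * flipmat r = 1\<^sub>m (r * r)"
proof (rule eq_matI)
  have f: "flipmat r \<in> carrier_mat (r * r) (r * r)" by (simp add: flipmat_def)
  fix i j assume "i < dim_row (1\<^sub>m (r * r) :: complex mat)" "j < dim_col (1\<^sub>m (r * r) :: complex mat)"
  hence ij: "i < r * r" "j < r * r" by auto
  have lt: "k mod r * r + k div r < r * r" if "k < r * r" for k
    using that by (intro mult_lt div_lt mod_lt) auto
  show "(flipmat r * flipmat r) $$ (i, j) = 1\<^sub>m (r * r) $$ (i, j)"
    unfolding flip_entry(1)[OF f ij] using ij lt[of i] div_lt[of i r r] by (auto simp: flipmat_def div_mult_mod_eq)
qed (auto simp: flipmat_def)

context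
  fixes r :: nat and a :: complex
  assumes r: "r \<ge> 2"
begin

abbreviation (input) "VE \<equiv> actE (Vmod r a)"
abbreviation (input) "VF \<equiv> actF (Vmod r a)"
abbreviation (input) "VK \<equiv> actK (Vmod r a)"
abbreviation (input) "VKi \<equiv> actKi (Vmod r a)"

lemmas V_props = umoduleD[OF umodule_Vmod[OF r, of a]]

lemma r_pos: "r > 0" using r by simp

lemma V_carriers: "VE \<in> carrier_mat r r" "VF \<in> carrier_mat r r" "VK \<in> carrier_mat r r" "VKi \<in> carrier_mat r r"
  using V_props by auto

lemmas V_mult_simps = mult_carrier_mat[of _ r r _ r] left_mult_one_mat[of _ r r] right_mult_one_mat[of _ r r]

lemma rmat_Vmod:
  "rmat r (kb r r VE (1\<^sub>m r)) (kb r r VF (1\<^sub>m r)) (\<lambda>g. kb r r (dgm r (\<lambda>i. g (wt r a i))) (1\<^sub>m r))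
     (kb r r (1\<^sub>m r) VE) (kb r r (1\<^sub>m r) VF) (\<lambda>g. kb r r (1\<^sub>m r) (dgm r (\<lambda>i. g (wt r a i)))) (wt r a ` {..<r})"
proof -
  have w1: "wmod r (kb r r VE (1\<^sub>m r)) (kb r r VF (1\<^sub>m r)) (\<lambda>g. kb r r (dgm r (\<lambda>i. g (wt r a i))) (1\<^sub>m r)) (wt r a ` {..<r})"
    using r_pos by (intro wmod_hom[OF r umodule_Vmod[OF r], where \<phi> = "\<lambda>X. kb r r X (1\<^sub>m r)"])
      (simp_all add: kb_mult kb_add_left kb_smult kb_one)
  have w2: "wmod r (kb r r (1\<^sub>m r) VE) (kb r r (1\<^sub>m r) VF) (\<lambda>g. kb r r (1\<^sub>m r) (dgm r (\<lambda>i. g (wt r a i)))) (wt r a ` {..<r})"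
    using r_pos by (intro wmod_hom[OF r umodule_Vmod[OF r], where \<phi> = "\<lambda>X. kb r r (1\<^sub>m r) X"])
      (simp_all add: kb_mult kb_add_right kb_smult kb_one)
  show ?thesis
    by (intro rmat.intro w1 w2 rmat_axioms.intro) (use V_carriers r_pos in \<open>simp_all add: kb_mult V_mult_simps\<close>)
qed

interpretation R: rmat r "kb r r VE (1\<^sub>m r)" "kb r r VF (1\<^sub>m r)" "\<lambda>g. kb r r (dgm r (\<lambda>i. g (wt r a i))) (1\<^sub>m r)"
  "kb r r (1\<^sub>m r) VE" "kb r r (1\<^sub>m r) VF" "\<lambda>g. kb r r (1\<^sub>m r) (dgm r (\<lambda>i. g (wt r a i)))" "wt r a ` {..<r}"
  by (rule rmat_Vmod)

definition Dmat :: "complex mat" where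
  "Dmat = dgm (r * r) (\<lambda>i. qp r (wt r a (i div r) * wt r a (i mod r) / 2))"

definition Tmat :: "complex mat" where
  "Tmat = msum (r*r) (r*r) (\<lambda>k. rco r k \<cdot>\<^sub>m kron (VE ^\<^sub>m k) (VF ^\<^sub>m k)) r"

lemma term_carrier: "rco r k \<cdot>\<^sub>m kron (VE ^\<^sub>m k) (VF ^\<^sub>m k) \<in> carrier_mat (r * r) (r * r)"
  using V_carriers by (intro smult_carrier_mat kron_carrier pow_carrier_mat)

lemma Dmat_carrier: "Dmat \<in> carrier_mat (r * r) (r * r)" by (simp add: Dmat_def)

lemma Tmat_carrier: "Tmat \<in> carrier_mat (r * r) (r * r)"
  unfolding Tmat_def by (rule msum_carrier) (rule term_carrier)

lemma flip_carrier: "flipmat r \<in> carrier_mat (r * r) (r * r)" by (simp add: flipmat_def)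

lemma cmat_eq: "cmat r a = flipmat r * (Dmat * Tmat)"
  unfolding cmat_def Rmat_def Dmat_def Tmat_def Let_def dgm_def rco_def ..

lemma cmat_carrier: "cmat r a \<in> carrier_mat (r * r) (r * r)"
  unfolding cmat_eq using Dmat_carrier Tmat_carrier flip_carrier by (intro mult_carrier_mat)

lemma bl_Tmat: "bl (r * r) Tmat = R.Th"
proof -
  have "kb r r (VE ^\<^sub>m k) (VF ^\<^sub>m k) = kb r r VE (1\<^sub>m r) ^ k * kb r r (1\<^sub>m r) VF ^ k" for k
    using V_carriers r_pos by (simp add: kb_pow kb_mult one_pow_mat V_mult_simps)
  thus ?thesis unfolding Tmat_def R.Th_def
    using term_carrier r_pos V_carriers by (subst bl_msum) (auto simp: bl_smult kb_def)
qed

lemma bl_cmat: "bl (r * r) (cmat r a) = bl (r * r) (flipmat r) * (bl (r * r) Dmat * R.Th)"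
  unfolding cmat_eq bl_Tmat[symmetric] using r_pos Dmat_carrier Tmat_carrier flip_carrier
  by (simp add: bl_mult mult_carrier_mat[of _ "r * r" "r * r" _ "r * r"])

text \<open>On a vector with weights x and y, the exponent of the Cartan factor changes by ((x +
  s)(y + t) - x y) / 2 = (s y + t x + s t) / 2. The first two terms become functions of H on one
  factor each; the condition on s and t removes the third.\<close>

lemma kron_Dmat:
  assumes A: "A \<in> carrier_mat r r" "shifts r (wt r a) s A" and B: "B \<in> carrier_mat r r" "shifts r (wt r a) t B"
    and st: "s = 0 \<or> t = 0"
  shows "kb r r A B * bl (r * r) Dmat =
    bl (r * r) Dmat * kb r r (A * dgm r (\<lambda>i. qp r (- t * wt r a i / 2))) (B * dgm r (\<lambda>i. qp r (- s * wt r a i / 2)))"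
proof -
  let ?A = "A * dgm r (\<lambda>i. qp r (- t * wt r a i / 2))" and ?B = "B * dgm r (\<lambda>i. qp r (- s * wt r a i / 2))"
  have c: "?A \<in> carrier_mat r r" "?B \<in> carrier_mat r r" "kron A B \<in> carrier_mat (r * r) (r * r)"
    using A B by (auto intro!: mult_carrier_mat[of _ r r _ r])
  hence ck: "kron ?A ?B \<in> carrier_mat (r * r) (r * r)" by (intro kron_carrier)
  have "kron A B * Dmat = Dmat * kron ?A ?B"
  proof (rule eq_matI)
    fix i j assume "i < dim_row (Dmat * kron ?A ?B)" "j < dim_col (Dmat * kron ?A ?B)"
    hence ij: "i < r * r" "j < r * r" using A B by (auto simp: Dmat_def)
    let ?h = "wt r a"
    show "(kron A B * Dmat) $$ (i, j) = (Dmat * kron ?A ?B) $$ (i, j)"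
    proof (cases "A $$ (i div r, j div r) = 0 \<or> B $$ (i mod r, j mod r) = 0")
      case True
      thus ?thesis unfolding Dmat_def mult_dgm_entry[OF c(3) ij] dgm_mult_entry[OF ck ij]
        using ij A B div_lt[of i r r] div_lt[of j r r] by (auto simp: kron_entry mult_dgm_entry[of _ r r])
    next
      case False
      hence h: "?h (i div r) = ?h (j div r) + s" "?h (i mod r) = ?h (j mod r) + t"
        using A B ij div_lt[of i r r] div_lt[of j r r] mod_lt[of i r r] mod_lt[of j r r] by (auto simp: shifts_def)
      have "qp r (?h (i div r) * ?h (i mod r) / 2) * (qp r (- t * ?h (j div r) / 2) * qp r (- s * ?h (j mod r) / 2)) =
          qp r (?h (j div r) * ?h (j mod r) / 2)"
        unfolding h qp_add[symmetric] using st by (intro arg_cong[of _ _ "qp r"]) (auto simp: field_simps)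
      thus ?thesis unfolding Dmat_def mult_dgm_entry[OF c(3) ij] dgm_mult_entry[OF ck ij]
        using ij A B div_lt[of i r r] div_lt[of j r r] mod_lt[of i r r] mod_lt[of j r r]
        by (simp add: kron_entry mult_dgm_entry[of _ r r] mult_ac)
    qed
  qed (use A B in \<open>auto simp: Dmat_def\<close>)
  thus ?thesis unfolding kb_def using r_pos c ck Dmat_carrier by (simp add: bl_mult[symmetric])
qed

lemma flip_kb:
  assumes "A \<in> carrier_mat r r" "B \<in> carrier_mat r r"
  shows "bl (r * r) (flipmat r) * kb r r A B = kb r r B A * bl (r * r) (flipmat r)"
  using flip_kron[OF assms] r_pos assms flip_carrier by (simp add: kb_def bl_mult[symmetric])

text \<open>The terms E^k \<otimes> F^k, the Cartan factor and the flip all preserve the total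
  weight. This gives commutation with H, K and K^(-1), to which the relations for E and F are added
  below.\<close>

lemma cmat_shifts: "shifts (r * r) (\<lambda>i. wt r a (i div r) + wt r a (i mod r)) 0 (cmat r a)"
proof -
  let ?h = "\<lambda>i. wt r a (i div r) + wt r a (i mod r)"
  have t: "shifts (r * r) ?h 0 (rco r k \<cdot>\<^sub>m kron (VE ^\<^sub>m k) (VF ^\<^sub>m k))" for k
  proof -
    have "shifts (r * r) ?h (of_nat k * 2 + of_nat k * - 2) (kron (VE ^\<^sub>m k) (VF ^\<^sub>m k))"
      using V_props by (intro shifts_kron shifts_pow pow_carrier_mat) auto
    moreover have "kron (VE ^\<^sub>m k) (VF ^\<^sub>m k) \<in> carrier_mat (r * r) (r * r)"
      using V_carriers by (intro kron_carrier pow_carrier_mat)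
    ultimately show ?thesis by (auto simp: shifts_def smult_entry)
  qed
  have T: "shifts (r * r) ?h 0 Tmat"
    unfolding shifts_def
  proof (intro allI impI)
    fix i j assume ij: "i < r * r" "j < r * r" and "Tmat $$ (i, j) \<noteq> 0"
    hence "(\<Sum>k<r. (rco r k \<cdot>\<^sub>m kron (VE ^\<^sub>m k) (VF ^\<^sub>m k)) $$ (i, j)) \<noteq> 0"
      unfolding Tmat_def by (subst (asm) msum_entry[OF term_carrier ij])
    then obtain k where "(rco r k \<cdot>\<^sub>m kron (VE ^\<^sub>m k) (VF ^\<^sub>m k)) $$ (i, j) \<noteq> 0"
      by (meson sum.neutral)
    thus "?h i = ?h j + 0" using t[of k] ij by (simp add: shifts_def)
  qed
  have f: "shifts (r * r) ?h 0 (flipmat r)"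
    using div_lt[of _ r r] r_pos by (auto simp: shifts_def flipmat_def)
  have D: "shifts (r * r) ?h 0 Dmat" unfolding Dmat_def by (rule shifts_dgm_0)
  have "shifts (r * r) ?h (0 + (0 + 0)) (cmat r a)"
    unfolding cmat_eq using f D T Dmat_carrier Tmat_carrier flip_carrier
    by (intro shifts_mult mult_carrier_mat[of _ "r * r" "r * r" _ "r * r"])
  thus ?thesis by simp
qed

text \<open>Each factor of the braiding changes the coproduct once. The quasi-R-matrix takes 1
  \<otimes> E + E \<otimes> K to E \<otimes> K^(-1) + 1 \<otimes> E, the Cartan factor takes this to
  the opposite coproduct E \<otimes> 1 + K \<otimes> E, and the flip restores the original one. For
  F the chain is the same.\<close>

lemma cmat_intertwines: "intertwines (r * r) (tens (Vmod r a) (Vmod r a)) (cmat r a)"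
proof -
  let ?W = "tens (Vmod r a) (Vmod r a)" and ?h = "\<lambda>i. wt r a (i div r) + wt r a (i mod r)"
  let ?b = "bl (r * r)" and ?t = "bl (r * r) (flipmat r)" and ?d = "bl (r * r) Dmat"
  note U = umodule_Vmod[OF r, of a]
  note W = umodule_tens[OF r U U]
  note DW = umoduleD[OF W]
  have sK: "shifts r (wt r a) 0 VK" "shifts r (wt r a) 0 VKi" by (simp_all add: V_props shifts_dgm_0)
  have K1: "VKi * VK = 1\<^sub>m r" "VK * VKi = 1\<^sub>m r" by (simp_all add: V_props dgm_mult dgm_one)
  have E: "?b (actE ?W) = kb r r (1\<^sub>m r) VE + kb r r VE VK"
    and F: "?b (actF ?W) = kb r r VKi VF + kb r r VF (1\<^sub>m r)"
    using V_carriers r_pos by (auto simp: tens_simps[OF U U] kb_def intro!: bl_add)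
  have p: "kb r r VE VK = kb r r VE (1\<^sub>m r) * kb r r (1\<^sub>m r) VK"
    "kb r r VE VKi = kb r r VE (1\<^sub>m r) * kb r r (1\<^sub>m r) VKi"
    "kb r r VKi VF = kb r r VKi (1\<^sub>m r) * kb r r (1\<^sub>m r) VF"
    "kb r r VK VF = kb r r VK (1\<^sub>m r) * kb r r (1\<^sub>m r) VF"
    using V_carriers r_pos by (simp_all add: kb_mult V_mult_simps)
  have TE: "R.Th * ?b (actE ?W) = (kb r r VE VKi + kb r r (1\<^sub>m r) VE) * R.Th"
    using R.Th_E unfolding E p unfolding V_props(5,6) .
  have DE: "?d * (kb r r VE VKi + kb r r (1\<^sub>m r) VE) = (kb r r VE (1\<^sub>m r) + kb r r VK VE) * ?d"
  proof -
    have "kb r r VE (1\<^sub>m r) * ?d = ?d * kb r r VE VKi"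
      using kron_Dmat[OF V_carriers(1) V_props(7) one_carrier_mat shifts_one] V_carriers by (simp add: dgm_one V_props(6) V_mult_simps)
    moreover have "kb r r VK VE * ?d = ?d * kb r r (1\<^sub>m r) VE"
    proof -
      have "VK * dgm r (\<lambda>i. qp r (- 2 * wt r a i / 2)) = 1\<^sub>m r" using K1(2) by (simp add: V_props(6))
      thus ?thesis using kron_Dmat[OF V_carriers(3) sK(1) V_carriers(1) V_props(7)] V_carriers by (simp add: dgm_one V_mult_simps)
    qed
    ultimately show ?thesis by (simp add: distrib_left distrib_right)
  qed
  have tE: "?t * (kb r r VE (1\<^sub>m r) + kb r r VK VE) = ?b (actE ?W) * ?t"
    unfolding E using V_carriers by (simp add: distrib_left distrib_right flip_kb)
  have cE: "?b (cmat r a) * ?b (actE ?W) = ?b (actE ?W) * ?b (cmat r a)"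
    unfolding bl_cmat by (simp only: mult.assoc TE) (simp only: mult.assoc[symmetric] tE[symmetric], simp only: mult.assoc DE[symmetric])
  have TF: "R.Th * ?b (actF ?W) = (kb r r VF (1\<^sub>m r) + kb r r VK VF) * R.Th"
    using R.Th_F unfolding F p unfolding V_props(5,6) .
  have DF: "?d * (kb r r VF (1\<^sub>m r) + kb r r VK VF) = (kb r r VF VKi + kb r r (1\<^sub>m r) VF) * ?d"
  proof -
    have "kb r r (1\<^sub>m r) VF * ?d = ?d * kb r r VK VF"
      using kron_Dmat[OF one_carrier_mat shifts_one V_carriers(2) V_props(8)] V_carriers by (simp add: dgm_one V_props(5) V_mult_simps)
    moreover have "kb r r VF VKi * ?d = ?d * kb r r VF (1\<^sub>m r)"
    proof -
      have "VKi * dgm r (\<lambda>i. qp r (- (- 2) * wt r a i / 2)) = 1\<^sub>m r" using K1(1) by (simp add: V_props(5))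
      thus ?thesis using kron_Dmat[OF V_carriers(2) V_props(8) V_carriers(4) sK(2)] V_carriers by (simp add: dgm_one V_mult_simps)
    qed
    ultimately show ?thesis by (simp add: distrib_left distrib_right)
  qed
  have tF: "?t * (kb r r VF VKi + kb r r (1\<^sub>m r) VF) = ?b (actF ?W) * ?t"
    unfolding F using V_carriers by (simp add: distrib_left distrib_right flip_kb add.commute)
  have cF: "?b (cmat r a) * ?b (actF ?W) = ?b (actF ?W) * ?b (cmat r a)"
    unfolding bl_cmat by (simp only: mult.assoc TF) (simp only: mult.assoc[symmetric] tF[symmetric], simp only: mult.assoc DF[symmetric])
  have lift: "cmat r a * X = X * cmat r a"
    if "X \<in> carrier_mat (r * r) (r * r)" "?b (cmat r a) * ?b X = ?b X * ?b (cmat r a)" for X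
    using that cmat_carrier r_pos
    by (intro bl_inj[of "r * r"]) (auto simp: bl_mult intro!: mult_carrier_mat[of _ "r * r" "r * r"])
  have dg: "cmat r a * dgm (r * r) (\<lambda>i. g (?h i)) = dgm (r * r) (\<lambda>i. g (?h i)) * cmat r a" for g
    using shifts_dgm[OF cmat_carrier cmat_shifts, of g] by simp
  show ?thesis unfolding intertwines_def
    using cmat_carrier DW(2,3) lift[OF DW(2) cE] lift[OF DW(3) cF] dg[of "\<lambda>x. x"] dg[of "qp r"] dg[of "\<lambda>x. qp r (- x)"]
    unfolding DW(4,5,6) by auto
qed

text \<open>Justifies the choice in \<open>cinv\<close>: the flip is an involution, the Cartan
  factor is diagonal without zeros, and the quasi-R-matrix is unipotent.\<close>

lemma cmat_invertible:
  "\<exists>M. M \<in> carrier_mat (r * r) (r * r) \<and> M * cmat r a = 1\<^sub>m (r * r) \<and> cmat r a * M = 1\<^sub>m (r * r)"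
proof -
  have N: "r * r > 0" using r_pos by simp
  let ?b = "bl (r * r)"
  have "kb r r VE (1\<^sub>m r) \<in> bls (r * r)" "kb r r (1\<^sub>m r) VF \<in> bls (r * r)"
    using V_carriers r_pos by (auto intro!: kb_bls)
  from R.Th_invertible[OF N this] obtain U where U: "U \<in> bls (r * r)" "U * R.Th = 1" "R.Th * U = 1" by blast
  define Di where "Di = dgm (r * r) (\<lambda>i. qp r (- (wt r a (i div r) * wt r a (i mod r) / 2)))"
  have Di: "Di \<in> carrier_mat (r * r) (r * r)" "Di * Dmat = 1\<^sub>m (r * r)" "Dmat * Di = 1\<^sub>m (r * r)"
    by (simp_all add: Di_def Dmat_def dgm_mult dgm_one)
  have d: "?b Di * ?b Dmat = 1" "?b Dmat * ?b Di = 1"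
    using N Di Dmat_carrier by (simp_all add: bl_mult[symmetric] bl_one)
  have t: "?b (flipmat r) * ?b (flipmat r) = 1"
    using N flip_carrier by (simp add: bl_mult[symmetric] bl_one flip_flip)
  have "U * ?b Di * ?b (flipmat r) \<in> bls (r * r)"
    using N U Di flip_carrier by (intro bls_mult bls_bl) auto
  then obtain M where M: "M \<in> carrier_mat (r * r) (r * r)" "U * ?b Di * ?b (flipmat r) = ?b M"
    by (elim blsE)
  have "U * ?b Di * ?b (flipmat r) * (?b (flipmat r) * (?b Dmat * R.Th)) = U * (?b Di * (?b (flipmat r) * ?b (flipmat r)) * ?b Dmat) * R.Th"
    by (simp only: mult.assoc)
  hence 1: "?b M * ?b (cmat r a) = 1" unfolding bl_cmat M(2)[symmetric] by (simp add: t d U)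
  have "(?b (flipmat r) * (?b Dmat * R.Th)) * (U * ?b Di * ?b (flipmat r)) = ?b (flipmat r) * (?b Dmat * (R.Th * U) * ?b Di) * ?b (flipmat r)"
    by (simp only: mult.assoc)
  hence 2: "?b (cmat r a) * ?b M = 1" unfolding bl_cmat M(2)[symmetric] by (simp add: t d U)
  have "M * cmat r a = 1\<^sub>m (r * r)" "cmat r a * M = 1\<^sub>m (r * r)"
    using M(1) cmat_carrier N 1 2
    by (auto intro!: bl_inj[of "r * r"] mult_carrier_mat[of _ "r * r" "r * r"] simp: bl_mult bl_one)
  thus ?thesis using M(1) by blast
qed

lemma cinv_intertwines: "intertwines (r * r) (tens (Vmod r a) (Vmod r a)) (cinv r a)"
  using someI_ex[OF cmat_invertible] intertwines_inverse[OF cmat_intertwines]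
  unfolding cinv_def by blast

lemma gen_mat_intertwines:
  assumes "1 \<le> fst g" "fst g < n"
  shows "intertwines (r ^ n) (tpow (Vmod r a) n) (gen_mat r a n g)"
proof -
  let ?V = "Vmod r a" and ?i = "fst g - 1" and ?j = "n - fst g - 1"
  let ?c = "if snd g then cmat r a else cinv r a"
  note U = umodule_Vmod[OF r, of a]
  \<comment> \<open>The generator acts on the two middle factors; i - 1 strands lie to the left of
    them and n - i - 1 to the right.\<close>
  have n: "n = (?i + Suc (Suc 0)) + ?j" using assms by simp
  have "tpow ?V (Suc (Suc 0)) = tens ?V ?V" using tpow_1[OF r, of a] by simp
  hence T: "tpow ?V n = tens (tens (tpow ?V ?i) (tens ?V ?V)) (tpow ?V ?j)"
    by (subst n) (simp only: tpow_add[OF r])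
  have "intertwines (r * r) (tens ?V ?V) ?c" using cmat_intertwines cinv_intertwines by simp
  hence "intertwines (r ^ ?i * (r * r)) (tens (tpow ?V ?i) (tens ?V ?V)) (kron (1\<^sub>m (r ^ ?i)) ?c)"
    by (rule intertwines_kron(1)[OF umodule_tpow[OF r] umodule_tens[OF r U U]])
  hence "intertwines (r ^ ?i * (r * r) * r ^ ?j) (tpow ?V n) (kron (kron (1\<^sub>m (r ^ ?i)) ?c) (1\<^sub>m (r ^ ?j)))"
    unfolding T
    by (rule intertwines_kron(2)[OF umodule_tens[OF r umodule_tpow[OF r] umodule_tens[OF r U U]] umodule_tpow[OF r]])
  moreover have "r ^ ?i * (r * r) * r ^ ?j = r ^ n"
    using arg_cong[OF n, of "\<lambda>k. r ^ k"] by (simp only: power_add power_Suc power_0 mult_1_right)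
  ultimately show ?thesis by (simp add: gen_mat_def)
qed

lemma braid_mat_intertwines:
  assumes "braid_word n w"
  shows "intertwines (r ^ n) (tpow (Vmod r a) n) (braid_mat r a n w)"
  using assms
proof (induction w)
  case Nil
  then show ?case using intertwines_one[OF umodule_tpow[OF r]] by (simp add: braid_mat_def)
next
  case (Cons g w)
  then show ?case
    using intertwines_mult[OF gen_mat_intertwines[of g n]] by (simp add: braid_mat_def braid_word_def)
qed

end

section \<open>The renormalized invariant\<close>

text \<open>The operator \<open>prj\<close> contains F^(r-1), so it vanishes on vectors of weight x
  unless x - 2(r - 1) is a weight too. This confines the possible highest weights to the range of
  summation in the theorem.\<close>

lemma (in wmod) prj_dg_cong:
  assumes "\<And>x. x \<in> L \<Longrightarrow> x - 2 * of_nat (r - 1) \<in> L \<Longrightarrow> g x = g' x"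
  shows "prj * dg g = prj * dg g'"
proof -
  have F: "F ^ (r - 1) * dg c = dg (\<lambda>x. c (x + 2 * of_nat (r - 1))) * F ^ (r - 1)" for c
    unfolding dg_Fpow by simp
  \<comment> \<open>Cutting the functions off outside L before moving F^(r-1) past them imposes the
    condition on x and on the shifted weight simultaneously.\<close>
  have L: "dg c = dg (\<lambda>x. if x \<in> L then c x else 0)" for c
    by (rule dg_cong) simp
  have "F ^ (r - 1) * dg g = F ^ (r - 1) * dg g'"
    unfolding L[of g] L[of g'] F
    by (intro arg_cong[of _ _ "\<lambda>X. X * F ^ (r - 1)"] dg_cong) (use assms in auto)
  moreover have "prj * dg c = E ^ (r - 1) * (F ^ (r - 1) * dg c) * dg (\<lambda>x. inverse (kap r (r - 1) x))" for c
    by (simp add: prj_def mult.assoc dg_mult mult.commute)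
  ultimately show ?thesis by simp
qed

lemma (in wmod) dg_sum: "finite S \<Longrightarrow> dg (\<lambda>x. \<Sum>m\<in>S. g m x) = (\<Sum>m\<in>S. dg (g m))"
  by (induction S rule: finite_induct) (simp_all add: dg_const dg_add[symmetric])

lemma intertwines_shifts:
  assumes M: "umodule r n h M" and f: "intertwines n M f"
  shows "shifts n h 0 f"
proof -
  have c: "f \<in> carrier_mat n n" and H: "f * dgm n h = dgm n h * f"
    using f umoduleD[OF M] by (auto simp: intertwines_def)
  have "f $$ (i, j) * (h i - h j) = 0" if "i < n" "j < n" for i j
    using mult_dgm_entry[OF c that, of h] dgm_mult_entry[OF c that, of h] H by (simp add: algebra_simps)
  thus ?thesis unfolding shifts_def by (metis add.right_neutral eq_iff_diff_eq_0 mult_eq_0_iff)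
qed

text \<open>The partial trace is a scalar matrix: its entries off the diagonal vanish because f
  preserves weights, and the diagonal ones agree by \<open>tr_umat_step\<close>. So the description
  in \<open>bracketT\<close> has a unique solution, and this scalar is the entry at v_0, written as
  a trace over the whole tensor power.\<close>

lemma bracketT_eq:
  assumes r: "r \<ge> 2" and n: "n \<ge> 1" and w: "braid_word n w"
  shows "bracketT r a n w = tr (r ^ n)
    (kb r (r ^ (n - 1)) (umat r 0 0) (piv r (r ^ (n - 1)) (wsum r a (n - 1))) * bl (r ^ n) (braid_mat r a n w))"
proof -
  define M where "M = r ^ (n - 1)"
  let ?h = "wsum r a (n - 1)" and ?W' = "tpow (Vmod r a) (n - 1)"
  let ?f = "braid_mat r a n w" and ?p = "piv r M ?h"
  have rM: "r > 0" "M > 0" using r by (auto simp: M_def)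
  have N: "r * M = r ^ n" using n by (simp add: M_def power_eq_if)
  note U = umodule_Vmod[OF r, of a] and W' = umodule_tpow[OF r, of "n - 1" a, folded M_def]
  have Wn: "tens (Vmod r a) ?W' = tpow (Vmod r a) n"
    using tpow_add[OF r, of a "Suc 0" "n - 1"] n by (simp add: tpow_1[OF r] del: tpow.simps)
  note W = umodule_tens[OF r U W', unfolded Wn]
  have f: "intertwines (r * M) (tpow (Vmod r a) n) ?f"
    unfolding N by (rule braid_mat_intertwines[OF r w])
  hence cf: "?f \<in> carrier_mat (r * M) (r * M)" by (simp add: intertwines_def)
  let ?t = "\<lambda>i. tr (r * M) (kb r M (umat r i i) ?p * bl (r * M) ?f)"
  have comm: "bl (r * M) (actF (tens (Vmod r a) ?W')) * bl (r * M) ?f =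
      bl (r * M) ?f * bl (r * M) (actF (tens (Vmod r a) ?W'))"
    using f rM unfolding Wn intertwines_def by (simp add: bl_mult[symmetric])
  have t: "?t i = ?t 0" if "i < r" for i
    using that
  proof (induction i)
    case (Suc i)
    then show ?case using tr_umat_step[OF r W' bls_bl[OF cf] comm, of i] by simp
  qed simp
  have tri: "?t i = (\<Sum>k<M. qp r (- ?h k) ^ (r - 1) * ?f $$ (i * M + k, i * M + k))" if i: "i < r" for i
  proof -
    have um: "umat r i i = dgm r (\<lambda>k. if k = i then 1 else 0)" by (rule eq_matI) auto
    have "?t i = (\<Sum>p<r * M. (kron (umat r i i) ?p * ?f) $$ (p, p))"
      unfolding kb_def using rM cf by (simp add: bl_mult[symmetric] tr_bl)
    also have "\<dots> = (\<Sum>p<r * M. (\<lambda>k l. (if k = i then 1 else 0) * qp r (- ?h l) ^ (r - 1) * ?f $$ (k * M + l, k * M + l)) (p div M) (p mod M))"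
      unfolding um piv_def kron_dgm by (intro sum.cong) (auto simp: dgm_mult_entry[OF cf])
    also have "\<dots> = (\<Sum>k<r. \<Sum>l<M. (if k = i then 1 else 0) * qp r (- ?h l) ^ (r - 1) * ?f $$ (k * M + l, k * M + l))"
      by (rule sum_div_mod[OF rM(2)])
    also have "\<dots> = (\<Sum>k<r. if k = i then \<Sum>l<M. qp r (- ?h l) ^ (r - 1) * ?f $$ (i * M + l, i * M + l) else 0)"
      by (intro sum.cong) auto
    finally show ?thesis using i by simp
  qed
  have K: "kron (1\<^sub>m r) (actKi ?W' ^\<^sub>m (r - 1)) = dgm (r * M) (\<lambda>p. qp r (- ?h (p mod M)) ^ (r - 1))"
    unfolding umoduleD(6)[OF W'] dgm_pow dgm_one[symmetric] kron_dgm by simp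
  have lt: "i * M + k < r * M" if "i < r" "k < M" for i k
    using mult_le_mono1[of "Suc i" r M] that by simp
  have "ptr r M (kron (1\<^sub>m r) (actKi ?W' ^\<^sub>m (r - 1)) * ?f) = ?t 0 \<cdot>\<^sub>m 1\<^sub>m r"
  proof (rule eq_matI)
    fix i j assume "i < dim_row (?t 0 \<cdot>\<^sub>m 1\<^sub>m r)" "j < dim_col (?t 0 \<cdot>\<^sub>m 1\<^sub>m r)"
    hence ij: "i < r" "j < r" by auto
    have "ptr r M (kron (1\<^sub>m r) (actKi ?W' ^\<^sub>m (r - 1)) * ?f) $$ (i, j) =
      (\<Sum>k<M. qp r (- ?h k) ^ (r - 1) * ?f $$ (i * M + k, j * M + k))"
      unfolding ptr_def K using ij lt by (simp add: dgm_mult_entry[OF cf])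
    also have "\<dots> = (?t 0 \<cdot>\<^sub>m 1\<^sub>m r) $$ (i, j)"
    proof (cases "i = j")
      case True
      then show ?thesis using t[OF ij(1)] tri[OF ij(1)] ij by simp
    next
      case False
      have "?f $$ (i * M + k, j * M + k) = 0" if k: "k < M" for k
      proof (rule ccontr)
        assume "?f $$ (i * M + k, j * M + k) \<noteq> 0"
        hence "wt r a i + ?h k = wt r a j + ?h k"
          using intertwines_shifts[OF W f, unfolded shifts_def, rule_format, OF lt[OF ij(1) k] lt[OF ij(2) k]] k
          by simp
        thus False using False by (simp add: wt_def)
      qed
      thus ?thesis using False ij by simp
    qed
    finally show "ptr r M (kron (1\<^sub>m r) (actKi ?W' ^\<^sub>m (r - 1)) * ?f) $$ (i, j) = (?t 0 \<cdot>\<^sub>m 1\<^sub>m r) $$ (i, j)" .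
  qed (simp_all add: ptr_def)
  moreover have "c = d" if "c \<cdot>\<^sub>m 1\<^sub>m r = d \<cdot>\<^sub>m 1\<^sub>m r" for c d :: complex
    using arg_cong[OF that, of "\<lambda>X. X $$ (0, 0)"] rM by simp
  ultimately have "bracketT r a n w = ?t 0"
    unfolding bracketT_def M_def[symmetric] by (intro the_equality) auto
  thus ?thesis unfolding M_def[symmetric] N .
qed

theorem mainTheorem8:
  fixes r n :: nat and a :: complex and w :: "(nat \<times> bool) list"
  assumes "r \<ge> 2" and "n \<ge> 1"
    and "braid_word n w" and "closure_is_knot n w"
    and "\<forall>k\<in>{1..n}. of_nat k * a \<notin> \<int>"
  shows "Ninv r a n w =
    (\<Sum>m\<in>{0..(n-1)*(r-1)}.
       (let g = of_nat n * a + of_nat ((n-1)*(r-1)) - 2 * of_nat m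
        in mdim r g * chi r a n w g))"
proof -
  note r = assms(1)
  have a: "a \<notin> \<int>" and na: "of_nat n * a \<notin> \<int>"
    using assms(2) assms(5)[rule_format, of 1] assms(5)[rule_format, of n] by auto
  define M where "M = r ^ (n - 1)"
  define N where "N = r ^ n"
  let ?W' = "tpow (Vmod r a) (n - 1)" and ?W = "tpow (Vmod r a) n"
  let ?f = "braid_mat r a n w"
  have rM: "r * M = N" using assms(2) by (simp add: M_def N_def power_eq_if)
  have N: "N > 0" using r by (simp add: N_def)
  note U = umodule_Vmod[OF r, of a] and W' = umodule_tpow[OF r, of "n - 1" a, folded M_def]
  have Wn: "tens (Vmod r a) ?W' = ?W"
    using tpow_add[OF r, of a "Suc 0" "n - 1"] assms(2) by (simp add: tpow_1[OF r] del: tpow.simps)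
  define h where "h = wsum r a n"
  note W = umodule_tpow[OF r, of n a, folded N_def h_def]
  have h: "\<exists>s\<le>n * (r - 1). h i = of_nat n * (a + of_nat (r - 1)) - 2 * of_nat s" for i
    unfolding h_def using wsum_form[OF r] by blast
  have hZ: "h i \<notin> \<int>" for i
  proof
    assume "h i \<in> \<int>"
    moreover obtain s where "h i = of_nat n * (a + of_nat (r - 1)) - 2 * of_nat s" using h by blast
    ultimately have "of_nat n * a + of_int (int n * int (r - 1) - 2 * int s) \<in> \<int>"
      by (simp add: algebra_simps)
    hence "of_nat n * a + of_int (int n * int (r - 1) - 2 * int s) - of_int (int n * int (r - 1) - 2 * int s) \<in> \<int>"
      by (intro Ints_diff Ints_of_int)
    thus False using na by simp
  qed
  interpret wmod r "bl N (actE ?W)" "bl N (actF ?W)" "dgl N h" "h ` {..<N}"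
    by (rule umodule_wmod[OF r W])
  have f: "intertwines N ?W ?f" unfolding N_def by (rule braid_mat_intertwines[OF r assms(3)])
  have cf: "?f \<in> carrier_mat N N" and comm: "?f * actE ?W = actE ?W * ?f" "?f * actF ?W = actF ?W * ?f"
    "?f * actH ?W = actH ?W * ?f" "?f * actK ?W = actK ?W * ?f"
    using f unfolding intertwines_def by blast+
  note cW = umoduleD(2,3)[OF W]
  let ?b = "bl N ?f" and ?k = "kap r (r - 1)"
  let ?e = "kb r M (umat r 0 0) (piv r M (wsum r a (n - 1)))"
  have e: "(\<Sum>j<r. \<Sum>i<r. bl N (actE ?W) ^ (r - 1 - j) * bl N (actF ?W) ^ (r - 1 - i) * ?e *
      bl N (actF ?W) ^ i * bl N (actE ?W) ^ j) = sc (?k (a + of_nat r - 1))"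
    using conj_sum[OF r W', of a] unfolding Wn rM .
  have "tr N (?e * ?b) = ?k (a + of_nat r - 1) * tr N (?b * psi)"
  proof (rule tr_psi[OF N _ _ _ _ _ _ _ _ e])
    show "bl N (actE ?W) \<in> bls N" "bl N (actF ?W) \<in> bls N" "?b \<in> bls N" "\<And>g. dgl N h g \<in> bls N"
      using cW cf by (simp_all add: dgl_def)
    show "?e \<in> bls N" using r unfolding rM[symmetric] by (intro kb_bls) (auto simp: M_def)
    show "bl N (actE ?W) * ?b = ?b * bl N (actE ?W)" "bl N (actF ?W) * ?b = ?b * bl N (actF ?W)"
      using N cW cf comm by (simp_all add: bl_mult[symmetric])
  qed (use hZ in auto)
  hence br: "bracketT r a n w = ?k (a + of_nat r - 1) * tr N (?b * psi)"
    using bracketT_eq[OF r assms(2,3)] by (simp only: M_def N_def)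
  define g where "g m = of_nat n * a + of_nat ((n-1)*(r-1)) - 2 * (of_nat m :: complex)" for m :: nat
  \<comment> \<open>\<open>?x m\<close> is the highest weight of V_\<gamma> for \<gamma> = g m,
    which is where \<open>kap\<close> is to be evaluated.\<close>
  let ?x = "\<lambda>m. g m + of_nat r - 1" and ?I = "{0..(n-1)*(r-1)}"
  have nr: "n * (r - 1) = (n-1)*(r-1) + (r - 1)" using assms(2) by (cases n) auto
  have x: "?x m = of_nat n * (a + of_nat (r - 1)) - 2 * of_nat m" for m
  proof -
    have "(of_nat n * of_nat (r - 1) :: complex) = of_nat ((n-1)*(r-1)) + of_nat (r - 1)"
      unfolding of_nat_mult[symmetric] of_nat_add[symmetric] nr ..
    thus ?thesis using r by (simp add: g_def distrib_left of_nat_diff)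
  qed
  \<comment> \<open>Splits the function 1 / kap of H into its values at the possible highest
    weights. A weight y of depth s contributes only if y - 2(r - 1), of depth s + r - 1, is a weight
    as well; since depths are at most n(r - 1), this leaves s \<le> (n - 1)(r - 1).\<close>
  have "psi = prj * dgl N h (\<lambda>x. \<Sum>m\<in>?I. inverse (?k (?x m)) * (if x = ?x m then 1 else 0))"
    unfolding psi_def
  proof (rule prj_dg_cong)
    fix y assume y: "y \<in> h ` {..<N}" "y - 2 * of_nat (r - 1) \<in> h ` {..<N}"
    obtain s where s: "s \<le> n * (r - 1)" "y = of_nat n * (a + of_nat (r - 1)) - 2 * of_nat s" using y(1) h by (elim imageE) (simp only:, blast)
    obtain i where i: "y - 2 * of_nat (r - 1) = h i" using y(2) by (rule imageE)
    obtain s' where s': "s' \<le> n * (r - 1)" "y - 2 * of_nat (r - 1) = of_nat n * (a + of_nat (r - 1)) - 2 * of_nat s'"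
      unfolding i using h[of i] by (elim exE conjE)
    have "2 * of_nat s' = of_nat n * (a + of_nat (r - 1)) - (y - 2 * of_nat (r - 1))" using s'(2) by simp
    also have "\<dots> = 2 * of_nat (s + (r - 1))" unfolding s(2) by simp
    finally have "2 * of_nat s' = (2 * of_nat (s + (r - 1)) :: complex)" .
    hence "of_nat s' = (of_nat (s + (r - 1)) :: complex)"
      by (simp only: mult_left_cancel[OF zero_neq_numeral[symmetric]])
    hence "s' = s + (r - 1)" by (simp only: of_nat_eq_iff)
    hence sI: "s \<in> ?I" using s'(1) nr by simp
    have eq: "y = ?x m \<longleftrightarrow> m = s" for m unfolding x s(2) by auto
    have "(\<Sum>m\<in>?I. inverse (?k (?x m)) * (if y = ?x m then 1 else 0)) = (\<Sum>m\<in>?I. if m = s then inverse (?k y) else 0)"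
      unfolding eq by (intro sum.cong) (auto simp: eq[of s, simplified, symmetric])
    thus "inverse (?k y) = (\<Sum>m\<in>?I. inverse (?k (?x m)) * (if y = ?x m then 1 else 0))" using sI by simp
  qed
  also have "\<dots> = (\<Sum>m\<in>?I. prj * (sc (inverse (?k (?x m))) * dgl N h (\<lambda>x. if x = ?x m then 1 else 0)))"
    by (simp add: dg_sum sum_distrib_left dg_mult[symmetric] dg_const)
  also have "\<dots> = (\<Sum>m\<in>?I. sc (inverse (?k (?x m))) * (prj * dgl N h (\<lambda>x. if x = ?x m then 1 else 0)))"
    by (simp only: sc_left_commute[of prj])
  finally have psi: "psi = \<dots>" .
  have chi: "chi r a n w (g m) = tr N (?b * (prj * dgl N h (\<lambda>x. if x = ?x m then 1 else 0)))" for m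
    unfolding chi_def N_def[symmetric] by (rule trace_HomC[OF r W hZ cf comm])
  have tr: "tr N (?b * psi) = (\<Sum>m\<in>?I. inverse (?k (?x m)) * chi r a n w (g m))"
    unfolding psi sum_distrib_left tr_sum chi by (simp only: sc_left_commute[of ?b] tr_sc)
  obtain C where C: "\<And>y. y \<notin> \<int> \<Longrightarrow> mdim r y * ?k (y + of_nat r - 1) = C"
    using mdim_kap_const[OF r] by blast
  have xZ: "?x m \<notin> \<int>" "g m \<notin> \<int>" for m
  proof -
    show gZ: "g m \<notin> \<int>" for m
    proof
      assume "g m \<in> \<int>"
      hence "g m - of_int (int ((n-1)*(r-1)) - 2 * int m) \<in> \<int>" by (intro Ints_diff Ints_of_int)
      thus False using na by (simp add: g_def)
    qed
    show "?x m \<notin> \<int>"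
    proof
      assume "?x m \<in> \<int>"
      hence "?x m - of_int (int r - 1) \<in> \<int>" by (rule Ints_diff[OF _ Ints_of_int])
      thus False using gZ[of m] by simp
    qed
  qed
  have md: "mdim r a * ?k (a + of_nat r - 1) * inverse (?k (?x m)) = mdim r (g m)" for m
  proof -
    have "?k (?x m) \<noteq> 0" using kap_nz[OF r _ xZ(1)] r by simp
    thus ?thesis using C[OF a] C[OF xZ(2)[of m]] by (simp add: field_simps)
  qed
  have "Ninv r a n w = (\<Sum>m\<in>?I. mdim r a * ?k (a + of_nat r - 1) * inverse (?k (?x m)) * chi r a n w (g m))"
    unfolding Ninv_def br tr by (simp add: sum_distrib_left mult.assoc)
  thus ?thesis unfolding md by (simp add: Let_def g_def)
qed

end
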